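(* Fix a prime $p$. Let $G$ be a locally finite group, and let $M$ be a $\mathbb{Z}_{(p)}G$-module such that $C_G(M)$ contains an element of order $p$. Then $\Lambda^*(G;M)=0$ (i.e. $\Lambda^i(G;M)=0$ for all $i\ge0$).
   Context: A $p$-group is a group each of whose elements has (finite) $p$-power order. A group is locally finite if each of its finitely generated subgroups is finite. $\mathbb{Z}_{(p)}$ is the ring of integers localized at $p$, and $C_G(M)$ is the kernel of the action of $G$ on $M$ (the subgroup of elements acting trivially on $M$). Higher limits: for a small category $\mathcal{C}$, a $\mathcal{C}$-module is a functor $\mathcal{C}^{\mathrm{op}}\to\mathrm{Ab}$, and $\varprojlim^i_{\mathcal{C}}(\Phi)$ denotes the $i$-th right derived functor of the inverse limit functor on the category of $\mathcal{C}$-modules. Orbit categories: for a group $G$, $\mathcal{O}(G)$ is the category whose objects are the subgroups of $G$, with $\mathrm{Mor}_{\mathcal{O}(G)}(H,K)=\{Kg \mid g\in G,\ gHg^{-1}\le K\}$ and composition $Lx\circ Kg=Lxg$; write $[g]=Kg$. $\mathcal{O}_p(G)\subseteq\mathcal{O}(G)$ is the full subcategory whose objects are all $p$-subgroups of $G$. For a $\mathbb{Z}G$-module $M$, $F_M\colon\mathcal{O}_p(G)^{\mathrm{op}}\to\mathrm{Ab}$ is the functor with $F_M(P)=M$ if $P=1$ and $F_M(P)=0$ if $P\ne1$, where $\mathrm{Aut}_{\mathcal{O}_p(G)}(1)\cong G$ acts on $F_M(1)=M$ through the given action ($F_M([g])$ is multiplication by $g^{-1}$). Set $\Lambda^*(G;M)=\varprojlim^*_{\mathcal{O}_p(G)}(F_M)$.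 *)

theory Defs
  imports "HOL-Algebra.Algebra"
begin

section \<open>Small categories and modules over them\<close>

text \<open>Hom-sets are not required to be disjoint: a morphism is an element of a given hom-set, and
  composition is written in the usual order, \<open>cmp C g f\<close> being \<open>g\<close> after \<open>f\<close>.\<close>

record ('o, 'a) cat =
  Ob :: "'o set"
  Mor :: "'o \<Rightarrow> 'o \<Rightarrow> 'a set"
  cmp :: "'a \<Rightarrow> 'a \<Rightarrow> 'a"
  idt :: "'o \<Rightarrow> 'a"

locale category =
  fixes C :: "('o, 'a) cat"
  assumes idt_closed: "c \<in> Ob C \<Longrightarrow> idt C c \<in> Mor C c c"
    and cmp_closed: "\<lbrakk>c \<in> Ob C; d \<in> Ob C; e \<in> Ob C; f \<in> Mor C c d; g \<in> Mor C d e\<rbrakk>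
      \<Longrightarrow> cmp C g f \<in> Mor C c e"
    and cmp_idt: "\<lbrakk>c \<in> Ob C; d \<in> Ob C; f \<in> Mor C c d\<rbrakk> \<Longrightarrow> cmp C f (idt C c) = f"
    and idt_cmp: "\<lbrakk>c \<in> Ob C; d \<in> Ob C; f \<in> Mor C c d\<rbrakk> \<Longrightarrow> cmp C (idt C d) f = f"
    and cmp_assoc: "\<lbrakk>b \<in> Ob C; c \<in> Ob C; d \<in> Ob C; e \<in> Ob C;
        f \<in> Mor C b c; g \<in> Mor C c d; h \<in> Mor C d e\<rbrakk>
      \<Longrightarrow> cmp C h (cmp C g f) = cmp C (cmp C h g) f"

text \<open>Contravariant functors to abelian groups; the groups are written multiplicatively.
  For \<open>f \<in> Mor C c d\<close>, the map \<open>fmap F c d f\<close> goes from \<open>fobj F d\<close> to \<open>fobj F c\<close>.\<close>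

record ('o, 'a, 'x) cmod =
  fobj :: "'o \<Rightarrow> 'x monoid"
  fmap :: "'o \<Rightarrow> 'o \<Rightarrow> 'a \<Rightarrow> 'x \<Rightarrow> 'x"

locale cmodule = category C for C :: "('o, 'a) cat" +
  fixes F :: "('o, 'a, 'x) cmod"
  assumes fobj_group: "c \<in> Ob C \<Longrightarrow> comm_group (fobj F c)"
    and fmap_hom: "\<lbrakk>c \<in> Ob C; d \<in> Ob C; f \<in> Mor C c d\<rbrakk>
      \<Longrightarrow> fmap F c d f \<in> hom (fobj F d) (fobj F c)"
    and fmap_idt: "\<lbrakk>c \<in> Ob C; x \<in> carrier (fobj F c)\<rbrakk> \<Longrightarrow> fmap F c c (idt C c) x = x"
    and fmap_cmp: "\<lbrakk>c \<in> Ob C; d \<in> Ob C; e \<in> Ob C; f \<in> Mor C c d; g \<in> Mor C d e;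
        x \<in> carrier (fobj F e)\<rbrakk>
      \<Longrightarrow> fmap F c e (cmp C g f) x = fmap F c d f (fmap F d e g x)"

definition nat_trans ::
  "('o, 'a) cat \<Rightarrow> ('o, 'a, 'x) cmod \<Rightarrow> ('o, 'a, 'y) cmod \<Rightarrow> ('o \<Rightarrow> 'x \<Rightarrow> 'y) \<Rightarrow> bool"
where
  "nat_trans C F F' \<eta> \<longleftrightarrow>
     (\<forall>c\<in>Ob C. \<eta> c \<in> hom (fobj F c) (fobj F' c)) \<and>
     (\<forall>c\<in>Ob C. \<forall>d\<in>Ob C. \<forall>f\<in>Mor C c d. \<forall>x\<in>carrier (fobj F d).
        \<eta> c (fmap F c d f x) = fmap F' c d f (\<eta> d x))"

definition extends_along_monos ::
  "'t itself \<Rightarrow> ('o, 'a) cat \<Rightarrow> ('o, 'a, 'x) cmod \<Rightarrow> bool"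
where
  "extends_along_monos TYPE('t) C I \<longleftrightarrow>
     (\<forall>(A :: ('o, 'a, 't) cmod) (B :: ('o, 'a, 't) cmod) \<iota> \<phi>.
        cmodule C A \<longrightarrow> cmodule C B \<longrightarrow> nat_trans C A B \<iota> \<longrightarrow>
        (\<forall>c\<in>Ob C. inj_on (\<iota> c) (carrier (fobj A c))) \<longrightarrow> nat_trans C A I \<phi> \<longrightarrow>
        (\<exists>\<psi>. nat_trans C B I \<psi> \<and>
           (\<forall>c\<in>Ob C. \<forall>x\<in>carrier (fobj A c). \<psi> c (\<iota> c x) = \<phi> c x)))"

text \<open>An injective object must have the extension property against all monomorphisms of modules,
  whereas a definition can only quantify over modules with carriers in one type.
  The type \<open>'a \<Rightarrow>\<^sub>0 int\<close> (with \<open>'a\<close> the type of morphisms) is large enough, since it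
  accommodates the representable modules \<open>\<int>[Mor(-,c)]\<close> and their submodules. The lemma
  \<open>injective_cmodule_extends\<close> below derives the property for all other carrier types.\<close>

definition injective_cmodule :: "('o, 'a) cat \<Rightarrow> ('o, 'a, 'x) cmod \<Rightarrow> bool" where
  "injective_cmodule C I \<longleftrightarrow> cmodule C I \<and> extends_along_monos TYPE('a \<Rightarrow>\<^sub>0 int) C I"


section \<open>Higher limits\<close>

locale injective_resolution = cmodule C F
  for C :: "('o, 'a) cat" and F :: "('o, 'a, 'x) cmod" +
  fixes I :: "nat \<Rightarrow> ('o, 'a, 'y) cmod"
    and \<delta> :: "nat \<Rightarrow> 'o \<Rightarrow> 'y \<Rightarrow> 'y"
    and \<epsilon> :: "'o \<Rightarrow> 'x \<Rightarrow> 'y"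
  assumes injective: "injective_cmodule C (I n)"
    and aug_nat: "nat_trans C F (I 0) \<epsilon>"
    and diff_nat: "nat_trans C (I n) (I (Suc n)) (\<delta> n)"
    and aug_inj: "c \<in> Ob C \<Longrightarrow> inj_on (\<epsilon> c) (carrier (fobj F c))"
    and exact_0: "c \<in> Ob C \<Longrightarrow>
      \<epsilon> c ` carrier (fobj F c) = kernel (fobj (I 0) c) (fobj (I 1) c) (\<delta> 0 c)"
    and exact_Suc: "c \<in> Ob C \<Longrightarrow>
      \<delta> n c ` carrier (fobj (I n) c) =
        kernel (fobj (I (Suc n)) c) (fobj (I (Suc (Suc n))) c) (\<delta> (Suc n) c)"

definition inv_lim :: "('o, 'a) cat \<Rightarrow> ('o, 'a, 'x) cmod \<Rightarrow> ('o \<Rightarrow> 'x) monoid" where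
  "inv_lim C F = (product_group (Ob C) (fobj F))
     \<lparr>carrier := {x \<in> carrier (product_group (Ob C) (fobj F)).
        \<forall>c\<in>Ob C. \<forall>d\<in>Ob C. \<forall>f\<in>Mor C c d. fmap F c d f (x d) = x c}\<rparr>"

definition inv_lim_map :: "('o, 'a) cat \<Rightarrow> ('o \<Rightarrow> 'x \<Rightarrow> 'y) \<Rightarrow> ('o \<Rightarrow> 'x) \<Rightarrow> ('o \<Rightarrow> 'y)" where
  "inv_lim_map C \<eta> x = (\<lambda>c\<in>Ob C. \<eta> c (x c))"

text \<open>The cohomology in degree \<open>i\<close> of the cochain complex obtained by applying the inverse
  limit to \<open>I 0 \<rightarrow> I 1 \<rightarrow> \<dots>\<close>. If \<open>(I, \<delta>)\<close> is part of an injective resolution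
  of \<open>F\<close>, this is the value at \<open>F\<close> of the \<open>i\<close>-th right derived functor of the inverse
  limit.\<close>

definition higher_lim ::
  "('o, 'a) cat \<Rightarrow> (nat \<Rightarrow> ('o, 'a, 'y) cmod) \<Rightarrow> (nat \<Rightarrow> 'o \<Rightarrow> 'y \<Rightarrow> 'y) \<Rightarrow> nat
    \<Rightarrow> ('o \<Rightarrow> 'y) set monoid"
where
  "higher_lim C I \<delta> i =
     (inv_lim C (I i))\<lparr>carrier := kernel (inv_lim C (I i)) (inv_lim C (I (Suc i))) (inv_lim_map C (\<delta> i))\<rparr>
     Mod (case i of 0 \<Rightarrow> {\<one>\<^bsub>inv_lim C (I 0)\<^esub>}
          | Suc j \<Rightarrow> inv_lim_map C (\<delta> j) ` carrier (inv_lim C (I j)))"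


section \<open>The orbit category of \<open>p\<close>-subgroups\<close>

definition p_group :: "nat \<Rightarrow> ('g, 'z) monoid_scheme \<Rightarrow> bool" where
  "p_group p G \<longleftrightarrow> group G \<and> (\<forall>x\<in>carrier G. \<exists>n. group.ord G x = p ^ n)"

definition locally_finite_group :: "('g, 'z) monoid_scheme \<Rightarrow> bool" where
  "locally_finite_group G \<longleftrightarrow>
     group G \<and> (\<forall>S. finite S \<and> S \<subseteq> carrier G \<longrightarrow> finite (generate G S))"

text \<open>The composite of \<open>K #> g\<close> and \<open>L #> x\<close> is \<open>L #> (x \<otimes> g)\<close>, which is the product
  of the two cosets as subsets of \<open>G\<close>; see \<open>orbit_cat_cmp\<close> below.\<close>

definition p_orbit_cat :: "nat \<Rightarrow> ('g, 'z) monoid_scheme \<Rightarrow> ('g set, 'g set) cat" where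
  "p_orbit_cat p G =
     \<lparr>Ob = {P. subgroup P G \<and> p_group p (G\<lparr>carrier := P\<rparr>)},
      Mor = (\<lambda>H K. {K #>\<^bsub>G\<^esub> g | g. g \<in> carrier G \<and>
                      (\<lambda>h. g \<otimes>\<^bsub>G\<^esub> h \<otimes>\<^bsub>G\<^esub> inv\<^bsub>G\<^esub> g) ` H \<subseteq> K}),
      cmp = (\<lambda>S T. S <#>\<^bsub>G\<^esub> T),
      idt = (\<lambda>H. H)\<rparr>"


section \<open>Modules with group action and the functor \<open>F\<^sub>M\<close>\<close>

definition localized_int :: "nat \<Rightarrow> rat ring" where
  "localized_int p =
     \<lparr>carrier = {of_int a / of_int b | a b. \<not> int p dvd b},
      monoid.mult = times, one = 1, ring.zero = 0, ring.add = plus\<rparr>"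

locale group_ring_module = module R M + G: group G
  for R :: "('r, 'v) ring_scheme" and G :: "('g, 'z) monoid_scheme"
    and M :: "('r, 'm, 'w) module_scheme" +
  fixes act :: "'g \<Rightarrow> 'm \<Rightarrow> 'm"
  assumes act_closed: "\<lbrakk>g \<in> carrier G; m \<in> carrier M\<rbrakk> \<Longrightarrow> act g m \<in> carrier M"
    and act_add: "\<lbrakk>g \<in> carrier G; m \<in> carrier M; n \<in> carrier M\<rbrakk>
      \<Longrightarrow> act g (m \<oplus>\<^bsub>M\<^esub> n) = act g m \<oplus>\<^bsub>M\<^esub> act g n"
    and act_smult: "\<lbrakk>g \<in> carrier G; r \<in> carrier R; m \<in> carrier M\<rbrakk>
      \<Longrightarrow> act g (r \<odot>\<^bsub>M\<^esub> m) = r \<odot>\<^bsub>M\<^esub> act g m"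
    and act_one: "m \<in> carrier M \<Longrightarrow> act \<one>\<^bsub>G\<^esub> m = m"
    and act_mult: "\<lbrakk>g \<in> carrier G; h \<in> carrier G; m \<in> carrier M\<rbrakk>
      \<Longrightarrow> act (g \<otimes>\<^bsub>G\<^esub> h) m = act g (act h m)"

definition action_kernel ::
  "('g, 'z) monoid_scheme \<Rightarrow> ('r, 'm, 'w) module_scheme \<Rightarrow> ('g \<Rightarrow> 'm \<Rightarrow> 'm) \<Rightarrow> 'g set"
where
  "action_kernel G M act = {g \<in> carrier G. \<forall>m\<in>carrier M. act g m = m}"

text \<open>A morphism \<open>S\<close> from the trivial subgroup to itself is a coset \<open>{g}\<close>, so that
  \<open>the_elem S = g\<close>.\<close>

definition atomic_functor ::
  "('g, 'z) monoid_scheme \<Rightarrow> ('r, 'm, 'w) module_scheme \<Rightarrow> ('g \<Rightarrow> 'm \<Rightarrow> 'm)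
    \<Rightarrow> ('g set, 'g set, 'm) cmod"
where
  "atomic_functor G M act =
     \<lparr>fobj = (\<lambda>P. \<lparr>carrier = (if P = {\<one>\<^bsub>G\<^esub>} then carrier M else {\<zero>\<^bsub>M\<^esub>}),
                   monoid.mult = add M, one = \<zero>\<^bsub>M\<^esub>\<rparr>),
      fmap = (\<lambda>P Q S m. if P = {\<one>\<^bsub>G\<^esub>} \<and> Q = {\<one>\<^bsub>G\<^esub>}
                        then act (inv\<^bsub>G\<^esub> (the_elem S)) m else \<zero>\<^bsub>M\<^esub>)\<rparr>"


section \<open>Injectivity does not depend on the carrier type of the test modules\<close>

lemma free_Abelian_group_hom_eq:
  assumes "comm_group H" "g \<in> hom (free_Abelian_group S) H" "h \<in> hom (free_Abelian_group S) H"
    and eq: "\<And>s. s \<in> S \<Longrightarrow> g (frag_of s) = h (frag_of s)"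
    and x: "Poly_Mapping.keys x \<subseteq> S"
  shows "g x = h x"
proof -
  interpret H: comm_group H by fact
  interpret g: group_hom "free_Abelian_group S" H g
    by (simp add: group_hom_def group_hom_axioms_def assms H.is_group)
  interpret h: group_hom "free_Abelian_group S" H h
    by (simp add: group_hom_def group_hom_axioms_def assms H.is_group)
  show ?thesis
    using x
  proof (induction x rule: free_Abelian_group_induct[consumes 1, case_names zero diff of])
    case zero
    then show ?case using g.hom_one h.hom_one by simp
  next
    case (diff x y)
    have "g (x - y) = g (x \<otimes>\<^bsub>free_Abelian_group S\<^esub> inv\<^bsub>free_Abelian_group S\<^esub> y)"
      using diff by simp
    also have "\<dots> = g x \<otimes>\<^bsub>H\<^esub> inv\<^bsub>H\<^esub> g y"
      using diff by (metis carrier_free_Abelian_group_iff g.hom_inv g.hom_mult group.inv_closed group_free_Abelian_group)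
    also have "\<dots> = h (x \<otimes>\<^bsub>free_Abelian_group S\<^esub> inv\<^bsub>free_Abelian_group S\<^esub> y)"
      using diff by (metis carrier_free_Abelian_group_iff h.hom_inv h.hom_mult group.inv_closed group_free_Abelian_group)
    finally show ?case using diff by simp
  qed (use eq in auto)
qed

definition representable :: "('o, 'a) cat \<Rightarrow> 'o \<Rightarrow> ('o, 'a, 'a \<Rightarrow>\<^sub>0 int) cmod" where
  "representable C e =
     \<lparr>fobj = (\<lambda>c. free_Abelian_group (Mor C c e)),
      fmap = (\<lambda>c d f. frag_extend (\<lambda>g. frag_of (cmp C g f)))\<rparr>"

lemma frag_extend_hom:
  assumes "\<And>s. s \<in> S \<Longrightarrow> Poly_Mapping.keys (\<phi> s) \<subseteq> T"
  shows "frag_extend \<phi> \<in> hom (free_Abelian_group S) (free_Abelian_group T)"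
proof (rule homI)
  fix x assume "x \<in> carrier (free_Abelian_group S)"
  then show "frag_extend \<phi> x \<in> carrier (free_Abelian_group T)"
    using assms keys_frag_extend[of \<phi> x] by fastforce
qed (simp add: frag_extend_add)

lemma (in category) cmodule_representable:
  assumes e: "e \<in> Ob C"
  shows "cmodule C (representable C e)"
proof (intro cmodule.intro cmodule_axioms.intro)
  show "category C" ..
next
  fix c assume c: "c \<in> Ob C"
  show "comm_group (fobj (representable C e) c)"
    by (simp add: representable_def abelian_free_Abelian_group)
  fix x assume "x \<in> carrier (fobj (representable C e) c)"
  then have x: "Poly_Mapping.keys x \<subseteq> Mor C c e" by (simp add: representable_def)
  have "frag_extend (\<lambda>g. frag_of (cmp C g (idt C c))) x = frag_extend frag_of x"
    by (rule frag_extend_eq) (use x e c cmp_idt in auto)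
  then show "fmap (representable C e) c c (idt C c) x = x"
    by (simp add: representable_def flip: frag_expansion)
next
  fix c d f assume "c \<in> Ob C" "d \<in> Ob C" "f \<in> Mor C c d"
  then show "fmap (representable C e) c d f
      \<in> hom (fobj (representable C e) d) (fobj (representable C e) c)"
    unfolding representable_def using e cmp_closed by (auto intro!: frag_extend_hom)
next
  fix c d d' f g x
  assume *: "c \<in> Ob C" "d \<in> Ob C" "d' \<in> Ob C" "f \<in> Mor C c d" "g \<in> Mor C d d'"
    and "x \<in> carrier (fobj (representable C e) d')"
  then have x: "Poly_Mapping.keys x \<subseteq> Mor C d' e" by (simp add: representable_def)
  have "frag_extend (\<lambda>h. frag_of (cmp C h (cmp C g f))) x
      = frag_extend ((\<lambda>k. frag_of (cmp C k f)) \<circ> (\<lambda>h. cmp C h g)) x"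
    by (rule frag_extend_eq) (use x * e cmp_assoc in auto)
  also have "\<dots> = frag_extend (\<lambda>k. frag_of (cmp C k f)) (frag_extend (frag_of \<circ> (\<lambda>h. cmp C h g)) x)"
    by (simp only: frag_extend_compose)
  finally show "fmap (representable C e) c d' (cmp C g f) x
      = fmap (representable C e) c d f (fmap (representable C e) d d' g x)"
    by (simp add: representable_def comp_def)
qed

lemma (in cmodule) yoneda:
  assumes e: "e \<in> Ob C" and b: "b \<in> carrier (fobj F e)"
  obtains \<beta> where "nat_trans C (representable C e) F \<beta>" "\<beta> e (frag_of (idt C e)) = b"
proof -
  have "\<exists>h. h \<in> hom (free_Abelian_group (Mor C c e)) (fobj F c) \<and>
      (\<forall>f\<in>Mor C c e. h (frag_of f) = fmap F c e f b)" if c: "c \<in> Ob C" for c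
  proof -
    interpret comm_group "fobj F c" using c by (rule fobj_group)
    have "(\<lambda>f. fmap F c e f b) ` Mor C c e \<subseteq> carrier (fobj F c)"
      using fmap_hom[OF c e] b by (auto simp: hom_def)
    from free_Abelian_group_universal[OF this] show ?thesis by metis
  qed
  then obtain \<beta> where \<beta>: "\<And>c. c \<in> Ob C \<Longrightarrow> \<beta> c \<in> hom (free_Abelian_group (Mor C c e)) (fobj F c)"
    "\<And>c f. \<lbrakk>c \<in> Ob C; f \<in> Mor C c e\<rbrakk> \<Longrightarrow> \<beta> c (frag_of f) = fmap F c e f b"
    by metis
  have "\<beta> c (fmap (representable C e) c d f x) = fmap F c d f (\<beta> d x)"
    if *: "c \<in> Ob C" "d \<in> Ob C" "f \<in> Mor C c d" and x: "Poly_Mapping.keys x \<subseteq> Mor C d e" for c d f x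
  proof -
    let ?r = "frag_extend (\<lambda>g. frag_of (cmp C g f))"
    have r: "?r \<in> hom (free_Abelian_group (Mor C d e)) (free_Abelian_group (Mor C c e))"
      by (rule frag_extend_hom) (use * e cmp_closed in auto)
    have "(\<beta> c \<circ> ?r) x = (fmap F c d f \<circ> \<beta> d) x"
    proof (rule free_Abelian_group_hom_eq[OF fobj_group[OF *(1)]])
      show "\<beta> c \<circ> ?r \<in> hom (free_Abelian_group (Mor C d e)) (fobj F c)"
        using r \<beta>(1)[OF *(1)] by (rule hom_compose)
      show "fmap F c d f \<circ> \<beta> d \<in> hom (free_Abelian_group (Mor C d e)) (fobj F c)"
        using \<beta>(1)[OF *(2)] fmap_hom[OF *] by (rule hom_compose)
      fix g assume g: "g \<in> Mor C d e"
      then show "(\<beta> c \<circ> ?r) (frag_of g) = (fmap F c d f \<circ> \<beta> d) (frag_of g)"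
        using * e b \<beta>(2) cmp_closed[OF *(1,2) e *(3) g] fmap_cmp[OF *(1,2) e *(3) g b] by simp
    qed (use x in auto)
    then show ?thesis by (simp add: representable_def)
  qed
  then have "nat_trans C (representable C e) F \<beta>"
    using \<beta>(1) by (simp add: nat_trans_def representable_def)
  moreover have "\<beta> e (frag_of (idt C e)) = b"
    using \<beta>(2)[OF e] idt_closed[OF e] fmap_idt[OF e b] by simp
  ultimately show ?thesis using that by blast
qed

text \<open>Baer's argument: partial extensions are represented by their graphs, and a maximal one is
  enlarged by extending a map from a submodule of a representable module.\<close>

definition partial_ext where
  "partial_ext C A B I \<iota> \<phi> R \<longleftrightarrow>
     R \<subseteq> {(c, b, y). c \<in> Ob C \<and> b \<in> carrier (fobj B c) \<and> y \<in> carrier (fobj I c)} \<and>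
     (\<forall>c y. (c, \<one>\<^bsub>fobj B c\<^esub>, y) \<in> R \<longrightarrow> y = \<one>\<^bsub>fobj I c\<^esub>) \<and>
     (\<forall>c b y b' y'. (c, b, y) \<in> R \<longrightarrow> (c, b', y') \<in> R \<longrightarrow>
        (c, b \<otimes>\<^bsub>fobj B c\<^esub> b', y \<otimes>\<^bsub>fobj I c\<^esub> y') \<in> R) \<and>
     (\<forall>c b y. (c, b, y) \<in> R \<longrightarrow> (c, inv\<^bsub>fobj B c\<^esub> b, inv\<^bsub>fobj I c\<^esub> y) \<in> R) \<and>
     (\<forall>c d f b y. c \<in> Ob C \<longrightarrow> f \<in> Mor C c d \<longrightarrow> (d, b, y) \<in> R \<longrightarrow>
        (c, fmap B c d f b, fmap I c d f y) \<in> R) \<and>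
     (\<forall>c\<in>Ob C. \<forall>x\<in>carrier (fobj A c). (c, \<iota> c x, \<phi> c x) \<in> R)"

lemma partial_ext_functional:
  assumes R: "partial_ext C A B I \<iota> \<phi> R" and "cmodule C B" "cmodule C I"
    and 1: "(c, b, y) \<in> R" and 2: "(c, b, y') \<in> R"
  shows "y = y'"
proof -
  have c: "c \<in> Ob C" and b: "b \<in> carrier (fobj B c)"
    and y: "y \<in> carrier (fobj I c)" "y' \<in> carrier (fobj I c)"
    using R 1 2 by (auto simp: partial_ext_def)
  interpret B: comm_group "fobj B c" using assms(2) c by (rule cmodule.fobj_group)
  interpret I: comm_group "fobj I c" using assms(3) c by (rule cmodule.fobj_group)
  have "(c, b \<otimes>\<^bsub>fobj B c\<^esub> inv\<^bsub>fobj B c\<^esub> b, y \<otimes>\<^bsub>fobj I c\<^esub> inv\<^bsub>fobj I c\<^esub> y') \<in> R"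
    using R 1 2 by (simp add: partial_ext_def)
  then have "y \<otimes>\<^bsub>fobj I c\<^esub> inv\<^bsub>fobj I c\<^esub> y' = \<one>\<^bsub>fobj I c\<^esub>"
    using R b by (simp add: partial_ext_def)
  then show ?thesis using y
    by (metis I.inv_closed I.inv_equality I.inv_inv)
qed

lemma partial_ext_union:
  assumes "cmodule C A" "cmodule C B" and inj: "injective_cmodule C I"
    and R: "partial_ext C A B I \<iota> \<phi> R" and e: "e \<in> Ob C" and b0: "b0 \<in> carrier (fobj B e)"
  shows "\<exists>R' y0. partial_ext C A B I \<iota> \<phi> R' \<and> R \<subseteq> R' \<and> (e, b0, y0) \<in> R'"
proof -
  interpret A: cmodule C A by fact
  interpret B: cmodule C B by fact
  interpret I: cmodule C I using inj by (simp add: injective_cmodule_def)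
  let ?P = "representable C e"
  interpret P: cmodule C ?P using e by (rule A.cmodule_representable)
  have R_carr: "c \<in> Ob C" "b \<in> carrier (fobj B c)" "y \<in> carrier (fobj I c)"
    if "(c, b, y) \<in> R" for c b y
  proof -
    have "R \<subseteq> {(c, b, y). c \<in> Ob C \<and> b \<in> carrier (fobj B c) \<and> y \<in> carrier (fobj I c)}"
      using R by (simp add: partial_ext_def)
    with that show "c \<in> Ob C" "b \<in> carrier (fobj B c)" "y \<in> carrier (fobj I c)" by blast+
  qed
  have R_fun: "y = y'" if "(c, b, y) \<in> R" "(c, b, y') \<in> R" for c b y y'
    using partial_ext_functional[OF R assms(2) I.cmodule_axioms that] .
  have R_mult: "(c, b \<otimes>\<^bsub>fobj B c\<^esub> b', y \<otimes>\<^bsub>fobj I c\<^esub> y') \<in> R"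
    if "(c, b, y) \<in> R" "(c, b', y') \<in> R" for c b y b' y'
    using R that by (simp add: partial_ext_def)
  have R_inv: "(c, inv\<^bsub>fobj B c\<^esub> b, inv\<^bsub>fobj I c\<^esub> y) \<in> R" if "(c, b, y) \<in> R" for c b y
    using R that by (simp add: partial_ext_def)
  have R_map: "(c, fmap B c d f b, fmap I c d f y) \<in> R"
    if "c \<in> Ob C" "f \<in> Mor C c d" "(d, b, y) \<in> R" for c d f b y
    using R that by (simp add: partial_ext_def)
  have R_A: "(c, \<iota> c x, \<phi> c x) \<in> R" if "c \<in> Ob C" "x \<in> carrier (fobj A c)" for c x
    using R that by (simp add: partial_ext_def)
  have R_one: "(c, \<one>\<^bsub>fobj B c\<^esub>, \<one>\<^bsub>fobj I c\<^esub>) \<in> R" if c: "c \<in> Ob C" for c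
  proof -
    interpret Ac: comm_group "fobj A c" using c by (rule A.fobj_group)
    interpret Bc: comm_group "fobj B c" using c by (rule B.fobj_group)
    interpret Ic: comm_group "fobj I c" using c by (rule I.fobj_group)
    have 1: "(c, \<iota> c \<one>\<^bsub>fobj A c\<^esub>, \<phi> c \<one>\<^bsub>fobj A c\<^esub>) \<in> R"
      using R_A c by simp
    show ?thesis
      using R_mult[OF 1 R_inv[OF 1]] R_carr[OF 1] by simp
  qed
  obtain \<beta> where \<beta>: "nat_trans C ?P B \<beta>" "\<beta> e (frag_of (idt C e)) = b0"
    using B.yoneda[OF e b0] .
  have \<beta>_hom: "\<beta> c \<in> hom (fobj ?P c) (fobj B c)" if "c \<in> Ob C" for c
    using \<beta> that by (simp add: nat_trans_def)
  have \<beta>_nat: "\<beta> c (fmap ?P c d f x) = fmap B c d f (\<beta> d x)"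
    if "c \<in> Ob C" "d \<in> Ob C" "f \<in> Mor C c d" "x \<in> carrier (fobj ?P d)" for c d f x
    using \<beta> that by (simp add: nat_trans_def)
  have \<beta>_group: "group_hom (fobj ?P c) (fobj B c) (\<beta> c)" if c: "c \<in> Ob C" for c
  proof (intro group_hom.intro group_hom_axioms.intro)
    show "group (fobj ?P c)" using P.fobj_group[OF c] by (rule comm_group.axioms)
    show "group (fobj B c)" using B.fobj_group[OF c] by (rule comm_group.axioms)
  qed (rule \<beta>_hom[OF c])

  define D where "D c = {x \<in> carrier (fobj ?P c). \<exists>y. (c, \<beta> c x, y) \<in> R}" for c
  define J where "J = \<lparr>fobj = (\<lambda>c. (fobj ?P c)\<lparr>carrier := D c\<rparr>), fmap = fmap ?P\<rparr>"
  define g where "g = (\<lambda>c x. THE y. (c, \<beta> c x, y) \<in> R)"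
  have g: "(c, \<beta> c x, g c x) \<in> R" if "x \<in> D c" for c x
    unfolding g_def
  proof (rule theI')
    show "\<exists>!y. (c, \<beta> c x, y) \<in> R" using that R_fun unfolding D_def by blast
  qed
  have g_eq: "g c x = y" if "(c, \<beta> c x, y) \<in> R" for c x y
    unfolding g_def using that R_fun by blast
  have D_sub: "subgroup (D c) (fobj ?P c)" if c: "c \<in> Ob C" for c
  proof -
    interpret \<beta>c: group_hom "fobj ?P c" "fobj B c" "\<beta> c" using c by (rule \<beta>_group)
    show ?thesis
    proof (rule \<beta>c.G.subgroupI)
      show "D c \<noteq> {}" using R_one[OF c] \<beta>c.hom_one \<beta>c.G.one_closed unfolding D_def
        by (metis (mono_tags, lifting) empty_iff mem_Collect_eq)
    qed (auto simp: D_def intro: R_inv R_mult)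
  qed
  have J: "cmodule C J"
  proof (intro cmodule.intro cmodule_axioms.intro)
    show "category C" ..
    fix c assume c: "c \<in> Ob C"
    interpret Pc: comm_group "fobj ?P c" using c by (rule P.fobj_group)
    show "comm_group (fobj J c)"
    proof (rule group.group_comm_groupI)
      show "group (fobj J c)"
        using subgroup.subgroup_is_group[OF D_sub[OF c] Pc.is_group] by (simp add: J_def)
    qed (simp add: J_def D_def Pc.m_comm)
    show "fmap J c c (idt C c) x = x" if "x \<in> carrier (fobj J c)" for x
      using that P.fmap_idt c by (simp add: J_def D_def)
  next
    fix c d f assume *: "c \<in> Ob C" "d \<in> Ob C" "f \<in> Mor C c d"
    have "fmap ?P c d f x \<in> D c" if x: "x \<in> D d" for x
    proof -
      have "(c, \<beta> c (fmap ?P c d f x), fmap I c d f (g d x)) \<in> R"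
        using R_map[OF *(1,3) g[OF x]] \<beta>_nat[OF *] x by (simp add: D_def)
      then show ?thesis using P.fmap_hom[OF *] x by (auto simp: D_def hom_def)
    qed
    then show "fmap J c d f \<in> hom (fobj J d) (fobj J c)"
      using P.fmap_hom[OF *] by (auto simp: J_def hom_def D_def)
  next
    fix c d e' f h x
    assume "c \<in> Ob C" "d \<in> Ob C" "e' \<in> Ob C" "f \<in> Mor C c d" "h \<in> Mor C d e'"
      "x \<in> carrier (fobj J e')"
    then show "fmap J c e' (cmp C h f) x = fmap J c d f (fmap J d e' h x)"
      using P.fmap_cmp by (simp add: J_def D_def)
  qed
  have "nat_trans C J ?P (\<lambda>c x. x)"
    by (auto simp: nat_trans_def J_def hom_def D_def)
  moreover have "nat_trans C J I g"
    unfolding nat_trans_def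
  proof (intro conjI ballI homI)
    fix c x y assume c: "c \<in> Ob C" and xy: "x \<in> carrier (fobj J c)" "y \<in> carrier (fobj J c)"
    interpret \<beta>c: group_hom "fobj ?P c" "fobj B c" "\<beta> c" using c by (rule \<beta>_group)
    have "x \<in> D c" "y \<in> D c" using xy by (auto simp: J_def)
    then have "(c, \<beta> c (x \<otimes>\<^bsub>fobj ?P c\<^esub> y), g c x \<otimes>\<^bsub>fobj I c\<^esub> g c y) \<in> R"
      using R_mult[OF g g] by (simp add: D_def)
    then show "g c (x \<otimes>\<^bsub>fobj J c\<^esub> y) = g c x \<otimes>\<^bsub>fobj I c\<^esub> g c y"
      using g_eq by (simp add: J_def)
  next
    fix c x assume "c \<in> Ob C" "x \<in> carrier (fobj J c)"
    then show "g c x \<in> carrier (fobj I c)" using g R_carr by (simp add: J_def) blast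
  next
    fix c d f x assume *: "c \<in> Ob C" "d \<in> Ob C" "f \<in> Mor C c d" and "x \<in> carrier (fobj J d)"
    then have x: "x \<in> D d" by (simp add: J_def)
    have "(c, \<beta> c (fmap ?P c d f x), fmap I c d f (g d x)) \<in> R"
      using R_map[OF *(1,3) g[OF x]] \<beta>_nat[OF *] x by (simp add: D_def)
    then show "g c (fmap J c d f x) = fmap I c d f (g d x)"
      using g_eq by (simp add: J_def)
  qed
  ultimately obtain h where h: "nat_trans C ?P I h"
    and hg: "\<And>c x. \<lbrakk>c \<in> Ob C; x \<in> D c\<rbrakk> \<Longrightarrow> h c x = g c x"
  proof -
    assume *: "nat_trans C J ?P (\<lambda>c x. x)" "nat_trans C J I g"
    have "\<exists>\<psi>. nat_trans C ?P I \<psi> \<and> (\<forall>c\<in>Ob C. \<forall>x\<in>carrier (fobj J c). \<psi> c x = g c x)"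
      using inj[unfolded injective_cmodule_def extends_along_monos_def] J P.cmodule_axioms *
      by (auto simp: inj_on_def)
    then show ?thesis using that by (auto simp: J_def)
  qed
  have h_hom: "h c \<in> hom (fobj ?P c) (fobj I c)" if "c \<in> Ob C" for c
    using h that by (simp add: nat_trans_def)
  have h_nat: "h c (fmap ?P c d f x) = fmap I c d f (h d x)"
    if "c \<in> Ob C" "d \<in> Ob C" "f \<in> Mor C c d" "x \<in> carrier (fobj ?P d)" for c d f x
    using h that by (simp add: nat_trans_def)
  have h_group: "group_hom (fobj ?P c) (fobj I c) (h c)" if c: "c \<in> Ob C" for c
  proof (intro group_hom.intro group_hom_axioms.intro)
    show "group (fobj ?P c)" using P.fobj_group[OF c] by (rule comm_group.axioms)
    show "group (fobj I c)" using I.fobj_group[OF c] by (rule comm_group.axioms)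
  qed (rule h_hom[OF c])

  define R' where "R' = {(c, b \<otimes>\<^bsub>fobj B c\<^esub> \<beta> c x, y \<otimes>\<^bsub>fobj I c\<^esub> h c x) | c b y x.
    (c, b, y) \<in> R \<and> x \<in> carrier (fobj ?P c)}"
  have R'I: "(c, b', y') \<in> R'"
    if "(c, b, y) \<in> R" "x \<in> carrier (fobj ?P c)" "b' = b \<otimes>\<^bsub>fobj B c\<^esub> \<beta> c x" "y' = y \<otimes>\<^bsub>fobj I c\<^esub> h c x"
    for c b y x b' y'
    using that unfolding R'_def by blast
  have R'E: thesis
    if "(c, b', y') \<in> R'"
      "\<And>b y x. \<lbrakk>c \<in> Ob C; (c, b, y) \<in> R; x \<in> carrier (fobj ?P c); b' = b \<otimes>\<^bsub>fobj B c\<^esub> \<beta> c x;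
         y' = y \<otimes>\<^bsub>fobj I c\<^esub> h c x\<rbrakk> \<Longrightarrow> thesis"
    for c b' y' thesis
    using that R_carr unfolding R'_def by blast
  have sub: "R \<subseteq> R'"
  proof clarify
    fix c b y assume cby: "(c, b, y) \<in> R"
    then have c: "c \<in> Ob C" by (rule R_carr)
    interpret \<beta>c: group_hom "fobj ?P c" "fobj B c" "\<beta> c" using c by (rule \<beta>_group)
    interpret hc: group_hom "fobj ?P c" "fobj I c" "h c" using c by (rule h_group)
    show "(c, b, y) \<in> R'"
      by (rule R'I[OF cby \<beta>c.G.one_closed]) (use R_carr[OF cby] in auto)
  qed
  have "partial_ext C A B I \<iota> \<phi> R'"
    unfolding partial_ext_def
  proof (intro conjI allI impI ballI)
    show "R' \<subseteq> {(c, b, y). c \<in> Ob C \<and> b \<in> carrier (fobj B c) \<and> y \<in> carrier (fobj I c)}"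
    proof clarify
      fix c b' y' assume "(c, b', y') \<in> R'"
      then show "c \<in> Ob C \<and> b' \<in> carrier (fobj B c) \<and> y' \<in> carrier (fobj I c)"
      proof (rule R'E)
        fix b y x
        assume c: "c \<in> Ob C" and *: "(c, b, y) \<in> R" "x \<in> carrier (fobj ?P c)"
          "b' = b \<otimes>\<^bsub>fobj B c\<^esub> \<beta> c x" "y' = y \<otimes>\<^bsub>fobj I c\<^esub> h c x"
        interpret \<beta>c: group_hom "fobj ?P c" "fobj B c" "\<beta> c" using c by (rule \<beta>_group)
        interpret hc: group_hom "fobj ?P c" "fobj I c" "h c" using c by (rule h_group)
        show ?thesis using c * R_carr[OF *(1)] by simp
      qed
    qed
  next
    fix c y' assume "(c, \<one>\<^bsub>fobj B c\<^esub>, y') \<in> R'"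
    then show "y' = \<one>\<^bsub>fobj I c\<^esub>"
    proof (rule R'E)
      fix b y x
      assume c: "c \<in> Ob C" and *: "(c, b, y) \<in> R" "x \<in> carrier (fobj ?P c)"
        "\<one>\<^bsub>fobj B c\<^esub> = b \<otimes>\<^bsub>fobj B c\<^esub> \<beta> c x" "y' = y \<otimes>\<^bsub>fobj I c\<^esub> h c x"
      interpret \<beta>c: group_hom "fobj ?P c" "fobj B c" "\<beta> c" using c by (rule \<beta>_group)
      interpret hc: group_hom "fobj ?P c" "fobj I c" "h c" using c by (rule h_group)
      note carr = R_carr[OF *(1)]
      have "\<beta> c x = inv\<^bsub>fobj B c\<^esub> b"
        using *(3) carr *(2) by (metis \<beta>c.H.inv_equality \<beta>c.H.inv_inv \<beta>c.H.inv_closed \<beta>c.hom_closed)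
      then have **: "(c, \<beta> c x, inv\<^bsub>fobj I c\<^esub> y) \<in> R" using R_inv[OF *(1)] by simp
      then have "x \<in> D c" using *(2) by (auto simp: D_def)
      then have "h c x = inv\<^bsub>fobj I c\<^esub> y" using hg[OF c] g_eq[OF **] by simp
      then show ?thesis using *(4) carr by simp
    qed
  next
    fix c b1 y1 b2 y2 assume 1: "(c, b1, y1) \<in> R'" and 2: "(c, b2, y2) \<in> R'"
    from 1 show "(c, b1 \<otimes>\<^bsub>fobj B c\<^esub> b2, y1 \<otimes>\<^bsub>fobj I c\<^esub> y2) \<in> R'"
    proof (rule R'E)
      fix b y x
      assume c: "c \<in> Ob C" and *: "(c, b, y) \<in> R" "x \<in> carrier (fobj ?P c)"
        "b1 = b \<otimes>\<^bsub>fobj B c\<^esub> \<beta> c x" "y1 = y \<otimes>\<^bsub>fobj I c\<^esub> h c x"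
      from 2 show ?thesis
      proof (rule R'E)
        fix b' y' x'
        assume **: "(c, b', y') \<in> R" "x' \<in> carrier (fobj ?P c)"
          "b2 = b' \<otimes>\<^bsub>fobj B c\<^esub> \<beta> c x'" "y2 = y' \<otimes>\<^bsub>fobj I c\<^esub> h c x'"
        interpret \<beta>c: group_hom "fobj ?P c" "fobj B c" "\<beta> c" using c by (rule \<beta>_group)
        interpret hc: group_hom "fobj ?P c" "fobj I c" "h c" using c by (rule h_group)
        interpret Bc: comm_group "fobj B c" using c by (rule B.fobj_group)
        interpret Ic: comm_group "fobj I c" using c by (rule I.fobj_group)
        show ?thesis
          by (rule R'I[OF R_mult[OF *(1) **(1)], of "x \<otimes>\<^bsub>fobj ?P c\<^esub> x'"])
            (use * ** R_carr[OF *(1)] R_carr[OF **(1)] in \<open>simp_all add: Bc.m_ac Ic.m_ac\<close>)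
      qed
    qed
  next
    fix c b1 y1 assume 1: "(c, b1, y1) \<in> R'"
    then show "(c, inv\<^bsub>fobj B c\<^esub> b1, inv\<^bsub>fobj I c\<^esub> y1) \<in> R'"
    proof (rule R'E)
      fix b y x
      assume c: "c \<in> Ob C" and *: "(c, b, y) \<in> R" "x \<in> carrier (fobj ?P c)"
        "b1 = b \<otimes>\<^bsub>fobj B c\<^esub> \<beta> c x" "y1 = y \<otimes>\<^bsub>fobj I c\<^esub> h c x"
      interpret \<beta>c: group_hom "fobj ?P c" "fobj B c" "\<beta> c" using c by (rule \<beta>_group)
      interpret hc: group_hom "fobj ?P c" "fobj I c" "h c" using c by (rule h_group)
      interpret Bc: comm_group "fobj B c" using c by (rule B.fobj_group)
      interpret Ic: comm_group "fobj I c" using c by (rule I.fobj_group)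
      show ?thesis
        by (rule R'I[OF R_inv[OF *(1)], of "inv\<^bsub>fobj ?P c\<^esub> x"])
          (use * R_carr[OF *(1)] in \<open>simp_all add: Bc.inv_mult Ic.inv_mult\<close>)
    qed
  next
    fix c d f b1 y1 assume c: "c \<in> Ob C" and f: "f \<in> Mor C c d" and 1: "(d, b1, y1) \<in> R'"
    from 1 show "(c, fmap B c d f b1, fmap I c d f y1) \<in> R'"
    proof (rule R'E)
      fix b y x
      assume d: "d \<in> Ob C" and *: "(d, b, y) \<in> R" "x \<in> carrier (fobj ?P d)"
        "b1 = b \<otimes>\<^bsub>fobj B d\<^esub> \<beta> d x" "y1 = y \<otimes>\<^bsub>fobj I d\<^esub> h d x"
      note carr = R_carr[OF *(1)]
      have x: "fmap ?P c d f x \<in> carrier (fobj ?P c)"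
        using P.fmap_hom[OF c d f] *(2) by (auto simp: hom_def)
      show ?thesis
      proof (rule R'I[OF R_map[OF c f *(1)] x])
        show "fmap B c d f b1 = fmap B c d f b \<otimes>\<^bsub>fobj B c\<^esub> \<beta> c (fmap ?P c d f x)"
          using *(2,3) carr hom_mult[OF B.fmap_hom[OF c d f]] \<beta>_nat[OF c d f] \<beta>_hom[OF d]
          by (auto simp: hom_def Pi_iff)
        show "fmap I c d f y1 = fmap I c d f y \<otimes>\<^bsub>fobj I c\<^esub> h c (fmap ?P c d f x)"
          using *(2,4) carr hom_mult[OF I.fmap_hom[OF c d f]] h_nat[OF c d f] h_hom[OF d]
          by (auto simp: hom_def Pi_iff)
      qed
    qed
  next
    fix c x assume "c \<in> Ob C" "x \<in> carrier (fobj A c)"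
    then show "(c, \<iota> c x, \<phi> c x) \<in> R'" by (intro subsetD[OF sub] R_A)
  qed
  moreover have "(e, b0, h e (frag_of (idt C e))) \<in> R'"
  proof (rule R'I[OF R_one[OF e]])
    interpret \<beta>e: group_hom "fobj ?P e" "fobj B e" "\<beta> e" using e by (rule \<beta>_group)
    interpret he: group_hom "fobj ?P e" "fobj I e" "h e" using e by (rule h_group)
    show *: "frag_of (idt C e) \<in> carrier (fobj ?P e)"
      using A.idt_closed[OF e] by (simp add: representable_def)
    show "b0 = \<one>\<^bsub>fobj B e\<^esub> \<otimes>\<^bsub>fobj B e\<^esub> \<beta> e (frag_of (idt C e))"
      using b0 \<beta>(2) by simp
    show "h e (frag_of (idt C e)) = \<one>\<^bsub>fobj I e\<^esub> \<otimes>\<^bsub>fobj I e\<^esub> h e (frag_of (idt C e))"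
      using he.hom_closed[OF *] by simp
  qed
  ultimately show ?thesis using sub by (intro exI conjI)
qed

lemma injective_cmodule_extends:
  fixes A :: "('o, 'a, 's) cmod" and B :: "('o, 'a, 't) cmod" and I :: "('o, 'a, 'x) cmod"
  assumes A: "cmodule C A" and B: "cmodule C B" and inj: "injective_cmodule C I"
    and \<iota>: "nat_trans C A B \<iota>" "\<And>c. c \<in> Ob C \<Longrightarrow> inj_on (\<iota> c) (carrier (fobj A c))"
    and \<phi>: "nat_trans C A I \<phi>"
  shows "\<exists>\<psi>. nat_trans C B I \<psi> \<and> (\<forall>c\<in>Ob C. \<forall>x\<in>carrier (fobj A c). \<psi> c (\<iota> c x) = \<phi> c x)"
proof -
  interpret A: cmodule C A by fact
  interpret B: cmodule C B by fact
  interpret I: cmodule C I using inj by (simp add: injective_cmodule_def)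
  let ?\<G> = "{R. partial_ext C A B I \<iota> \<phi> R}"
  let ?R0 = "{(c, \<iota> c x, \<phi> c x) | c x. c \<in> Ob C \<and> x \<in> carrier (fobj A c)}"
  have gh: "group_hom (fobj A c) (fobj B c) (\<iota> c)" "group_hom (fobj A c) (fobj I c) (\<phi> c)"
    if "c \<in> Ob C" for c
  proof -
    have "group (fobj A c)" "group (fobj B c)" "group (fobj I c)"
      using that by (auto intro: comm_group.axioms A.fobj_group B.fobj_group I.fobj_group)
    then show "group_hom (fobj A c) (fobj B c) (\<iota> c)" "group_hom (fobj A c) (fobj I c) (\<phi> c)"
      using that \<iota>(1) \<phi> by (auto simp: group_hom_def group_hom_axioms_def nat_trans_def)
  qed
  have R0: "partial_ext C A B I \<iota> \<phi> ?R0"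
    unfolding partial_ext_def
  proof (intro conjI allI impI ballI)
    show "?R0 \<subseteq> {(c, b, y). c \<in> Ob C \<and> b \<in> carrier (fobj B c) \<and> y \<in> carrier (fobj I c)}"
      using gh by (auto intro: group_hom.hom_closed)
  next
    fix c y assume "(c, \<one>\<^bsub>fobj B c\<^esub>, y) \<in> ?R0"
    then obtain x where x: "c \<in> Ob C" "x \<in> carrier (fobj A c)" "\<iota> c x = \<one>\<^bsub>fobj B c\<^esub>" "y = \<phi> c x"
      by auto
    interpret g: group_hom "fobj A c" "fobj B c" "\<iota> c" using gh x by simp
    interpret g': group_hom "fobj A c" "fobj I c" "\<phi> c" using gh x by simp
    have "x = \<one>\<^bsub>fobj A c\<^esub>"
      using \<iota>(2)[OF x(1)] x(2,3) g.hom_one g.G.one_closed by (metis inj_onD)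
    then show "y = \<one>\<^bsub>fobj I c\<^esub>" using x by simp
  next
    fix c b y b' y' assume "(c, b, y) \<in> ?R0" "(c, b', y') \<in> ?R0"
    then obtain x x' where x: "c \<in> Ob C" "x \<in> carrier (fobj A c)" "x' \<in> carrier (fobj A c)"
      and *: "b = \<iota> c x" "y = \<phi> c x" "b' = \<iota> c x'" "y' = \<phi> c x'" by auto
    interpret g: group_hom "fobj A c" "fobj B c" "\<iota> c" using gh x by simp
    interpret g': group_hom "fobj A c" "fobj I c" "\<phi> c" using gh x by simp
    show "(c, b \<otimes>\<^bsub>fobj B c\<^esub> b', y \<otimes>\<^bsub>fobj I c\<^esub> y') \<in> ?R0"
      using x unfolding * by (auto intro!: exI[of _ "x \<otimes>\<^bsub>fobj A c\<^esub> x'"])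
  next
    fix c b y assume "(c, b, y) \<in> ?R0"
    then obtain x where x: "c \<in> Ob C" "x \<in> carrier (fobj A c)" and *: "b = \<iota> c x" "y = \<phi> c x"
      by auto
    interpret g: group_hom "fobj A c" "fobj B c" "\<iota> c" using gh x by simp
    interpret g': group_hom "fobj A c" "fobj I c" "\<phi> c" using gh x by simp
    show "(c, inv\<^bsub>fobj B c\<^esub> b, inv\<^bsub>fobj I c\<^esub> y) \<in> ?R0"
      using x unfolding * by (auto intro!: exI[of _ "inv\<^bsub>fobj A c\<^esub> x"])
  next
    fix c d f b y assume c: "c \<in> Ob C" and f: "f \<in> Mor C c d" and "(d, b, y) \<in> ?R0"
    then obtain x where x: "d \<in> Ob C" "x \<in> carrier (fobj A d)" and *: "b = \<iota> d x" "y = \<phi> d x"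
      by auto
    have "fmap A c d f x \<in> carrier (fobj A c)"
      using A.fmap_hom[OF c x(1) f] x by (auto simp: hom_def)
    moreover have "\<iota> c (fmap A c d f x) = fmap B c d f b" "\<phi> c (fmap A c d f x) = fmap I c d f y"
      using \<iota>(1) \<phi> c f x unfolding * nat_trans_def by auto
    ultimately show "(c, fmap B c d f b, fmap I c d f y) \<in> ?R0"
      using c by (intro CollectI exI[of _ c] exI[of _ "fmap A c d f x"]) simp
  qed auto
  have "\<exists>R\<in>?\<G>. \<forall>Q\<in>?\<G>. R \<subseteq> Q \<longrightarrow> Q = R"
  proof (rule subset_Zorn_nonempty)
    show "?\<G> \<noteq> {}" using R0 by blast
    fix \<C> assume ne: "\<C> \<noteq> {}" and ch: "subset.chain ?\<G> \<C>"
    then have pe: "partial_ext C A B I \<iota> \<phi> R" if "R \<in> \<C>" for R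
      using that by (auto simp: subset_chain_def)
    have two: "\<exists>R\<in>\<C>. u \<in> R \<and> v \<in> R" if "u \<in> \<Union>\<C>" "v \<in> \<Union>\<C>" for u v
      using that ch unfolding subset_chain_def by blast
    show "\<Union>\<C> \<in> ?\<G>"
      unfolding mem_Collect_eq partial_ext_def
    proof (intro conjI allI impI ballI)
      show "\<Union>\<C> \<subseteq> {(c, b, y). c \<in> Ob C \<and> b \<in> carrier (fobj B c) \<and> y \<in> carrier (fobj I c)}"
        using pe by (intro Union_least) (simp add: partial_ext_def)
    next
      fix c y assume "(c, \<one>\<^bsub>fobj B c\<^esub>, y) \<in> \<Union>\<C>"
      then obtain R where "R \<in> \<C>" "(c, \<one>\<^bsub>fobj B c\<^esub>, y) \<in> R" by blast
      with pe[of R] show "y = \<one>\<^bsub>fobj I c\<^esub>" by (simp add: partial_ext_def)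
    next
      fix c b y b' y' assume "(c, b, y) \<in> \<Union>\<C>" "(c, b', y') \<in> \<Union>\<C>"
      from two[OF this] obtain R where "R \<in> \<C>" "(c, b, y) \<in> R" "(c, b', y') \<in> R" by blast
      with pe[of R] have "(c, b \<otimes>\<^bsub>fobj B c\<^esub> b', y \<otimes>\<^bsub>fobj I c\<^esub> y') \<in> R"
        by (simp add: partial_ext_def)
      with \<open>R \<in> \<C>\<close> show "(c, b \<otimes>\<^bsub>fobj B c\<^esub> b', y \<otimes>\<^bsub>fobj I c\<^esub> y') \<in> \<Union>\<C>" by (rule UnionI)
    next
      fix c b y assume "(c, b, y) \<in> \<Union>\<C>"
      then obtain R where "R \<in> \<C>" "(c, b, y) \<in> R" by blast
      with pe[of R] have "(c, inv\<^bsub>fobj B c\<^esub> b, inv\<^bsub>fobj I c\<^esub> y) \<in> R"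
        by (simp add: partial_ext_def)
      with \<open>R \<in> \<C>\<close> show "(c, inv\<^bsub>fobj B c\<^esub> b, inv\<^bsub>fobj I c\<^esub> y) \<in> \<Union>\<C>" by (rule UnionI)
    next
      fix c d f b y assume "c \<in> Ob C" "f \<in> Mor C c d" "(d, b, y) \<in> \<Union>\<C>"
      then obtain R where "R \<in> \<C>" "c \<in> Ob C" "f \<in> Mor C c d" "(d, b, y) \<in> R" by blast
      with pe[of R] have "(c, fmap B c d f b, fmap I c d f y) \<in> R"
        by (simp add: partial_ext_def)
      with \<open>R \<in> \<C>\<close> show "(c, fmap B c d f b, fmap I c d f y) \<in> \<Union>\<C>" by (rule UnionI)
    next
      fix c x assume *: "c \<in> Ob C" "x \<in> carrier (fobj A c)"
      obtain R where "R \<in> \<C>" using ne by blast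
      with pe[of R] * have "(c, \<iota> c x, \<phi> c x) \<in> R"
        by (simp add: partial_ext_def)
      with \<open>R \<in> \<C>\<close> show "(c, \<iota> c x, \<phi> c x) \<in> \<Union>\<C>" by (rule UnionI)
    qed
  qed
  then obtain R where R: "partial_ext C A B I \<iota> \<phi> R"
    and max: "\<And>Q. \<lbrakk>partial_ext C A B I \<iota> \<phi> Q; R \<subseteq> Q\<rbrakk> \<Longrightarrow> Q = R" by blast
  have total: "\<exists>y. (c, b, y) \<in> R" if "c \<in> Ob C" "b \<in> carrier (fobj B c)" for c b
    using partial_ext_union[OF A B inj R that] max by blast
  have "\<exists>y. (c, b, y) \<in> R \<and> (\<forall>y'. (c, b, y') \<in> R \<longrightarrow> y' = y)"
    if "c \<in> Ob C" "b \<in> carrier (fobj B c)" for c b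
    using total[OF that] partial_ext_functional[OF R B I.cmodule_axioms] by blast
  then obtain \<psi> where \<psi>: "\<And>c b. \<lbrakk>c \<in> Ob C; b \<in> carrier (fobj B c)\<rbrakk> \<Longrightarrow> (c, b, \<psi> c b) \<in> R"
    and eq: "\<And>c b y. \<lbrakk>c \<in> Ob C; b \<in> carrier (fobj B c); (c, b, y) \<in> R\<rbrakk> \<Longrightarrow> y = \<psi> c b"
    by metis
  have nat: "nat_trans C B I \<psi>"
    unfolding nat_trans_def
  proof (intro conjI ballI homI)
    fix c b assume "c \<in> Ob C" "b \<in> carrier (fobj B c)"
    then have "(c, b, \<psi> c b) \<in> R" by (rule \<psi>)
    moreover have "R \<subseteq> {(c, b, y). c \<in> Ob C \<and> b \<in> carrier (fobj B c) \<and> y \<in> carrier (fobj I c)}"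
      using R by (simp add: partial_ext_def)
    ultimately show "\<psi> c b \<in> carrier (fobj I c)" by blast
  next
    fix c b b' assume c: "c \<in> Ob C" and b: "b \<in> carrier (fobj B c)" "b' \<in> carrier (fobj B c)"
    interpret Bc: comm_group "fobj B c" using c by (rule B.fobj_group)
    have "(c, b \<otimes>\<^bsub>fobj B c\<^esub> b', \<psi> c b \<otimes>\<^bsub>fobj I c\<^esub> \<psi> c b') \<in> R"
      using R \<psi>[OF c b(1)] \<psi>[OF c b(2)] by (simp add: partial_ext_def)
    then show "\<psi> c (b \<otimes>\<^bsub>fobj B c\<^esub> b') = \<psi> c b \<otimes>\<^bsub>fobj I c\<^esub> \<psi> c b'"
      using eq[OF c] b by simp
  next
    fix c d f b assume *: "c \<in> Ob C" "d \<in> Ob C" "f \<in> Mor C c d" and b: "b \<in> carrier (fobj B d)"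
    have "(c, fmap B c d f b, fmap I c d f (\<psi> d b)) \<in> R"
      using R * \<psi>[OF *(2) b] by (simp add: partial_ext_def)
    moreover have "fmap B c d f b \<in> carrier (fobj B c)"
      using B.fmap_hom[OF *] b by (auto simp: hom_def)
    ultimately show "\<psi> c (fmap B c d f b) = fmap I c d f (\<psi> d b)"
      using eq[OF *(1)] by simp
  qed
  have comp: "\<psi> c (\<iota> c x) = \<phi> c x" if "c \<in> Ob C" "x \<in> carrier (fobj A c)" for c x
  proof (rule eq[symmetric])
    show "\<iota> c x \<in> carrier (fobj B c)" using gh(1)[OF that(1)] that(2) by (rule group_hom.hom_closed)
    show "(c, \<iota> c x, \<phi> c x) \<in> R" using R that by (simp add: partial_ext_def)
  qed (rule that(1))
  show ?thesis
    by (rule exI[of _ \<psi>], rule conjI[OF nat], intro ballI, rule comp)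
qed

section \<open>The orbit category is a category and \<open>F\<^sub>M\<close> is a module over it\<close>

lemma orbit_cat_cmp:
  assumes "group G" and K: "subgroup K G" and L: "subgroup L G"
    and g: "g \<in> carrier G" and x: "x \<in> carrier G"
    and sub: "(\<lambda>k. x \<otimes>\<^bsub>G\<^esub> k \<otimes>\<^bsub>G\<^esub> inv\<^bsub>G\<^esub> x) ` K \<subseteq> L"
  shows "(L #>\<^bsub>G\<^esub> x) <#>\<^bsub>G\<^esub> (K #>\<^bsub>G\<^esub> g) = L #>\<^bsub>G\<^esub> (x \<otimes>\<^bsub>G\<^esub> g)"
proof -
  interpret group G by fact
  interpret K: subgroup K G by fact
  interpret L: subgroup L G by fact
  show ?thesis
  proof (intro equalityI subsetI)
    fix y assume "y \<in> (L #>\<^bsub>G\<^esub> x) <#>\<^bsub>G\<^esub> (K #>\<^bsub>G\<^esub> g)"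
    then obtain l k where l: "l \<in> L" and k: "k \<in> K"
      and y: "y = l \<otimes>\<^bsub>G\<^esub> x \<otimes>\<^bsub>G\<^esub> (k \<otimes>\<^bsub>G\<^esub> g)"
      by (auto simp: set_mult_def r_coset_def)
    have carr: "l \<in> carrier G" "k \<in> carrier G" using l k by auto
    have "x \<otimes>\<^bsub>G\<^esub> k \<otimes>\<^bsub>G\<^esub> inv\<^bsub>G\<^esub> x \<in> L" using sub k by blast
    then have "l \<otimes>\<^bsub>G\<^esub> (x \<otimes>\<^bsub>G\<^esub> k \<otimes>\<^bsub>G\<^esub> inv\<^bsub>G\<^esub> x) \<in> L" using l by simp
    moreover have "inv\<^bsub>G\<^esub> x \<otimes>\<^bsub>G\<^esub> (x \<otimes>\<^bsub>G\<^esub> g) = g" using g x by (simp flip: m_assoc)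
    then have "y = l \<otimes>\<^bsub>G\<^esub> (x \<otimes>\<^bsub>G\<^esub> k \<otimes>\<^bsub>G\<^esub> inv\<^bsub>G\<^esub> x) \<otimes>\<^bsub>G\<^esub> (x \<otimes>\<^bsub>G\<^esub> g)"
      using g x carr y by (simp add: m_assoc)
    ultimately show "y \<in> L #>\<^bsub>G\<^esub> (x \<otimes>\<^bsub>G\<^esub> g)" by (auto simp: r_coset_def)
  next
    fix y assume "y \<in> L #>\<^bsub>G\<^esub> (x \<otimes>\<^bsub>G\<^esub> g)"
    then obtain l where l: "l \<in> L" and "y = l \<otimes>\<^bsub>G\<^esub> (x \<otimes>\<^bsub>G\<^esub> g)"
      by (auto simp: r_coset_def)
    then have "y = (l \<otimes>\<^bsub>G\<^esub> x) \<otimes>\<^bsub>G\<^esub> (\<one>\<^bsub>G\<^esub> \<otimes>\<^bsub>G\<^esub> g)" using g x by (simp add: m_assoc)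
    moreover have "l \<otimes>\<^bsub>G\<^esub> x \<in> L #>\<^bsub>G\<^esub> x" "\<one>\<^bsub>G\<^esub> \<otimes>\<^bsub>G\<^esub> g \<in> K #>\<^bsub>G\<^esub> g"
      using l K.one_closed unfolding r_coset_def by blast+
    ultimately show "y \<in> (L #>\<^bsub>G\<^esub> x) <#>\<^bsub>G\<^esub> (K #>\<^bsub>G\<^esub> g)"
      unfolding set_mult_def by blast
  qed
qed

lemma orbit_cat_MorE:
  assumes "S \<in> Mor (p_orbit_cat p G) H K"
  obtains g where "g \<in> carrier G" "(\<lambda>h. g \<otimes>\<^bsub>G\<^esub> h \<otimes>\<^bsub>G\<^esub> inv\<^bsub>G\<^esub> g) ` H \<subseteq> K" "S = K #>\<^bsub>G\<^esub> g"
  using assms by (auto simp: p_orbit_cat_def)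

lemma category_p_orbit_cat:
  assumes "group G"
  shows "category (p_orbit_cat p G)"
proof -
  interpret group G by fact
  have Ob: "subgroup H G" if "H \<in> Ob (p_orbit_cat p G)" for H
    using that by (simp add: p_orbit_cat_def)
  have cmp: "cmp (p_orbit_cat p G) (L #>\<^bsub>G\<^esub> x) (K #>\<^bsub>G\<^esub> g) = L #>\<^bsub>G\<^esub> (x \<otimes>\<^bsub>G\<^esub> g)"
    if "K \<in> Ob (p_orbit_cat p G)" "L \<in> Ob (p_orbit_cat p G)" "g \<in> carrier G" "x \<in> carrier G"
      "(\<lambda>k. x \<otimes>\<^bsub>G\<^esub> k \<otimes>\<^bsub>G\<^esub> inv\<^bsub>G\<^esub> x) ` K \<subseteq> L" for K L g x
    using orbit_cat_cmp[OF assms Ob Ob] that by (simp add: p_orbit_cat_def)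
  have idt: "idt (p_orbit_cat p G) H = H #>\<^bsub>G\<^esub> \<one>\<^bsub>G\<^esub>" if "H \<in> Ob (p_orbit_cat p G)" for H
    using Ob[OF that] by (simp add: p_orbit_cat_def coset_mult_one subgroup.subset)
  have idsub: "(\<lambda>h. \<one>\<^bsub>G\<^esub> \<otimes>\<^bsub>G\<^esub> h \<otimes>\<^bsub>G\<^esub> inv\<^bsub>G\<^esub> \<one>\<^bsub>G\<^esub>) ` H \<subseteq> H" if "H \<in> Ob (p_orbit_cat p G)" for H
    using subgroup.mem_carrier[OF Ob[OF that]] by auto
  have cmpsub: "(\<lambda>h. x \<otimes>\<^bsub>G\<^esub> g \<otimes>\<^bsub>G\<^esub> h \<otimes>\<^bsub>G\<^esub> inv\<^bsub>G\<^esub> (x \<otimes>\<^bsub>G\<^esub> g)) ` H \<subseteq> L"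
    if "H \<in> Ob (p_orbit_cat p G)" "g \<in> carrier G" "x \<in> carrier G"
      "(\<lambda>h. g \<otimes>\<^bsub>G\<^esub> h \<otimes>\<^bsub>G\<^esub> inv\<^bsub>G\<^esub> g) ` H \<subseteq> K" "(\<lambda>k. x \<otimes>\<^bsub>G\<^esub> k \<otimes>\<^bsub>G\<^esub> inv\<^bsub>G\<^esub> x) ` K \<subseteq> L" for H K L g x
  proof clarify
    fix h assume h: "h \<in> H"
    then have "x \<otimes>\<^bsub>G\<^esub> (g \<otimes>\<^bsub>G\<^esub> h \<otimes>\<^bsub>G\<^esub> inv\<^bsub>G\<^esub> g) \<otimes>\<^bsub>G\<^esub> inv\<^bsub>G\<^esub> x \<in> L" using that by blast
    then show "x \<otimes>\<^bsub>G\<^esub> g \<otimes>\<^bsub>G\<^esub> h \<otimes>\<^bsub>G\<^esub> inv\<^bsub>G\<^esub> (x \<otimes>\<^bsub>G\<^esub> g) \<in> L"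
      using subgroup.mem_carrier[OF Ob[OF that(1)] h] that(2,3)
      by (simp add: m_assoc inv_mult_group)
  qed
  have MorI: "K #>\<^bsub>G\<^esub> g \<in> Mor (p_orbit_cat p G) H K"
    if "g \<in> carrier G" "(\<lambda>h. g \<otimes>\<^bsub>G\<^esub> h \<otimes>\<^bsub>G\<^esub> inv\<^bsub>G\<^esub> g) ` H \<subseteq> K" for H K g
    using that by (auto simp: p_orbit_cat_def)
  show ?thesis
  proof
    show "idt (p_orbit_cat p G) H \<in> Mor (p_orbit_cat p G) H H" if "H \<in> Ob (p_orbit_cat p G)" for H
      using MorI[OF one_closed idsub[OF that]] idt[OF that] by simp
  next
    fix H K L S T
    assume *: "H \<in> Ob (p_orbit_cat p G)" "K \<in> Ob (p_orbit_cat p G)" "L \<in> Ob (p_orbit_cat p G)"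
      "S \<in> Mor (p_orbit_cat p G) H K" "T \<in> Mor (p_orbit_cat p G) K L"
    from *(4,5) show "cmp (p_orbit_cat p G) T S \<in> Mor (p_orbit_cat p G) H L"
      by (elim orbit_cat_MorE) (use * in \<open>simp add: cmp MorI cmpsub\<close>)
  next
    fix H K S
    assume *: "H \<in> Ob (p_orbit_cat p G)" "K \<in> Ob (p_orbit_cat p G)" "S \<in> Mor (p_orbit_cat p G) H K"
    from *(3) show "cmp (p_orbit_cat p G) S (idt (p_orbit_cat p G) H) = S"
      by (elim orbit_cat_MorE) (use * idt in \<open>simp add: cmp\<close>)
    from *(3) show "cmp (p_orbit_cat p G) (idt (p_orbit_cat p G) K) S = S"
      by (elim orbit_cat_MorE) (use * idt idsub[OF *(2)] in \<open>simp add: cmp\<close>)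
  next
    fix H K L N S T U
    assume *: "H \<in> Ob (p_orbit_cat p G)" "K \<in> Ob (p_orbit_cat p G)" "L \<in> Ob (p_orbit_cat p G)"
      "N \<in> Ob (p_orbit_cat p G)" "S \<in> Mor (p_orbit_cat p G) H K"
      "T \<in> Mor (p_orbit_cat p G) K L" "U \<in> Mor (p_orbit_cat p G) L N"
    from *(5-7) show "cmp (p_orbit_cat p G) U (cmp (p_orbit_cat p G) T S)
        = cmp (p_orbit_cat p G) (cmp (p_orbit_cat p G) U T) S"
      by (elim orbit_cat_MorE) (use * in \<open>simp add: cmp cmpsub m_assoc\<close>)
  qed
qed

lemma (in group_ring_module) cmodule_atomic_functor:
  "cmodule (p_orbit_cat p G) (atomic_functor G M act)"
proof (intro cmodule.intro cmodule_axioms.intro)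
  interpret C: category "p_orbit_cat p G" by (rule category_p_orbit_cat) (rule G.is_group) 
  show "category (p_orbit_cat p G)" ..
  have act_zero: "act g \<zero>\<^bsub>M\<^esub> = \<zero>\<^bsub>M\<^esub>" if g: "g \<in> carrier G" for g
    using act_add[OF g, of "\<zero>\<^bsub>M\<^esub>" "\<zero>\<^bsub>M\<^esub>"] act_closed[OF g M.zero_closed]
    by (simp add: M.add.l_cancel_one')
  have triv: "\<exists>g\<in>carrier G. S = {g}" if "S \<in> Mor (p_orbit_cat p G) {\<one>\<^bsub>G\<^esub>} {\<one>\<^bsub>G\<^esub>}" for S
    using that by (auto simp: p_orbit_cat_def r_coset_def)
  have to_triv: "P = {\<one>\<^bsub>G\<^esub>}" if "P \<in> Ob (p_orbit_cat p G)" "S \<in> Mor (p_orbit_cat p G) P {\<one>\<^bsub>G\<^esub>}" for P S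
  proof -
    have P: "subgroup P G" using that by (simp add: p_orbit_cat_def)
    obtain g where g: "g \<in> carrier G" "(\<lambda>h. g \<otimes>\<^bsub>G\<^esub> h \<otimes>\<^bsub>G\<^esub> inv\<^bsub>G\<^esub> g) ` P \<subseteq> {\<one>\<^bsub>G\<^esub>}"
      using \<open>S \<in> _\<close> by (rule orbit_cat_MorE)
    have "h = \<one>\<^bsub>G\<^esub>" if h: "h \<in> P" for h
    proof -
      have "h \<in> carrier G" "g \<otimes>\<^bsub>G\<^esub> h \<otimes>\<^bsub>G\<^esub> inv\<^bsub>G\<^esub> g = \<one>\<^bsub>G\<^esub>"
        using subgroup.mem_carrier[OF P h] g h by auto
      then show ?thesis
        using g(1) by (metis G.inv_closed G.inv_equality G.inv_inv G.m_closed G.l_cancel_one')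
    qed
    then show ?thesis using subgroup.one_closed[OF P] by blast
  qed
  fix P assume "P \<in> Ob (p_orbit_cat p G)"
  show "comm_group (fobj (atomic_functor G M act) P)"
  proof (cases "P = {\<one>\<^bsub>G\<^esub>}")
    case True
    show ?thesis
    proof (rule comm_groupI)
      fix m assume "m \<in> carrier (fobj (atomic_functor G M act) P)"
      then show "\<exists>n\<in>carrier (fobj (atomic_functor G M act) P).
          n \<otimes>\<^bsub>fobj (atomic_functor G M act) P\<^esub> m = \<one>\<^bsub>fobj (atomic_functor G M act) P\<^esub>"
        using True by (intro bexI[of _ "\<ominus>\<^bsub>M\<^esub> m"]) (simp_all add: atomic_functor_def M.l_neg)
    qed (use True in \<open>simp_all add: atomic_functor_def M.a_ac\<close>)
  next
    case False
    then show ?thesis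
      by (auto simp: atomic_functor_def intro!: comm_groupI)
  qed
  show "fmap (atomic_functor G M act) P P (idt (p_orbit_cat p G) P) m = m"
    if "m \<in> carrier (fobj (atomic_functor G M act) P)" for m
    using that act_one by (auto simp: atomic_functor_def p_orbit_cat_def split: if_splits)
  fix Q S
  assume Q: "Q \<in> Ob (p_orbit_cat p G)" and S: "S \<in> Mor (p_orbit_cat p G) P Q"
  show "fmap (atomic_functor G M act) P Q S
      \<in> hom (fobj (atomic_functor G M act) Q) (fobj (atomic_functor G M act) P)"
  proof (cases "P = {\<one>\<^bsub>G\<^esub>} \<and> Q = {\<one>\<^bsub>G\<^esub>}")
    case True
    then obtain g where "g \<in> carrier G" "S = {g}" using triv S by blast
    then show ?thesis
      using True act_closed act_add by (auto simp: atomic_functor_def hom_def)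
  qed (auto simp: atomic_functor_def hom_def)
  fix N T m
  assume N: "N \<in> Ob (p_orbit_cat p G)" and T: "T \<in> Mor (p_orbit_cat p G) Q N"
    and m: "m \<in> carrier (fobj (atomic_functor G M act) N)"
  show "fmap (atomic_functor G M act) P N (cmp (p_orbit_cat p G) T S) m
      = fmap (atomic_functor G M act) P Q S (fmap (atomic_functor G M act) Q N T m)"
  proof (cases "N = {\<one>\<^bsub>G\<^esub>}")
    case True
    then have Q1: "Q = {\<one>\<^bsub>G\<^esub>}" using to_triv Q T by blast
    then have P1: "P = {\<one>\<^bsub>G\<^esub>}" using to_triv \<open>P \<in> _\<close> S by blast
    obtain g h where "g \<in> carrier G" "S = {g}" "h \<in> carrier G" "T = {h}"
      using triv S T Q1 P1 True by metis
    then show ?thesis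
      using True Q1 P1 m
      by (simp add: atomic_functor_def p_orbit_cat_def set_mult_def G.inv_mult_group act_mult)
  next
    case N: False
    then have "m = \<zero>\<^bsub>M\<^esub>" using m by (simp add: atomic_functor_def)
    show ?thesis
    proof (cases "P = {\<one>\<^bsub>G\<^esub>} \<and> Q = {\<one>\<^bsub>G\<^esub>}")
      case True
      then obtain g where "g \<in> carrier G" "S = {g}" using triv S by blast
      then show ?thesis using N True act_zero by (auto simp: atomic_functor_def)
    qed (use N in \<open>auto simp: atomic_functor_def\<close>)
  qed
qed

lemma cring_localized_int:
  assumes "Factorial_Ring.prime p"
  shows "cring (localized_int p)"
proof -
  have c: "x \<in> carrier (localized_int p) \<longleftrightarrow> (\<exists>a b. x = of_int a / of_int b \<and> \<not> int p dvd b)" for x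
    by (simp add: localized_int_def)
  have nz: "b \<noteq> 0" if "\<not> int p dvd b" for b using that by auto
  have nd: "\<not> int p dvd b * d" if "\<not> int p dvd b" "\<not> int p dvd d" for b d
    using that assms by (simp add: prime_dvd_mult_iff)
  have add: "x + y \<in> carrier (localized_int p)" 
    if xy: "x \<in> carrier (localized_int p)" "y \<in> carrier (localized_int p)" for x y
  proof -
    obtain a b a' b' where *: "x = of_int a / of_int b" "\<not> int p dvd b"
      "y = of_int a' / of_int b'" "\<not> int p dvd b'" using xy unfolding c by blast
    then have "x + y = of_int (a * b' + a' * b) / of_int (b * b')"
      using nz by (simp add: field_simps)
    then show ?thesis unfolding c using nd * by blast
  qed
  have mult: "x * y \<in> carrier (localized_int p)" 
    if xy: "x \<in> carrier (localized_int p)" "y \<in> carrier (localized_int p)" for x y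
  proof -
    obtain a b a' b' where *: "x = of_int a / of_int b" "\<not> int p dvd b"
      "y = of_int a' / of_int b'" "\<not> int p dvd b'" using xy unfolding c by blast
    then have "x * y = of_int (a * a') / of_int (b * b')" by simp
    then show ?thesis unfolding c using nd * by blast
  qed
  have of_int: "of_int n \<in> carrier (localized_int p)" for n
    unfolding c using assms by (intro exI[of _ n] exI[of _ 1]) (auto simp: prime_int_iff' dest: not_prime_unit)
  have neg: "- x \<in> carrier (localized_int p)" if "x \<in> carrier (localized_int p)" for x
    using mult[OF of_int[of "-1"] that] by simp
  show ?thesis
  proof (rule cringI)
    show "abelian_group (localized_int p)"
    proof (rule abelian_groupI)
      fix x assume "x \<in> carrier (localized_int p)"
      then have "- x \<in> carrier (localized_int p)" "- x \<oplus>\<^bsub>localized_int p\<^esub> x = \<zero>\<^bsub>localized_int p\<^esub>"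
        using neg by (simp_all add: localized_int_def)
      then show "\<exists>y\<in>carrier (localized_int p). y \<oplus>\<^bsub>localized_int p\<^esub> x = \<zero>\<^bsub>localized_int p\<^esub>" ..
    qed (use add of_int[of 0] in \<open>auto simp: localized_int_def\<close>)
    show "comm_monoid (localized_int p)"
      by (rule comm_monoidI) (use mult of_int[of 1] in \<open>auto simp: localized_int_def\<close>)
  qed (simp add: localized_int_def distrib_right)
qed

end

theory Submission
  imports Defs
begin

text \<open>Let \<open>T\<close> be the \<open>G\<close>-set of all cosets \<open>gP\<close> of \<open>p\<close>-subgroups. The free abelian groups
  \<open>E\<^sub>n(P)\<close> on \<open>n\<close>-tuples of \<open>P\<close>-fixed points of \<open>T\<close> form an exact sequence
  \<open>\<dots> \<rightarrow> E\<^sub>2 \<rightarrow> E\<^sub>1 \<rightarrow> E\<^sub>0 = \<int>\<close> of functors, and \<open>E\<^sub>n\<close> is a sum of representable functors for \<open>n > 0\<close>.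
  Hence \<open>\<Lambda>\<^sup>*(G;M)\<close> is the cohomology of the complex of \<open>G\<close>-equivariant functions \<open>T\<^sup>n \<rightarrow> M\<close> that
  vanish on tuples with a nontrivial stabilizer.

  Let \<open>H = C\<^sub>G(M)\<close>. Such functions factor through the chains on \<open>T\<close> with coefficients in \<open>\<int>\<^sub>(\<^sub>p\<^sub>)\<close>
  modulo tuples with a nontrivial stabilizer and modulo \<open>H\<close>. This is a complex of free
  \<open>\<int>\<^sub>(\<^sub>p\<^sub>)[G/H]\<close>-modules, so that it suffices to show that it is acyclic. As \<open>G\<close> is locally finite,
  one can replace \<open>G\<close> by a finite subgroup \<open>K\<close> containing an element of \<open>H\<close> of order \<open>p\<close>, and
  \<open>H\<close> by \<open>J = H \<inter> K\<close>. If \<open>J = K\<close>, adjoining a point of an orbit of length prime to \<open>p\<close>, averaged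
  over the orbit, is a contraction modulo \<open>p\<close>, and Nakayama's lemma applies. In general, this
  argument is applied to the centralizers in \<open>J\<close> of \<open>p\<close>-subgroups \<open>P\<close> of \<open>K\<close>, acting on the
  fixed points of \<open>P\<close>.\<close>

section \<open>Chains on lists\<close>

text \<open>The obstacle is that two groups are involved: lists are identified only along
  \<open>H\<close>, while all lists with a nontrivial stabilizer in \<open>G\<close> are discarded.
  Averaging over an orbit deals with a single group. At the finite level the quotient by
  \<open>J\<close>-dead lists and by \<open>J\<close> is therefore contracted first, and the value
  of the contraction at a list \<open>a\<close> is confined to chains on points fixed by the
  stabilizer of \<open>a\<close> in \<open>K\<close>. A list that is free for \<open>J\<close> but
  not for \<open>K\<close> then goes to lists whose stabilizers contain its own, so the contraction
  descends to the quotient by \<open>K\<close>-dead lists. Such values exist if the chains on the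
  fixed points of a \<open>p\<close>-group \<open>P\<close> are acyclic. The centralizer of
  \<open>P\<close> in \<open>J\<close> serves here because its order is still divisible by
  \<open>p\<close>: the \<open>p\<close>-group \<open>P\<close> acts on \<open>J\<close> by
  conjugation.

  The element of order \<open>p\<close> also makes the empty list dead, which removes the
  augmentation term. Acyclicity passes from finite subgroups to \<open>G\<close>, contractions do
  not; the one over \<open>G\<close> is built afterwards from freeness. Composing a cocycle with it
  gives a cochain whose coboundary is the cocycle.\<close>

abbreviation "lookup \<equiv> Poly_Mapping.lookup"
abbreviation "keys \<equiv> Poly_Mapping.keys"
abbreviation "single \<equiv> Poly_Mapping.single"

definition scl :: "'k::comm_ring_1 \<Rightarrow> ('a \<Rightarrow>\<^sub>0 'k) \<Rightarrow> ('a \<Rightarrow>\<^sub>0 'k)" where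
  "scl r c = Poly_Mapping.map ((*) r) c"

lemma lookup_scl [simp]: "lookup (scl r c) a = r * lookup c a"
  by (cases "lookup c a = 0") (simp_all add: scl_def Poly_Mapping.map.rep_eq when_def)

lemma scl_zero [simp]: "scl r 0 = 0" "scl 0 c = 0"
  by (rule poly_mapping_eqI; simp)+

lemma scl_one [simp]: "scl 1 c = c"
  by (rule poly_mapping_eqI; simp)

lemma scl_scl [simp]: "scl r (scl s c) = scl (r * s) c"
  by (rule poly_mapping_eqI; simp add: mult.assoc)

lemma scl_add: "scl r (c + d) = scl r c + scl r d"
  by (rule poly_mapping_eqI; simp add: lookup_add distrib_left)

lemma scl_diff: "scl r (c - d) = scl r c - scl r d"
  by (rule poly_mapping_eqI; simp add: lookup_minus right_diff_distrib)

lemma scl_add_left: "scl (r + s) c = scl r c + scl s c"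
  by (rule poly_mapping_eqI; simp add: lookup_add distrib_right)

lemma scl_minus_one: "scl (-1) c = - c"
  by (rule poly_mapping_eqI; simp)

lemma scl_single [simp]: "scl r (single a s) = single a (r * s)"
  by (rule poly_mapping_eqI; simp add: lookup_single when_def)

lemma scl_sum: "scl r (sum f A) = (\<Sum>a\<in>A. scl r (f a))"
  by (induction A rule: infinite_finite_induct) (simp_all add: scl_add)

lemma keys_scl: "keys (scl r c) \<subseteq> keys c"
  by (auto simp: in_keys_iff)

lemma poly_mapping_expand: "c = (\<Sum>a\<in>keys c. single a (lookup c a))"
proof (rule poly_mapping_eqI)
  fix b
  have "lookup (\<Sum>a\<in>keys c. single a (lookup c a)) b =
      (\<Sum>a\<in>keys c. if a = b then lookup c b else 0)"
    by (simp add: lookup_sum lookup_single when_def if_distrib cong: sum.cong if_cong)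
  also have "\<dots> = lookup c b" by (simp add: in_keys_iff)
  finally show "lookup c b = lookup (\<Sum>a\<in>keys c. single a (lookup c a)) b"
    by simp
qed

text \<open>The coefficient ring is left open because the same boundary operator is needed over
  \<open>int\<close>, for the functors \<open>E n\<close>, and over \<open>rat\<close>, for chains
  with coefficients in Z_(p).\<close>

definition lext :: "('a \<Rightarrow> 'b \<Rightarrow>\<^sub>0 'k) \<Rightarrow> ('a \<Rightarrow>\<^sub>0 'k) \<Rightarrow> ('b \<Rightarrow>\<^sub>0 'k::comm_ring_1)" where
  "lext f c = (\<Sum>a\<in>keys c. scl (lookup c a) (f a))"

lemma lext_superset:
  assumes "finite A" "keys c \<subseteq> A"
  shows "lext f c = (\<Sum>a\<in>A. scl (lookup c a) (f a))"
  unfolding lext_def using assms by (intro sum.mono_neutral_left) (auto simp: in_keys_iff)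

lemma lext_zero [simp]: "lext f 0 = 0"
  by (simp add: lext_def)

lemma lext_single [simp]: "lext f (single a r) = scl r (f a)"
  by (cases "r = 0") (simp_all add: lext_def)

lemma lext_add: "lext f (c + d) = lext f c + lext f d"
proof -
  let ?A = "keys c \<union> keys d"
  have "lext f (c + d) = (\<Sum>a\<in>?A. scl (lookup (c + d) a) (f a))"
    by (rule lext_superset) (use Poly_Mapping.keys_add[of c d] in auto)
  then show ?thesis
    by (simp add: lext_superset[of ?A c] lext_superset[of ?A d] lookup_add scl_add_left sum.distrib)
qed

lemma lext_scl: "lext f (scl r c) = scl r (lext f c)"
  by (subst lext_superset[OF finite_keys keys_scl]) (simp add: lext_def scl_sum)

lemma lext_minus: "lext f (- c) = - lext f c"
  using lext_scl[of f "-1" c] by (simp add: scl_minus_one)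

lemma lext_diff: "lext f (c - d) = lext f c - lext f d"
  using lext_add[of f c "- d"] by (simp add: lext_minus)

lemma lext_sum: "lext f (sum g A) = (\<Sum>a\<in>A. lext f (g a))"
  by (induction A rule: infinite_finite_induct) (simp_all add: lext_add)

lemma lext_cong: "(\<And>a. a \<in> keys c \<Longrightarrow> f a = g a) \<Longrightarrow> lext f c = lext g c"
  by (simp add: lext_def)

lemma lext_lext: "lext f (lext g c) = lext (\<lambda>a. lext f (g a)) c"
  by (simp add: lext_def[of g] lext_def[of "\<lambda>a. lext f (g a)"] lext_sum lext_scl)

lemma lext_diff_fun: "lext (\<lambda>a. f a - g a) c = lext f c - lext g c"
  by (simp add: lext_def scl_diff sum_subtractf)

lemma lext_id: "lext (\<lambda>a. single a 1) c = c"
  by (subst (2) poly_mapping_expand) (simp add: lext_def)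

lemma keys_lext: "keys (lext f c) \<subseteq> (\<Union>a\<in>keys c. keys (f a))"
proof
  fix b assume "b \<in> keys (lext f c)"
  then have "(\<Sum>a\<in>keys c. lookup c a * lookup (f a) b) \<noteq> 0"
    by (simp add: in_keys_iff lext_def lookup_sum)
  then obtain a where "a \<in> keys c" "lookup c a * lookup (f a) b \<noteq> 0"
    using sum.not_neutral_contains_not_neutral by blast
  then show "b \<in> (\<Union>a\<in>keys c. keys (f a))"
    by (intro UN_I[of a]) (auto simp: in_keys_iff)
qed

definition push :: "('a \<Rightarrow> 'b) \<Rightarrow> ('a \<Rightarrow>\<^sub>0 'k) \<Rightarrow> ('b \<Rightarrow>\<^sub>0 'k::comm_ring_1)" where
  "push f = lext (\<lambda>a. single (f a) 1)"

lemma push_single [simp]: "push f (single a r) = single (f a) r"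
  by (simp add: push_def)

lemma push_zero [simp]: "push f 0 = 0"
  by (simp add: push_def)

lemmas push_add = lext_add[of "\<lambda>a. single (f a) 1" for f, folded push_def]
lemmas push_diff = lext_diff[of "\<lambda>a. single (f a) 1" for f, folded push_def]
lemma keys_push: "keys (push f c) \<subseteq> f ` keys c"
  unfolding push_def using keys_lext by fastforce

lemma push_push: "push f (push g c) = push (\<lambda>a. f (g a)) c"
  by (simp add: push_def lext_lext)

lemma push_cong: "(\<And>a. a \<in> keys c \<Longrightarrow> f a = g a) \<Longrightarrow> push f c = push g c"
  unfolding push_def by (rule lext_cong) simp

lemma push_ident: "(\<And>a. a \<in> keys c \<Longrightarrow> f a = a) \<Longrightarrow> push f c = c"
  using push_cong[of c f "\<lambda>a. a"] lext_id[of c] by (simp add: push_def)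

lemma lext_push: "lext f (push g c) = lext (\<lambda>a. f (g a)) c"
  by (simp add: push_def lext_lext)

lemma push_lext: "push f (lext g c) = lext (\<lambda>a. push f (g a)) c"
  by (simp add: push_def lext_lext)

text \<open>The recursion is \<open>\<partial>(t\<sigma>) = \<sigma> - t(\<partial>\<sigma>)\<close>; lists of length \<open>n\<close> are simplices of dimension
  \<open>n - 1\<close>, so that the empty list generates the augmentation.\<close>

fun bd :: "'t list \<Rightarrow> ('t list \<Rightarrow>\<^sub>0 'k::comm_ring_1)" where
  "bd [] = 0"
| "bd (t # ts) = single ts 1 - push ((#) t) (bd ts)"

text \<open>Prefixing a vertex is a contracting homotopy of the augmented complex. This identity
  yields \<partial>\<partial> = 0, the averaged contraction of \<open>finite_group_exact\<close> and
  the exactness in \<open>injective_row_exact\<close>.\<close>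

lemma bd_cone: "lext bd (push ((#) t) c) = c - push ((#) t) (lext bd c)"
  by (simp add: lext_push lext_diff_fun lext_id push_lext)

lemma bd_bd_list: "lext bd (bd ts) = (0 :: 't list \<Rightarrow>\<^sub>0 'k::comm_ring_1)"
  by (induction ts) (simp_all add: lext_diff bd_cone)

lemma bd_bd [simp]: "lext bd (lext bd c) = 0"
proof -
  have "lext bd (lext bd c) = lext (\<lambda>a. 0) c"
    by (subst lext_lext) (simp only: bd_bd_list)
  then show ?thesis by (simp add: lext_def)
qed

lemma keys_bd:
  "\<sigma> \<in> keys (bd ts :: _ \<Rightarrow>\<^sub>0 'k::comm_ring_1) \<Longrightarrow> Suc (length \<sigma>) = length ts \<and> set \<sigma> \<subseteq> set ts"
proof (induction ts arbitrary: \<sigma>)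
  case (Cons t ts)
  have "\<sigma> \<in> keys (single ts (1::'k)) \<or> \<sigma> \<in> keys (push ((#) t) (bd ts :: _ \<Rightarrow>\<^sub>0 'k))"
    using Cons.prems keys_diff[of "single ts (1::'k)" "push ((#) t) (bd ts)"] by auto
  then have "\<sigma> = ts \<or> \<sigma> \<in> (#) t ` keys (bd ts :: _ \<Rightarrow>\<^sub>0 'k)"
    using keys_push[of "(#) t" "bd ts :: _ \<Rightarrow>\<^sub>0 'k"] by auto
  then show ?case using Cons.IH by force
qed simp

lemma push_map_bd: "push (map f) (bd ts) = (bd (map f ts) :: _ \<Rightarrow>\<^sub>0 'k::comm_ring_1)"
proof (induction ts)
  case (Cons t ts)
  have "push (map f) (push ((#) t) (bd ts :: _ \<Rightarrow>\<^sub>0 'k)) = push ((#) (f t)) (push (map f) (bd ts))"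
    by (simp add: push_push)
  then show ?case using Cons by (simp add: push_diff)
qed simp

lemma push_map_lext_bd: "push (map f) (lext bd c) = lext bd (push (map f) c)"
  by (simp add: push_lext lext_push push_map_bd)

section \<open>Chains over \<open>\<int>\<^sub>(\<^sub>p\<^sub>)\<close>\<close>

abbreviation Zp :: "nat \<Rightarrow> rat set" where
  "Zp p \<equiv> carrier (localized_int p)"

lemma Zp_iff: "x \<in> Zp p \<longleftrightarrow> (\<exists>a b. x = of_int a / of_int b \<and> \<not> int p dvd b)"
  by (simp add: localized_int_def)

locale localization =
  fixes p :: nat
  assumes p: "Factorial_Ring.prime p"
begin

lemma Zp_add: "x \<in> Zp p \<Longrightarrow> y \<in> Zp p \<Longrightarrow> x + y \<in> Zp p"
  using cring.cring_simprules(1)[OF cring_localized_int[OF p], of x y] by (simp add: localized_int_def)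

lemma Zp_mult: "x \<in> Zp p \<Longrightarrow> y \<in> Zp p \<Longrightarrow> x * y \<in> Zp p"
  using cring.cring_simprules(5)[OF cring_localized_int[OF p], of x y] by (simp add: localized_int_def)

lemma Zp_of_int: "of_int n \<in> Zp p"
  unfolding Zp_iff using p by (intro exI[of _ n] exI[of _ 1]) (auto simp: not_prime_unit)

lemma Zp_0: "0 \<in> Zp p" and Zp_1: "1 \<in> Zp p" and Zp_p: "of_nat p \<in> Zp p"
  using Zp_of_int[of 0] Zp_of_int[of 1] Zp_of_int[of "int p"] by simp_all

lemma Zp_minus: "x \<in> Zp p \<Longrightarrow> - x \<in> Zp p"
  using Zp_mult[OF Zp_of_int[of "-1"]] by simp

lemma Zp_sum: "(\<And>a. a \<in> A \<Longrightarrow> f a \<in> Zp p) \<Longrightarrow> sum f A \<in> Zp p"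
  by (induction A rule: infinite_finite_induct) (auto simp: Zp_0 Zp_add)

lemma Zp_inverse:
  assumes "\<not> p dvd m"
  shows "1 / of_nat m \<in> Zp p"
  unfolding Zp_iff using assms by (intro exI[of _ 1] exI[of _ "int m"]) auto

text \<open>The ring is local with maximal ideal generated by \<open>p\<close>: if
  \<open>x = a / b\<close>, the numerator \<open>b - p a\<close> is as prime to \<open>p\<close> as
  \<open>b\<close>. This is the input for \<open>nakayama\<close>.\<close>

lemma Zp_unit:
  assumes "x \<in> Zp p"
  shows "1 - of_nat p * x \<noteq> 0" "1 / (1 - of_nat p * x) \<in> Zp p"
proof -
  obtain a b where x: "x = of_int a / of_int b" and b: "\<not> int p dvd b"
    using assms unfolding Zp_iff by blast
  have b': "\<not> int p dvd b - int p * a"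
    using b by (metis dvd_triv_left dvd_diff_left_iff)
  have nz: "b \<noteq> 0" "b - int p * a \<noteq> 0" using b b' by auto
  have eq: "1 - of_nat p * x = of_int (b - int p * a) / of_int b"
    using nz by (simp add: x field_simps)
  show "1 - of_nat p * x \<noteq> 0" unfolding eq using nz by (metis divide_eq_0_iff of_int_eq_0_iff)
  show "1 / (1 - of_nat p * x) \<in> Zp p"
    unfolding Zp_iff eq using b' by (intro exI[of _ b] exI[of _ "b - int p * a"]) simp
qed

text \<open>The denominators are prime to \<open>p\<close>, so every power of \<open>p\<close>
  divides the numerator \<open>a\<close>; the power with exponent \<bar>a\<bar> is already larger
  than \<bar>a\<bar>.\<close>

lemma Zp_separated:
  assumes "\<And>i. \<exists>y\<in>Zp p. x = of_nat p ^ i * y"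
  shows "x = 0"
proof (rule ccontr)
  assume "x \<noteq> 0"
  have "x \<in> Zp p" using assms[of 0] by simp
  then obtain a b where x: "x = of_int a / of_int b" and b: "\<not> int p dvd b"
    unfolding Zp_iff by blast
  have a: "a \<noteq> 0" and b0: "b \<noteq> 0" using x \<open>x \<noteq> 0\<close> by auto
  have "int p ^ i dvd a" for i
  proof -
    obtain c d where cd: "x = of_nat p ^ i * (of_int c / of_int d)" "\<not> int p dvd d"
      using assms[of i] unfolding Bex_def Zp_iff by blast
    have "d \<noteq> 0" using cd by auto
    then have "of_int (a * d) = (of_int (int p ^ i * c * b) :: rat)"
      using cd(1) b0 unfolding x by (simp add: field_simps)
    then have "a * d = int p ^ i * c * b" by (simp only: of_int_eq_iff)
    then have "int p ^ i dvd a * d" by (metis dvd_triv_left mult.assoc)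
    moreover have "coprime (int p ^ i) d"
      using cd(2) p by (simp add: prime_imp_coprime)
    ultimately show ?thesis by (simp add: coprime_dvd_mult_left_iff)
  qed
  then have "int p ^ nat \<bar>a\<bar> \<le> \<bar>a\<bar>"
    using a by (intro zdvd_imp_le) simp_all
  moreover have "nat \<bar>a\<bar> < p ^ nat \<bar>a\<bar>"
    using prime_gt_1_nat[OF p] by (simp add: power_gt_expt)
  ultimately show False
    by (metis int_nat_eq abs_ge_zero linorder_not_le of_nat_less_iff of_nat_power)
qed

text \<open>The elements of Z_(p) do not form a type, so chains have rational coefficients and
  modules over Z_(p) appear as sets closed under scalars from \<open>Zp p\<close>.\<close>

definition submod :: "('a \<Rightarrow>\<^sub>0 rat) set \<Rightarrow> bool" where
  "submod W \<longleftrightarrow> 0 \<in> W \<and> (\<forall>c\<in>W. \<forall>d\<in>W. c + d \<in> W) \<and> (\<forall>r\<in>Zp p. \<forall>c\<in>W. scl r c \<in> W)"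

lemma submodD:
  assumes "submod W"
  shows submod_zero: "0 \<in> W" and submod_add: "c \<in> W \<Longrightarrow> d \<in> W \<Longrightarrow> c + d \<in> W"
    and submod_scl: "r \<in> Zp p \<Longrightarrow> c \<in> W \<Longrightarrow> scl r c \<in> W"
    and submod_minus: "c \<in> W \<Longrightarrow> - c \<in> W" and submod_diff: "c \<in> W \<Longrightarrow> d \<in> W \<Longrightarrow> c - d \<in> W"
proof -
  show *: "0 \<in> W" "c \<in> W \<Longrightarrow> d \<in> W \<Longrightarrow> c + d \<in> W" "r \<in> Zp p \<Longrightarrow> c \<in> W \<Longrightarrow> scl r c \<in> W" for c d r
    using assms by (auto simp: submod_def)
  show m: "c \<in> W \<Longrightarrow> - c \<in> W" for c
    using *(3)[OF Zp_of_int[of "-1"]] by (simp add: scl_minus_one)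
  show "c \<in> W \<Longrightarrow> d \<in> W \<Longrightarrow> c - d \<in> W" for c d
    using *(2)[OF _ m, of c d] by simp
qed

lemma submod_sum: "submod W \<Longrightarrow> (\<And>a. a \<in> A \<Longrightarrow> f a \<in> W) \<Longrightarrow> sum f A \<in> W"
  by (induction A rule: infinite_finite_induct) (auto simp: submod_zero submod_add)

text \<open>The set is \<open>f(A) + V\<close>. It is used for \<open>f = D\<close>, to set up
  Nakayama's lemma, and for multiplication by \<open>p\<close>, to describe divisibility by
  \<open>p\<close> modulo null chains.\<close>

lemma submod_image_plus:
  assumes A: "submod A" and V: "submod V" and add: "\<And>c d. f (c + d) = f c + f d"
    and scl: "\<And>r c. f (scl r c) = scl r (f c)"
  shows "submod {c. \<exists>d\<in>A. c - f d \<in> V}"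
  unfolding submod_def
proof (intro conjI ballI CollectI)
  have "f 0 = 0" using scl[of 0 0] by simp
  then show "\<exists>d\<in>A. 0 - f d \<in> V" using submod_zero[OF A] submod_zero[OF V] by (intro bexI[of _ 0]) simp_all
next
  fix c d assume "c \<in> {c. \<exists>d\<in>A. c - f d \<in> V}" "d \<in> {c. \<exists>d\<in>A. c - f d \<in> V}"
  then obtain c' d' where *: "c' \<in> A" "d' \<in> A" "c - f c' \<in> V" "d - f d' \<in> V" by blast
  have "(c + d) - f (c' + d') = (c - f c') + (d - f d')" by (simp add: add)
  then show "\<exists>e\<in>A. c + d - f e \<in> V"
    using submod_add[OF V *(3,4)] submod_add[OF A *(1,2)] by metis
next
  fix r c assume r: "r \<in> Zp p" and "c \<in> {c. \<exists>d\<in>A. c - f d \<in> V}"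
  then obtain c' where *: "c' \<in> A" "c - f c' \<in> V" by blast
  have "scl r c - f (scl r c') = scl r (c - f c')" by (simp add: scl scl_diff)
  then show "\<exists>e\<in>A. scl r c - f e \<in> V"
    using submod_scl[OF V r *(2)] submod_scl[OF A r *(1)] by metis
qed

definition integral :: "('a \<Rightarrow>\<^sub>0 rat) \<Rightarrow> bool" where
  "integral c \<longleftrightarrow> (\<forall>a. lookup c a \<in> Zp p)"

lemma submod_lext:
  assumes "submod W" "integral c" "\<And>a. a \<in> keys c \<Longrightarrow> f a \<in> W"
  shows "lext f c \<in> W"
  unfolding lext_def using assms by (intro submod_sum submod_scl) (auto simp: integral_def)

lemma integral_add: "integral c \<Longrightarrow> integral d \<Longrightarrow> integral (c + d)"
  and integral_scl: "r \<in> Zp p \<Longrightarrow> integral c \<Longrightarrow> integral (scl r c)"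
  and integral_zero: "integral 0"
  and integral_single: "r \<in> Zp p \<Longrightarrow> integral (single a r)"
  by (auto simp: integral_def lookup_add Zp_add Zp_mult Zp_0 lookup_single when_def)

definition chains :: "'t set \<Rightarrow> nat \<Rightarrow> ('t list \<Rightarrow>\<^sub>0 rat) set" where
  "chains Y n = {c. integral c \<and> keys c \<subseteq> {ts. length ts = n \<and> set ts \<subseteq> Y}}"

lemma submod_chains: "submod (chains Y n)"
  unfolding submod_def chains_def
  using Poly_Mapping.keys_add keys_scl
  by (fastforce simp: integral_zero integral_add integral_scl)

lemma single_chains: "r \<in> Zp p \<Longrightarrow> length ts = n \<Longrightarrow> set ts \<subseteq> Y \<Longrightarrow> single ts r \<in> chains Y n"
  by (simp add: chains_def integral_single)

lemma chainsD: 
  assumes "c \<in> chains Y n"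
  shows "integral c" "ts \<in> keys c \<Longrightarrow> length ts = n" "ts \<in> keys c \<Longrightarrow> set ts \<subseteq> Y"
  using assms by (auto simp: chains_def)

lemma chains_mono: "Y \<subseteq> Y' \<Longrightarrow> chains Y n \<subseteq> chains Y' n"
  by (auto simp: chains_def)

lemma lext_chains:
  assumes "c \<in> chains Y n" "\<And>ts. length ts = n \<Longrightarrow> set ts \<subseteq> Y \<Longrightarrow> f ts \<in> chains Y' m"
  shows "lext f c \<in> chains Y' m"
  using assms by (intro submod_lext submod_chains) (auto dest: chainsD)

lemma push_chains:
  assumes "c \<in> chains Y n" "\<And>ts. length ts = n \<Longrightarrow> set ts \<subseteq> Y \<Longrightarrow> length (f ts) = m \<and> set (f ts) \<subseteq> Y'"
  shows "push f c \<in> chains Y' m"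
  unfolding push_def using assms by (intro lext_chains[OF assms(1)] single_chains Zp_1) auto

lemma bd_chains: "length ts = Suc n \<Longrightarrow> set ts \<subseteq> Y \<Longrightarrow> bd ts \<in> chains Y n"
proof (induction ts arbitrary: n)
  case (Cons t ts)
  show ?case
  proof (cases ts)
    case Nil
    then show ?thesis using Cons by (simp add: single_chains Zp_1)
  next
    case (Cons t' ts')
    then obtain m where n: "n = Suc m" using Cons.prems by (cases n) auto
    have "bd ts \<in> chains Y m" using Cons.IH[of m] Cons.prems n by simp
    then have "push ((#) t) (bd ts :: _ \<Rightarrow>\<^sub>0 rat) \<in> chains Y n"
      by (rule push_chains) (use Cons.prems n in auto)
    then show ?thesis
      using Cons.prems by (auto intro!: submod_diff[OF submod_chains] single_chains Zp_1)
  qed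
qed simp

lemma lext_bd_chains: "c \<in> chains Y (Suc n) \<Longrightarrow> lext bd c \<in> chains Y n"
  by (erule lext_chains) (rule bd_chains)

lemma integral_bd: "integral (bd ts)"
proof (cases "length ts")
  case (Suc n)
  then show ?thesis using bd_chains[of ts n "set ts"] by (auto dest: chainsD)
qed (simp add: integral_zero)

text \<open>Quotients of chain groups: lists outside \<open>L\<close> are set to zero and \<open>R\<close>-related lists are
  identified.\<close>

inductive_set nul :: "'t set \<Rightarrow> ('t list \<Rightarrow> bool) \<Rightarrow> ('t list \<Rightarrow> 't list \<Rightarrow> bool) \<Rightarrow> ('t list \<Rightarrow>\<^sub>0 rat) set"
  for Y L R where
  nul_zero: "0 \<in> nul Y L R"
| nul_dead: "\<lbrakk>c \<in> nul Y L R; r \<in> Zp p; set a \<subseteq> Y; \<not> L a\<rbrakk> \<Longrightarrow> c + single a r \<in> nul Y L R"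
| nul_rel: "\<lbrakk>c \<in> nul Y L R; r \<in> Zp p; set a \<subseteq> Y; set b \<subseteq> Y; R a b\<rbrakk>
    \<Longrightarrow> c + (single a r - single b r) \<in> nul Y L R"

lemma nul_add:
  assumes "d \<in> nul Y L R" "c \<in> nul Y L R"
  shows "c + d \<in> nul Y L R"
  using assms(1)
proof induction
  case (nul_dead d r a)
  then show ?case using nul.nul_dead[of "c + d" Y L R r a] by (simp add: add.assoc)
next
  case (nul_rel d r a b)
  then show ?case using nul.nul_rel[of "c + d" Y L R r a b] by (simp only: add.assoc)
qed (simp add: assms(2))

lemma nul_scl:
  assumes "c \<in> nul Y L R" "r \<in> Zp p"
  shows "scl r c \<in> nul Y L R"
  using assms(1)
proof induction
  case (nul_dead d s a)
  then show ?case using nul.nul_dead[of "scl r d" Y L R "r * s" a] Zp_mult assms(2) by (simp add: scl_add)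
next
  case (nul_rel d s a b)
  then show ?case
    using nul.nul_rel[of "scl r d" Y L R "r * s" a b] Zp_mult assms(2) by (simp add: scl_add scl_diff)
qed (simp add: nul_zero)

lemma submod_nul: "submod (nul Y L R)"
  by (simp add: submod_def nul_add nul_scl nul_zero)

lemma nul_deadI: "set a \<subseteq> Y \<Longrightarrow> \<not> L a \<Longrightarrow> single a 1 \<in> nul Y L R"
  using nul_dead[OF nul_zero Zp_1] by simp

lemma nul_relI: "set a \<subseteq> Y \<Longrightarrow> set b \<subseteq> Y \<Longrightarrow> R a b \<Longrightarrow> single a 1 - single b 1 \<in> nul Y L R"
  using nul_rel[OF nul_zero Zp_1] by simp

text \<open>Universal property of the quotient: a linear map into a quotient by \<open>W\<close>
  descends as soon as it respects the two kinds of generators.\<close>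

lemma nul_lext:
  assumes "c \<in> nul Y L R" and W: "submod W"
    and dead: "\<And>a. set a \<subseteq> Y \<Longrightarrow> \<not> L a \<Longrightarrow> f a \<in> W"
    and rel: "\<And>a b. set a \<subseteq> Y \<Longrightarrow> set b \<subseteq> Y \<Longrightarrow> R a b \<Longrightarrow> f a - f b \<in> W"
  shows "lext f c \<in> W"
  using assms(1)
proof (induction rule: nul.induct)
  case (nul_rel c r a b)
  have "scl r (f a - f b) \<in> W" using nul_rel rel W by (auto intro: submod_scl)
  then have "lext f c + scl r (f a - f b) \<in> W" using nul_rel.IH W by (auto intro: submod_add)
  then show ?case by (simp add: lext_add lext_diff scl_diff)
qed (auto simp: lext_add submod_zero[OF W] intro!: submod_add[OF W] submod_scl[OF W] dead)

lemma nul_mono: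
  assumes "c \<in> nul Y L R" "Y \<subseteq> Y'" "\<And>a. set a \<subseteq> Y \<Longrightarrow> L' a \<Longrightarrow> L a" "\<And>a b. R a b \<Longrightarrow> R' a b"
  shows "c \<in> nul Y' L' R'"
proof -
  have "lext (\<lambda>a. single a 1) c \<in> nul Y' L' R'"
    using assms(1) submod_nul by (rule nul_lext) (use assms(2-) in \<open>blast intro: nul_deadI nul_relI\<close>)+
  then show ?thesis by (simp add: lext_id)
qed

text \<open>The sum of the coefficients over \<open>A\<close>, written as a chain on a one-point set
  so that it is an instance of \<open>lext\<close>.\<close>

definition ssum :: "'a set \<Rightarrow> ('a \<Rightarrow>\<^sub>0 rat) \<Rightarrow> unit \<Rightarrow>\<^sub>0 rat" where
  "ssum A = lext (\<lambda>a. if a \<in> A then single () 1 else 0)"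

lemma ssum_add: "ssum A (c + d) = ssum A c + ssum A d"
  and ssum_diff: "ssum A (c - d) = ssum A c - ssum A d"
  and ssum_scl: "ssum A (scl r c) = scl r (ssum A c)"
  and ssum_single: "ssum A (single a r) = (if a \<in> A then single () r else 0)"
  by (simp_all add: ssum_def lext_add lext_diff lext_scl)

lemma ssum_cong: "(\<And>a. a \<in> keys c \<Longrightarrow> a \<in> A \<longleftrightarrow> a \<in> B) \<Longrightarrow> ssum A c = ssum B c"
  unfolding ssum_def by (rule lext_cong) simp

lemma nul_ssum:
  assumes "c \<in> nul Y L R" "\<And>a. set a \<subseteq> Y \<Longrightarrow> \<not> L a \<Longrightarrow> a \<notin> A"
    "\<And>a b. set a \<subseteq> Y \<Longrightarrow> set b \<subseteq> Y \<Longrightarrow> R a b \<Longrightarrow> a \<in> A \<longleftrightarrow> b \<in> A"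
  shows "ssum A c = 0"
proof -
  have "submod {0 :: unit \<Rightarrow>\<^sub>0 rat}" by (simp add: submod_def)
  from nul_lext[OF assms(1) this] show ?thesis unfolding ssum_def using assms(2,3) by fastforce
qed

lemma equivp_class: "equivp R \<Longrightarrow> R a b \<Longrightarrow> R d a \<longleftrightarrow> R d b"
  by (meson equivp_symp equivp_transp)

lemma nulI_ssum:
  assumes R: "equivp R" and LR: "\<And>a b. R a b \<Longrightarrow> L a \<longleftrightarrow> L b"
  shows "integral c \<Longrightarrow> keys c \<subseteq> {a. set a \<subseteq> Y} \<Longrightarrow> (\<And>a. set a \<subseteq> Y \<Longrightarrow> L a \<Longrightarrow> ssum {b. R a b} c = 0)
    \<Longrightarrow> c \<in> nul Y L R"
proof (induction "card (keys c)" arbitrary: c rule: less_induct)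
  case less
  note R_class = equivp_class[OF R]
  show ?case
  proof (cases "keys c = {}")
    case True
    then show ?thesis by (simp add: nul_zero)
  next
    case False
    then obtain a where a: "a \<in> keys c" by blast
    define r where "r = lookup c a"
    have r: "r \<in> Zp p" "r \<noteq> 0" and aY: "set a \<subseteq> Y"
      using a less.prems by (auto simp: r_def integral_def in_keys_iff)
    have smaller: "c' \<in> nul Y L R" if "integral c'" "keys c' \<subseteq> keys c - {a}"
      "\<And>a. set a \<subseteq> Y \<Longrightarrow> L a \<Longrightarrow> ssum {b. R a b} c' = 0" for c'
    proof (rule less.hyps)
      show "card (keys c') < card (keys c)"
        using that(2) a by (metis card_Diff1_less card_mono finite_Diff finite_keys le_less_trans)
    qed (use that less.prems in auto)
    show ?thesis
    proof (cases "L a")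
      case False
      have "c - single a r \<in> nul Y L R"
      proof (rule smaller)
        show "integral (c - single a r)"
          using less.prems(1) r Zp_minus by (simp add: integral_def r_def lookup_minus lookup_single when_def Zp_0)
        show "keys (c - single a r) \<subseteq> keys c - {a}"
          by (auto simp: in_keys_iff lookup_minus r_def lookup_single when_def split: if_splits)
        show "ssum {b. R a' b} (c - single a r) = 0" if "set a' \<subseteq> Y" "L a'" for a'
          using less.prems(3)[OF that] that(2) False LR by (auto simp: ssum_diff ssum_single)
      qed
      from nul_dead[OF this r(1) aY False] show ?thesis by simp
    next
      case True
      have "\<exists>b\<in>keys c. b \<noteq> a \<and> R a b"
      proof (rule ccontr)
        assume *: "\<not> ?thesis"
        have "ssum {b. R a b} c = ssum {a} c"
          by (rule ssum_cong) (use * R in \<open>auto intro: equivp_reflp\<close>)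
        also have "\<dots> = ssum {a} (single a r) + ssum {a} (c - single a r)"
          by (simp flip: ssum_add)
        also have "ssum {a} (c - single a r) = ssum {} (c - single a r)"
          by (rule ssum_cong) (auto simp: in_keys_iff lookup_minus r_def)
        finally have "ssum {b. R a b} c = single () r"
          by (simp add: ssum_single) (simp add: ssum_def lext_def)
        then show False using less.prems(3)[OF aY True] r(2) by (metis lookup_single_eq lookup_zero)
      qed
      then obtain b where b: "b \<in> keys c" "b \<noteq> a" "R a b" by blast
      have "c - (single a r - single b r) \<in> nul Y L R"
      proof (rule smaller)
        show "integral (c - (single a r - single b r))"
          using less.prems(1) r Zp_add[OF _ r(1)]
          by (simp add: integral_def r_def lookup_minus lookup_single when_def Zp_0)
        show "keys (c - (single a r - single b r)) \<subseteq> keys c - {a}"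
          using b by (auto simp: in_keys_iff lookup_minus r_def lookup_single when_def split: if_splits)
        show "ssum {b. R a' b} (c - (single a r - single b r)) = 0" if "set a' \<subseteq> Y" "L a'" for a'
          using less.prems(3)[OF that] R_class[OF b(3)] by (simp add: ssum_diff ssum_single)
      qed
      moreover have "set b \<subseteq> Y" using b less.prems by auto
      ultimately show ?thesis using nul_rel[of "c - (single a r - single b r)" Y L R r a b] r(1) aY b(3)
        by (simp only: diff_add_cancel)
    qed
  qed
qed

text \<open>The generators that witness \<open>c \<in> nul Y L R\<close> may involve lists outside
  \<open>Y'\<close>, so relations cannot simply be restricted. Class sums can: on the keys of
  \<open>c\<close> the two classes of an \<open>L'\<close>-list coincide. This is how nullity for
  \<open>J\<close> becomes nullity for a centralizer on fixed points.\<close>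

lemma nul_transfer:
  assumes c: "c \<in> nul Y L R" "integral c" "keys c \<subseteq> {a. set a \<subseteq> Y'}" "Y' \<subseteq> Y"
    and R: "equivp R" "\<And>a b. R a b \<Longrightarrow> L a \<longleftrightarrow> L b"
    and R': "equivp R'" "\<And>a b. R' a b \<Longrightarrow> L' a \<longleftrightarrow> L' b"
    and L: "\<And>a. set a \<subseteq> Y' \<Longrightarrow> L' a \<Longrightarrow> L a"
    and RR': "\<And>a b. set a \<subseteq> Y' \<Longrightarrow> set b \<subseteq> Y' \<Longrightarrow> L' a \<Longrightarrow> R a b \<longleftrightarrow> R' a b"
  shows "c \<in> nul Y' L' R'"
proof (rule nulI_ssum[OF R' c(2,3)])
  fix a assume a: "set a \<subseteq> Y'" "L' a"
  have "ssum {b. R' a b} c = ssum {b. R a b} c"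
    by (rule ssum_cong) (use RR'[OF a(1) _ a(2)] c(3) in auto)
  also have "\<dots> = 0"
    using c(1) by (rule nul_ssum) (use R(2) L[OF a] equivp_class[OF R(1)] in auto)
  finally show "ssum {b. R' a b} c = 0" .
qed

text \<open>The class sums are coordinates with values in Z_(p), which is separated by
  \<open>Zp_separated\<close>.\<close>

lemma nul_separated:
  assumes R: "equivp R" "\<And>a b. R a b \<Longrightarrow> L a \<longleftrightarrow> L b"
    and v: "v \<in> chains Y n" "\<And>i. \<exists>e\<in>chains Y n. v - scl (of_nat p ^ i) e \<in> nul Y L R"
  shows "v \<in> nul Y L R"
proof (rule nulI_ssum[OF R])
  fix a assume a: "set a \<subseteq> Y" "L a"
  have "lookup (ssum {b. R a b} v) () = 0"
  proof (rule Zp_separated)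
    fix i
    obtain e where e: "e \<in> chains Y n" "v - scl (of_nat p ^ i) e \<in> nul Y L R"
      using v(2) by blast
    have "ssum {b. R a b} (v - scl (of_nat p ^ i) e) = 0"
      using e(2) by (rule nul_ssum) (use R(2) a equivp_class[OF R(1)] in auto)
    then have "ssum {b. R a b} v = scl (of_nat p ^ i) (ssum {b. R a b} e)"
      by (simp add: ssum_diff ssum_scl)
    moreover have "lookup (ssum {b. R a b} e) () \<in> Zp p"
      using chainsD(1)[OF e(1)]
      by (auto simp: ssum_def lext_def lookup_sum integral_def Zp_0 intro!: Zp_sum Zp_mult Zp_1)
    ultimately show "\<exists>y\<in>Zp p. lookup (ssum {b. R a b} v) () = of_nat p ^ i * y"
      by auto
  qed
  then show "ssum {b. R a b} v = 0" by (simp add: poly_mapping_eqI)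
qed (use v(1) in \<open>auto simp: chains_def\<close>)


text \<open>Induction on the generators. In the congruence for \<open>x\<close> the generator
  \<open>x\<close> itself occurs with coefficient \<open>1 - p a\<close>, a unit, so
  \<open>x\<close> is a multiple of \<open>p\<close> of a combination of the others; substituting it
  keeps their congruences in the required form.\<close>

lemma nakayama:
  assumes "finite F" and W: "submod W"
    and gen: "\<And>b. b \<in> F \<Longrightarrow> \<exists>e. integral e \<and> keys e \<subseteq> F \<and> single b 1 - scl (of_nat p) e \<in> W"
  shows "b \<in> F \<Longrightarrow> single b 1 \<in> W"
  using assms(1) gen
proof (induction F arbitrary: b rule: finite_induct)
  case (insert x F)
  have split: "\<exists>a y. a \<in> Zp p \<and> integral y \<and> keys y \<subseteq> F \<and>
      single b 1 - scl (of_nat p) (single x a + y) \<in> W" if b_in: "b \<in> insert x F" for b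
  proof -
    obtain e where e: "integral e" "keys e \<subseteq> insert x F" "single b 1 - scl (of_nat p) e \<in> W"
      using insert.prems(2)[OF b_in] by blast
    define y where "y = e - single x (lookup e x)"
    have "e = single x (lookup e x) + y" by (simp add: y_def)
    moreover have "integral y"
      using e(1) by (auto simp: y_def integral_def lookup_minus lookup_single when_def Zp_0)
    moreover have "keys y \<subseteq> F"
      using e(2) by (auto simp: y_def in_keys_iff lookup_minus lookup_single when_def split: if_splits)
    ultimately show ?thesis using e by (metis integral_def)
  qed
  obtain a y where a: "a \<in> Zp p" and y: "integral y" "keys y \<subseteq> F"
    and ay: "single x 1 - scl (of_nat p) (single x a + y) \<in> W"
    using split[of x] by blast
  define u where "u = 1 / (1 - of_nat p * a)"
  have u: "u \<in> Zp p" "u * (1 - of_nat p * a) = 1"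
    using Zp_unit[OF a] by (simp_all add: u_def)
  have "scl u (single x 1 - scl (of_nat p) (single x a + y)) \<in> W"
    using submod_scl[OF W u(1) ay] .
  also have "scl u (single x 1 - scl (of_nat p) (single x a + y)) = single x 1 - scl (of_nat p * u) y"
  proof (rule poly_mapping_eqI)
    fix i
    show "lookup (scl u (single x 1 - scl (of_nat p) (single x a + y))) i = lookup (single x 1 - scl (of_nat p * u) y) i"
      using u(2) by (simp add: lookup_minus lookup_add lookup_single when_def algebra_simps)
  qed
  finally have x: "single x 1 - scl (of_nat p * u) y \<in> W" .
  have F: "single b 1 \<in> W" if "b \<in> F" for b
  proof (rule insert.IH[OF that])
    fix b assume "b \<in> F"
    then obtain a' y' where a': "a' \<in> Zp p" and y': "integral y'" "keys y' \<subseteq> F"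
      and *: "single b 1 - scl (of_nat p) (single x a' + y') \<in> W"
      using split[of b] by blast
    have pa: "of_nat p * a' \<in> Zp p" "of_nat p * u * a' \<in> Zp p" using a' u Zp_mult Zp_p by auto
    have "single b 1 - scl (of_nat p) (single x a' + y')
        + scl (of_nat p * a') (single x 1 - scl (of_nat p * u) y) \<in> W"
      using submod_add[OF W * submod_scl[OF W pa(1) x]] .
    also have "single b 1 - scl (of_nat p) (single x a' + y')
        + scl (of_nat p * a') (single x 1 - scl (of_nat p * u) y)
        = single b 1 - scl (of_nat p) (y' + scl (of_nat p * u * a') y)"
      by (rule poly_mapping_eqI)
        (simp add: lookup_minus lookup_add lookup_single when_def algebra_simps)
    finally show "\<exists>e. integral e \<and> keys e \<subseteq> F \<and> single b 1 - scl (of_nat p) e \<in> W"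
      using y y' pa(2) Poly_Mapping.keys_add[of y' "scl (of_nat p * u * a') y"]
        keys_scl[of "of_nat p * u * a'" y]
      by (intro exI[of _ "y' + scl (of_nat p * u * a') y"]) (auto intro: integral_add integral_scl)
  qed
  have "lext (\<lambda>a. single a 1) y \<in> W"
    using W y(1) by (rule submod_lext) (use F y(2) in auto)
  then have "scl (of_nat p * u) y \<in> W"
    using u(1) Zp_p Zp_mult W by (simp add: lext_id submod_scl)
  with x have "single x 1 \<in> W"
    using submod_add[OF W, of "single x 1 - scl (of_nat p * u) y"] by force
  with F show ?case using insert.prems(1) by blast
qed simp

text \<open>A contraction modulo \<open>p\<close> of a degreewise finitely generated quotient of the chain complex
  makes the quotient acyclic over \<open>\<int>\<^sub>(\<^sub>p\<^sub>)\<close>: by Nakayama's lemma the endomorphism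
  \<open>\<partial>k + k\<partial>\<close>, which is the identity modulo \<open>p\<close>, is surjective, and it is injective because the
  quotient is \<open>p\<close>-adically separated.\<close>

lemma exact_of_contraction_mod_p:
  assumes "finite Y" and V: "submod V"
    and bdV: "\<And>c. c \<in> V \<Longrightarrow> lext bd c \<in> V" and kV: "\<And>c. c \<in> V \<Longrightarrow> lext k c \<in> V"
    and k: "\<And>ts. set ts \<subseteq> Y \<Longrightarrow> k ts \<in> chains Y (Suc (length ts))"
    and contr: "\<And>ts. set ts \<subseteq> Y \<Longrightarrow> \<exists>e\<in>chains Y (length ts).
      single ts 1 - lext bd (k ts) - lext k (bd ts) - scl (of_nat p) e \<in> V"
    and sep: "\<And>v n. v \<in> chains Y n \<Longrightarrow> (\<And>i. \<exists>e\<in>chains Y n. v - scl (of_nat p ^ i) e \<in> V) \<Longrightarrow> v \<in> V"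
    and c: "c \<in> chains Y n" "lext bd c \<in> V"
  shows "\<exists>w\<in>chains Y (Suc n). c - lext bd w \<in> V"
proof -
  define D where "D c = lext bd (lext k c) + lext k (lext bd c)" for c
  have D_lin: "D (c - d) = D c - D d" "D (scl r c) = scl r (D c)" for c d r
    by (simp_all add: D_def lext_diff lext_scl scl_add)
  have DV: "D c \<in> V" if "c \<in> V" for c
    unfolding D_def using that bdV kV by (intro submod_add[OF V]) auto
  have bd0: "lext bd c = (0 :: _ \<Rightarrow>\<^sub>0 rat)" if "c \<in> chains Y 0" for c
    unfolding lext_def using that by (intro sum.neutral) (auto dest: chainsD)
  have kc: "lext k c \<in> chains Y (Suc n)" if "c \<in> chains Y n" for c n
    using that by (rule lext_chains) (use k in auto)
  have Dc: "D c \<in> chains Y n" if "c \<in> chains Y n" for c n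
  proof (cases n)
    case 0
    then show ?thesis using that lext_bd_chains[OF kc[OF that]] by (simp add: D_def bd0)
  next
    case (Suc m)
    then show ?thesis unfolding D_def
      using lext_bd_chains[OF kc[OF that]] kc[OF lext_bd_chains[OF that[unfolded Suc]]]
      by (simp add: submod_add[OF submod_chains])
  qed
  have contr': "\<exists>e\<in>chains Y n. c - D c - scl (of_nat p) e \<in> V" if c: "c \<in> chains Y n" for c n
  proof -
    have "\<exists>e. set ts \<subseteq> Y \<longrightarrow> e \<in> chains Y (length ts) \<and>
      single ts 1 - lext bd (k ts) - lext k (bd ts) - scl (of_nat p) e \<in> V" for ts
      using contr by blast
    then obtain e where e: "\<And>ts. set ts \<subseteq> Y \<Longrightarrow> e ts \<in> chains Y (length ts)"
      "\<And>ts. set ts \<subseteq> Y \<Longrightarrow> single ts 1 - lext bd (k ts) - lext k (bd ts) - scl (of_nat p) (e ts) \<in> V"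
      by metis
    have "lext (\<lambda>ts. single ts 1 - lext bd (k ts) - lext k (bd ts) - scl (of_nat p) (e ts)) c \<in> V"
      using V chainsD(1)[OF c] by (rule submod_lext) (use e c in \<open>auto dest: chainsD\<close>)
    moreover have "lext (\<lambda>ts. scl (of_nat p) (e ts)) c = scl (of_nat p) (lext e c)"
      by (simp add: lext_def scl_sum mult.commute)
    ultimately have "c - D c - scl (of_nat p) (lext e c) \<in> V"
      by (simp add: lext_diff_fun lext_id D_def lext_lext flip: diff_diff_eq)
    moreover have "lext e c \<in> chains Y n" using c by (rule lext_chains) (use e in auto)
    ultimately show ?thesis by blast
  qed
  define W where "W = {c. \<exists>d\<in>chains Y n. c - D d \<in> V}"
  have W: "submod W"
    unfolding W_def using submod_chains V
    by (rule submod_image_plus) (simp_all add: D_def lext_add lext_scl scl_add)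
  let ?F = "{ts. set ts \<subseteq> Y \<and> length ts = n}"
  have basis: "single ts 1 \<in> W" if "ts \<in> ?F" for ts
  proof (rule nakayama[OF finite_lists_length_eq[OF \<open>finite Y\<close>, of n] W _ that])
    fix b assume b: "b \<in> ?F"
    have sb: "single b 1 \<in> chains Y n" using b by (simp add: single_chains Zp_1)
    obtain e where e: "e \<in> chains Y n" "single b 1 - D (single b 1) - scl (of_nat p) e \<in> V"
      using contr'[OF sb] by blast
    have "single b 1 - scl (of_nat p) e \<in> W"
      unfolding W_def using e(2) sb by (auto intro!: bexI[of _ "single b 1"] simp: algebra_simps)
    then show "\<exists>e. integral e \<and> keys e \<subseteq> ?F \<and> single b 1 - scl (of_nat p) e \<in> W"
      using e(1) by (intro exI[of _ e]) (auto simp: chains_def)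
  qed
  have "lext (\<lambda>a. single a 1) c \<in> W"
    using W chainsD(1)[OF c(1)] by (rule submod_lext) (use basis c in \<open>auto dest: chainsD\<close>)
  then obtain d where d: "d \<in> chains Y n" "c - D d \<in> V"
    by (auto simp: lext_id W_def)
  \<comment> \<open>\<open>D\<close> commutes with the boundary, so \<open>D v\<close> is null
    because the boundary of \<open>c\<close> is. Once \<open>v\<close> itself is null,
    \<open>D d\<close> reduces to the boundary of \<open>lext k d\<close>.\<close>
  define v where "v = lext bd d"
  have "lext bd c - lext bd (D d) \<in> V" using bdV[OF d(2)] by (simp add: lext_diff)
  then have "lext bd c - (lext bd c - lext bd (D d)) \<in> V" by (rule submod_diff[OF V c(2)])
  moreover have "lext bd (D d) = D v" by (simp add: D_def v_def lext_add)
  ultimately have Dv: "D v \<in> V" by simp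
  have "v \<in> V"
  proof (cases n)
    case 0
    then show ?thesis using d(1) bd0 submod_zero[OF V] by (simp add: v_def)
  next
    case (Suc m)
    have v: "v \<in> chains Y m" unfolding v_def using d(1) Suc lext_bd_chains by blast
    show ?thesis
    proof (rule sep[OF v])
      fix i
      show "\<exists>e\<in>chains Y m. v - scl (of_nat p ^ i) e \<in> V"
      proof (induction i)
        case 0
        then show ?case using v submod_zero[OF V] by (intro bexI[of _ v]) simp_all
      next
        case (Suc i)
        then obtain e where e: "e \<in> chains Y m" "v - scl (of_nat p ^ i) e \<in> V" by blast
        obtain e' where e': "e' \<in> chains Y m" "e - D e - scl (of_nat p) e' \<in> V"
          using contr'[OF e(1)] by blast
        have pi: "of_nat p ^ i \<in> Zp p" using Zp_of_int[of "int p ^ i"] by simp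
        \<comment> \<open>Modulo \<open>V\<close>: if \<open>v = p^i e\<close>, then
          \<open>p^i D e = D v = 0\<close>, while \<open>e = D e + p e'\<close>; hence
          \<open>v = p^(i+1) e'\<close>.\<close>
        have 1: "v - scl (of_nat p ^ i) e - D (v - scl (of_nat p ^ i) e) + D v \<in> V"
          by (rule submod_add[OF V submod_diff[OF V e(2) DV[OF e(2)]] Dv])
        have 2: "scl (of_nat p ^ i) (e - D e - scl (of_nat p) e') \<in> V"
          using submod_scl[OF V pi e'(2)] .
        have "v - scl (of_nat p ^ Suc i) e' \<in> V"
          using submod_add[OF V 1 2] by (simp add: D_lin scl_diff mult.commute)
        then show ?case using e'(1) by blast
      qed
    qed
  qed
  then have "(c - D d) + lext k v \<in> V" by (rule submod_add[OF V d(2) kV])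
  then have "c - lext bd (lext k d) \<in> V" by (simp add: D_def v_def)
  then show ?thesis using kc[OF d(1)] by blast
qed

section \<open>Sums over the orbits of a permutation of order dividing \<open>p\<close>\<close>

lemma funpow_fixpoint_of_prime:
  assumes "(f ^^ p) u = u" "(f ^^ d) u = u" "0 < d" "d < p"
  shows "f u = u"
proof -
  have "coprime d p" using assms(3,4) p by (metis coprime_commute nat_dvd_not_less prime_imp_coprime)
  obtain x y where "d * x = p * y + 1"
    using bezout_add_strong_nat[of d p] assms(3) \<open>coprime d p\<close>
    by (metis coprime_common_divisor_nat less_not_refl3)
  then have eq: "d * x = y * p + 1" by (simp add: mult.commute)
  have iter: "(f ^^ (m * q)) u = u" if "(f ^^ q) u = u" for m q
    by (induction m) (simp_all add: that funpow_add)
  have "u = (f ^^ (d * x)) u" using iter[OF assms(2), of x] by (simp add: mult.commute)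
  also have "\<dots> = f ((f ^^ (y * p)) u)" by (subst eq) simp
  also have "\<dots> = f u" using iter[OF assms(1)] by simp
  finally show ?thesis by simp
qed

text \<open>Orbits have length 1 or \<open>p\<close>. Modulo \<open>W\<close> the function is
  constant on an orbit, so a long orbit contributes \<open>p f(u)\<close> and a fixed point
  contributes \<open>f(u)\<close>; both vanish by assumption.\<close>

lemma submod_sum_orbits:
  assumes W: "submod W"
  shows "finite U \<Longrightarrow> (\<And>u. u \<in> U \<Longrightarrow> \<tau> u \<in> U \<and> (\<tau> ^^ p) u = u) \<Longrightarrow>
    (\<And>u. u \<in> U \<Longrightarrow> f u - f (\<tau> u) \<in> W) \<Longrightarrow> (\<And>u. u \<in> U \<Longrightarrow> \<tau> u = u \<Longrightarrow> f u \<in> W) \<Longrightarrow>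
    (\<And>u. u \<in> U \<Longrightarrow> scl (of_nat p) (f u) \<in> W) \<Longrightarrow> sum f U \<in> W"
proof (induction "card U" arbitrary: U rule: less_induct)
  case less
  show ?case
  proof (cases "U = {}")
    case True
    then show ?thesis using submod_zero[OF W] by simp
  next
    case False
    then obtain u where u: "u \<in> U" by blast
    have p0: "p > 0" using p by (simp add: prime_gt_0_nat)
    have inU: "(\<tau> ^^ i) u \<in> U" for i using u less.prems(2) by (induction i) auto
    define B where "B = (\<lambda>i. (\<tau> ^^ i) u) ` {..<p}"
    have OU: "B \<subseteq> U" using inU by (auto simp: B_def)
    have O_all: "(\<tau> ^^ i) u \<in> B" for i
    proof -
      have "(\<tau> ^^ (i mod p)) u = (\<tau> ^^ i) u"
        using less.prems(2)[OF u] by (intro funpow_mod_eq) auto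
      then show ?thesis using p0 by (metis B_def imageI lessThan_iff mod_less_divisor)
    qed
    have uO: "u \<in> B" using O_all[of 0] by simp
    have rest: "sum f (U - B) \<in> W"
    proof (rule less.hyps)
      show "card (U - B) < card U"
        using u uO less.prems(1) by (metis Diff_iff Diff_subset psubset_card_mono psubsetI)
      show "finite (U - B)" using less.prems(1) by simp
      fix v assume v: "v \<in> U - B"
      have "\<tau> v \<notin> B"
      proof
        assume "\<tau> v \<in> B"
        then obtain i where "\<tau> v = (\<tau> ^^ i) u" by (auto simp: B_def)
        then have "(\<tau> ^^ (p - 1)) (\<tau> v) = (\<tau> ^^ (p - 1 + i)) u" by (simp add: funpow_add)
        moreover have "(\<tau> ^^ (p - 1)) (\<tau> v) = (\<tau> ^^ p) v"
          using p0 by (metis Suc_pred' comp_apply funpow_Suc_right)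
        ultimately have "v = (\<tau> ^^ (p - 1 + i)) u" using less.prems(2) v by auto
        then show False using O_all v by auto
      qed
      then show "\<tau> v \<in> U - B \<and> (\<tau> ^^ p) v = v" using v less.prems(2) by auto
    qed (use less.prems in auto)
    have fi: "f u - f ((\<tau> ^^ i) u) \<in> W" for i
    proof (induction i)
      case 0
      then show ?case using submod_zero[OF W] by simp
    next
      case (Suc i)
      then show ?case using submod_add[OF W Suc less.prems(3)[OF inU[of i]]] by simp
    qed
    have "sum f B \<in> W"
    proof (cases "\<tau> u = u")
      case True
      then have "(\<tau> ^^ i) u = u" for i by (induction i) auto
      then have "B = {u}" using uO by (auto simp: B_def)
      then show ?thesis using less.prems(4)[OF u True] by simp
    next
      case False
      have "inj_on (\<lambda>i. (\<tau> ^^ i) u) {..<p}"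
      proof (rule linorder_inj_onI')
        fix i j assume ij: "i \<in> {..<p}" "j \<in> {..<p}" "i < j"
        show "(\<tau> ^^ i) u \<noteq> (\<tau> ^^ j) u"
        proof
          assume "(\<tau> ^^ i) u = (\<tau> ^^ j) u"
          then have "(\<tau> ^^ (p - i)) ((\<tau> ^^ i) u) = (\<tau> ^^ (p - i)) ((\<tau> ^^ j) u)" by simp
          then have "(\<tau> ^^ p) u = (\<tau> ^^ (p - i + j)) u"
            using ij by (simp flip: funpow_add comp_apply[of "\<tau> ^^ _" "\<tau> ^^ _"])
          moreover have "p - i + j = (j - i) + p" using ij by auto
          ultimately have "u = (\<tau> ^^ (j - i)) ((\<tau> ^^ p) u)"
            using less.prems(2)[OF u] by (metis comp_apply funpow_add)
          then have "(\<tau> ^^ (j - i)) u = u" using less.prems(2)[OF u] by simp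
          then show False using funpow_fixpoint_of_prime[of \<tau> u "j - i"] less.prems(2)[OF u] ij False
            by (auto simp: less_imp_diff_less)
        qed
      qed
      then have "sum f B = (\<Sum>i<p. f ((\<tau> ^^ i) u))" by (simp add: B_def sum.reindex)
      also have "\<dots> = (\<Sum>i<p. f u) - (\<Sum>i<p. f u - f ((\<tau> ^^ i) u))" by (simp add: sum_subtractf)
      also have "(\<Sum>i<p. f u) = scl (of_nat p) (f u)"
        by (rule poly_mapping_eqI) (simp add: lookup_sum)
      also have "scl (of_nat p) (f u) - (\<Sum>i<p. f u - f ((\<tau> ^^ i) u)) \<in> W"
        by (rule submod_diff[OF W less.prems(5)[OF u] submod_sum[OF W fi]])
      finally show ?thesis .
    qed
    then have "sum f (U - B) + sum f B \<in> W" using rest by (intro submod_add[OF W])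
    then show ?thesis using sum.subset_diff[OF OU less.prems(1), of f] by simp
  qed
qed

end

section \<open>Group actions on chains\<close>

lemma (in group) conj_eq_one:
  assumes "g \<in> carrier G" "h \<in> carrier G" "g \<otimes> h \<otimes> inv g = \<one>"
  shows "h = \<one>"
proof -
  have "g \<otimes> h = g" using assms by (metis inv_closed inv_equality inv_inv m_closed)
  then show ?thesis using assms(1,2) by simp
qed

locale set_action = group G for G (structure) +
  fixes T :: "'t set" and act :: "'a \<Rightarrow> 't \<Rightarrow> 't"
  assumes act_closed: "g \<in> carrier G \<Longrightarrow> t \<in> T \<Longrightarrow> act g t \<in> T"
    and act_one: "t \<in> T \<Longrightarrow> act \<one> t = t"
    and act_mult: "g \<in> carrier G \<Longrightarrow> h \<in> carrier G \<Longrightarrow> t \<in> T \<Longrightarrow> act (g \<otimes> h) t = act g (act h t)"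
begin

abbreviation mact :: "'a \<Rightarrow> 't list \<Rightarrow> 't list" where
  "mact g \<equiv> map (act g)"

lemma mact_closed: "g \<in> carrier G \<Longrightarrow> set a \<subseteq> T \<Longrightarrow> set (mact g a) \<subseteq> T"
  using act_closed by auto

lemma mact_one: "set a \<subseteq> T \<Longrightarrow> mact \<one> a = a"
  using act_one by (induction a) auto

lemma mact_mult: "g \<in> carrier G \<Longrightarrow> h \<in> carrier G \<Longrightarrow> set a \<subseteq> T \<Longrightarrow> mact (g \<otimes> h) a = mact g (mact h a)"
  using act_mult by (induction a) auto

lemma act_inv: "g \<in> carrier G \<Longrightarrow> t \<in> T \<Longrightarrow> act (inv g) (act g t) = t"
  by (metis act_mult act_one inv_closed l_inv)

lemma act_inv': "g \<in> carrier G \<Longrightarrow> t \<in> T \<Longrightarrow> act g (act (inv g) t) = t"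
  by (metis act_mult act_one inv_closed r_inv)

lemma mact_inv: "g \<in> carrier G \<Longrightarrow> set a \<subseteq> T \<Longrightarrow> mact (inv g) (mact g a) = a"
  using act_inv by (induction a) auto

text \<open>The stabilizer of the list in \<open>K\<close> is trivial. For the empty list the
  stabilizer is all of \<open>K\<close>, so the augmentation generator is dead unless
  \<open>K\<close> is trivial.\<close>

definition live :: "'a set \<Rightarrow> 't list \<Rightarrow> bool" where
  "live K ts \<longleftrightarrow> (\<forall>g\<in>K. (\<forall>t\<in>set ts. act g t = t) \<longrightarrow> g = \<one>)"

text \<open>The alternative \<open>a = b\<close> makes the relation reflexive on lists outside
  \<open>T\<close> as well, hence an equivalence on the whole type.\<close>

definition rel :: "'a set \<Rightarrow> 't list \<Rightarrow> 't list \<Rightarrow> bool" where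
  "rel K a b \<longleftrightarrow> a = b \<or> (set a \<subseteq> T \<and> set b \<subseteq> T \<and> (\<exists>g\<in>K. mact g a = b))"

lemma relI: "g \<in> K \<Longrightarrow> K \<subseteq> carrier G \<Longrightarrow> set a \<subseteq> T \<Longrightarrow> rel K a (mact g a)"
  using mact_closed unfolding rel_def by blast

lemma equivp_rel:
  assumes K: "subgroup K G"
  shows "equivp (rel K)"
proof (rule equivpI)
  interpret K: subgroup K G by fact
  show "reflp (rel K)" by (simp add: reflp_def rel_def)
  show "symp (rel K)"
  proof (rule sympI)
    fix a b assume "rel K a b"
    then consider "a = b" | g where "set a \<subseteq> T" "set b \<subseteq> T" "g \<in> K" "b = mact g a"
      by (auto simp: rel_def)
    then show "rel K b a"
    proof cases
      case 2
      then have "mact (inv g) b = a" using mact_inv by simp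
      then show ?thesis using 2 unfolding rel_def by (metis K.m_inv_closed)
    qed (simp add: rel_def)
  qed
  show "transp (rel K)"
  proof (rule transpI)
    fix a b c assume "rel K a b" "rel K b c"
    then show "rel K a c"
      unfolding rel_def by (metis K.m_closed K.mem_carrier mact_mult)
  qed
qed

lemma conj_fixes:
  assumes "g \<in> carrier G" "h \<in> carrier G" "t \<in> T"
  shows "act (g \<otimes> h \<otimes> inv g) (act g t) = act g t \<longleftrightarrow> act h t = t"
proof -
  have "act (g \<otimes> h \<otimes> inv g) (act g t) = act g (act h t)"
    using assms by (simp add: act_mult act_closed act_inv)
  then show ?thesis using assms by (metis act_closed act_inv)
qed

lemma conj_in_subgroup: "subgroup K G \<Longrightarrow> g \<in> K \<Longrightarrow> h \<in> K \<Longrightarrow> g \<otimes> h \<otimes> inv g \<in> K"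
  by (simp add: subgroup.m_closed subgroup.m_inv_closed)

lemma live_mact:
  assumes K: "subgroup K G" and g: "g \<in> K" and a: "set a \<subseteq> T"
  shows "live K (mact g a) \<longleftrightarrow> live K a"
proof -
  have *: "live K a" if "live K (mact g a)" "g \<in> K" "set a \<subseteq> T" for g a
    unfolding live_def
  proof (intro ballI impI)
    fix h assume h: "h \<in> K" "\<forall>t\<in>set a. act h t = t"
    have carr: "g \<in> carrier G" "h \<in> carrier G" using K h(1) that(2) by (auto dest: subgroup.mem_carrier)
    have "\<forall>t\<in>set (mact g a). act (g \<otimes> h \<otimes> inv g) t = t"
      using conj_fixes[OF carr] that(3) h(2) by auto
    then have "g \<otimes> h \<otimes> inv g = \<one>"
      using that(1) conj_in_subgroup[OF K that(2) h(1)] unfolding live_def by blast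
    then show "h = \<one>" by (rule conj_eq_one[OF carr])
  qed
  have gc: "g \<in> carrier G" using K g by (rule subgroup.mem_carrier)
  show ?thesis
    using *[OF _ g a] *[of "inv g" "mact g a"] subgroup.m_inv_closed[OF K g] mact_closed[OF gc a] mact_inv[OF gc a]
    by auto
qed

lemma live_rel:
  assumes "subgroup K G" "H \<subseteq> K" "rel H a b"
  shows "live K a \<longleftrightarrow> live K b"
  using assms live_mact unfolding rel_def by blast

text \<open>Freeness on live lists. It makes the choice of translating elements in
  \<open>equivariant_contraction\<close> consistent, and it forces elements of \<open>J\<close> into
  the centralizer in \<open>finite_fixed_points_exact\<close>.\<close>

lemma live_unique:
  assumes K: "subgroup K G" and "live K a" "set a \<subseteq> T" "g \<in> K" "h \<in> K" "mact g a = mact h a"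
  shows "g = h"
proof -
  have carr: "g \<in> carrier G" "h \<in> carrier G" using assms by (auto dest: subgroup.mem_carrier)
  have "act (inv h \<otimes> g) t = t" if "t \<in> set a" for t
  proof -
    have "act g t = act h t" using that assms(6) by (metis map_eq_conv)
    then show ?thesis using that assms(3) carr by (auto simp: act_mult act_inv subset_iff)
  qed
  moreover have "inv h \<otimes> g \<in> K" using assms by (simp add: subgroup.m_closed subgroup.m_inv_closed)
  ultimately have "inv h \<otimes> g = \<one>" using assms(2) unfolding live_def by blast
  then show ?thesis using carr by (metis inv_equality inv_inv inv_closed)
qed

lemma live_antimono: "live K a \<Longrightarrow> set a \<subseteq> set b \<Longrightarrow> live K b"
  unfolding live_def by blast

lemma push_mact_mult:
  assumes "g \<in> carrier G" "h \<in> carrier G" "\<And>a. a \<in> keys c \<Longrightarrow> set a \<subseteq> T"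
  shows "push (mact (g \<otimes> h)) c = push (mact g) (push (mact h) c)"
  unfolding push_push using assms by (intro push_cong) (auto simp: mact_mult)

end

locale p_action = localization p + set_action G T act
  for p :: nat and G :: "('a, 'b) monoid_scheme" (structure) and T :: "'t set" and act :: "'a \<Rightarrow> 't \<Rightarrow> 't"
begin

abbreviation null :: "'t set \<Rightarrow> 'a set \<Rightarrow> 'a set \<Rightarrow> ('t list \<Rightarrow>\<^sub>0 rat) set" where
  "null Y K H \<equiv> nul Y (live K) (rel H)"

text \<open>A face has fewer vertices and thus a larger stabilizer, so faces of dead lists are dead;
  translates have translated faces.\<close>

lemma null_bd:
  assumes "c \<in> null Y K H" "Y \<subseteq> T"
  shows "lext bd c \<in> null Y K H"
  using assms(1) submod_nul
proof (rule nul_lext)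
  fix a assume a: "set a \<subseteq> Y" "\<not> live K a"
  have "lext (\<lambda>a. single a 1) (bd a) \<in> null Y K H"
    using submod_nul integral_bd
  proof (rule submod_lext)
    fix \<sigma> assume "\<sigma> \<in> keys (bd a :: _ \<Rightarrow>\<^sub>0 rat)"
    then have "set \<sigma> \<subseteq> set a" using keys_bd by blast
    then show "single \<sigma> 1 \<in> null Y K H"
      using a live_antimono by (intro nul_deadI) auto
  qed
  then show "bd a \<in> null Y K H" by (simp add: lext_id)
next
  fix a b assume ab: "set a \<subseteq> Y" "set b \<subseteq> Y" "rel H a b"
  show "bd a - bd b \<in> null Y K H"
  proof (cases "a = b")
    case False
    then obtain g where g: "g \<in> H" "b = mact g a" using ab by (auto simp: rel_def)
    have "lext (\<lambda>\<sigma>. single \<sigma> 1 - single (mact g \<sigma>) 1) (bd a) \<in> null Y K H"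
      using submod_nul integral_bd
    proof (rule submod_lext)
      fix \<sigma> assume "\<sigma> \<in> keys (bd a :: _ \<Rightarrow>\<^sub>0 rat)"
      then have \<sigma>: "set \<sigma> \<subseteq> set a" using keys_bd by blast
      then have "set (mact g \<sigma>) \<subseteq> set b" using g by auto
      then show "single \<sigma> 1 - single (mact g \<sigma>) 1 \<in> null Y K H"
        using \<sigma> ab g assms(2) unfolding rel_def by (intro nul_relI) blast+
    qed
    then show ?thesis by (simp add: lext_diff_fun lext_id g(2) push_def flip: push_map_bd)
  qed (simp add: nul_zero)
qed

text \<open>If \<open>b = h a\<close>, then \<open>g b = (g h g^-1)(g a)\<close>: stability of
  \<open>H\<close> under conjugation by \<open>g\<close> is what preserves the relation.\<close>

lemma null_push:
  assumes c: "c \<in> null Y K H" and Y: "Y \<subseteq> T" "\<And>t. t \<in> Y \<Longrightarrow> act g t \<in> Y"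
    and K: "subgroup K G" "g \<in> K" and H: "H \<subseteq> carrier G" "\<And>h. h \<in> H \<Longrightarrow> g \<otimes> h \<otimes> inv g \<in> H"
  shows "push (mact g) c \<in> null Y K H"
  unfolding push_def using c submod_nul
proof (rule nul_lext)
  have g: "g \<in> carrier G" using K by (rule subgroup.mem_carrier)
  fix a assume a: "set a \<subseteq> Y"
  have ga: "set (mact g a) \<subseteq> Y" using a Y(2) by auto
  show "single (mact g a) 1 \<in> null Y K H" if "\<not> live K a"
    using ga live_mact[OF K] a Y(1) that by (intro nul_deadI) auto
  fix b assume b: "set b \<subseteq> Y" "rel H a b"
  have gb: "set (mact g b) \<subseteq> Y" using b Y(2) by auto
  have "rel H (mact g a) (mact g b)"
  proof (cases "a = b")
    case False
    then obtain h where h: "h \<in> H" "b = mact h a" using b by (auto simp: rel_def)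
    have aT: "set a \<subseteq> T" using a Y by blast
    have hG: "h \<in> carrier G" using h H by blast
    have "mact (g \<otimes> h \<otimes> inv g) (mact g a) = mact (g \<otimes> h) (mact (inv g) (mact g a))"
      using g hG by (intro mact_mult mact_closed[OF g aT]) auto
    then have "mact g b = mact (g \<otimes> h \<otimes> inv g) (mact g a)"
      unfolding mact_inv[OF g aT] mact_mult[OF g hG aT] h(2) by simp
    then show ?thesis using H(2)[OF h(1)] ga gb Y(1) by (auto simp: rel_def)
  qed (simp add: rel_def)
  then show "single (mact g a) 1 - single (mact g b) 1 \<in> null Y K H"
    using ga gb by (intro nul_relI)
qed

text \<open>The contraction is \<open>\<sigma> \<mapsto> |U|\<^sup>-\<^sup>1 \<Sum>\<^sub>u u\<sigma>\<close> on live lists. It fails to be a contraction only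
  by faces that are dead, i.e. fixed by some \<open>y\<close> of order \<open>p\<close>, where the summands are
  identified along \<open>y\<close>-orbits, so that the sum is divisible by \<open>p\<close>.\<close>

lemma finite_group_exact:
  assumes C: "subgroup C G" and Y: "finite Y" "Y \<subseteq> T" "\<And>g t. g \<in> C \<Longrightarrow> t \<in> Y \<Longrightarrow> act g t \<in> Y"
    and U: "U \<subseteq> Y" "\<not> p dvd card U" "\<And>g t. g \<in> C \<Longrightarrow> t \<in> U \<Longrightarrow> act g t \<in> U"
    and dead: "\<And>a. set a \<subseteq> Y \<Longrightarrow> \<not> live C a \<Longrightarrow> \<exists>y\<in>C. y \<noteq> \<one> \<and> y [^] p = \<one> \<and> (\<forall>t\<in>set a. act y t = t)"
    and c: "c \<in> chains Y n" "lext bd c \<in> null Y C C"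
  shows "\<exists>w\<in>chains Y (Suc n). c - lext bd w \<in> null Y C C"
proof -
  let ?V = "null Y C C"
  have V: "submod ?V" by (rule submod_nul)
  have CG: "C \<subseteq> carrier G" using C by (rule subgroup.subset)
  have finU: "finite U" using U(1) Y(1) by (rule finite_subset)
  define m :: rat where "m = 1 / of_nat (card U)"
  have m: "m \<in> Zp p" using Zp_inverse[OF U(2)] by (simp add: m_def)
  have m1: "m * of_nat (card U) = 1" using U(2) by (cases "card U = 0") (auto simp: m_def)
  define h where "h a = scl m (\<Sum>u\<in>U. single (u # a) 1)" for a
  \<comment> \<open>On a dead list \<open>h\<close> is only divisible by \<open>p\<close> modulo
    null chains, not null. Setting \<open>k\<close> to zero there makes it well defined on the
    quotient, at the price of an error that is divisible by \<open>p\<close>.\<close>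
  define k where "k a = (if live C a then h a else 0)" for a
  have h: "h a \<in> chains Y (Suc (length a))" if "set a \<subseteq> Y" for a
    unfolding h_def using that U(1) m
    by (intro submod_scl[OF submod_chains] submod_sum[OF submod_chains] single_chains) (auto simp: Zp_1)
  have hrel: "h a - h (mact g a) \<in> ?V" if "set a \<subseteq> Y" "g \<in> C" for a g
  proof -
    have "bij_betw (act g) U U"
    proof (rule bij_betwI[where g = "act (inv g)"])
      show "act g \<in> U \<rightarrow> U" "act (inv g) \<in> U \<rightarrow> U"
        using U(3) that(2) subgroup.m_inv_closed[OF C] by auto
      show "act (inv g) (act g u) = u" "act g (act (inv g) u) = u" if "u \<in> U" for u
        using act_inv act_inv' \<open>g \<in> C\<close> CG that U(1) Y(2) by blast+
    qed
    then have "(\<Sum>u\<in>U. single (u # mact g a) (1::rat)) = (\<Sum>u\<in>U. single (mact g (u # a)) 1)"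
      by (simp add: sum.reindex_bij_betw[of "act g" U U "\<lambda>u. single (u # mact g a) 1", symmetric])
    then have "h a - h (mact g a) = scl m (\<Sum>u\<in>U. single (u # a) 1 - single (mact g (u # a)) 1)"
      by (simp add: h_def scl_diff sum_subtractf)
    also have "\<dots> \<in> ?V"
    proof (intro submod_scl[OF V m] submod_sum[OF V] nul_relI)
      fix u assume "u \<in> U"
      then show ua: "set (u # a) \<subseteq> Y" "set (mact g (u # a)) \<subseteq> Y"
        using U(1) Y that by auto
      show "rel C (u # a) (mact g (u # a))"
        by (rule relI[OF that(2) CG subset_trans[OF ua(1) Y(2)]])
    qed
    finally show ?thesis .
  qed
  \<comment> \<open>Chains divisible by \<open>p\<close> modulo null chains: the errors that
    \<open>exact_of_contraction_mod_p\<close> tolerates.\<close>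
  define Q where "Q n = {c. \<exists>e\<in>chains Y n. c - scl (of_nat p) e \<in> ?V}" for n
  have Q: "submod (Q n)" for n
    unfolding Q_def using submod_chains V by (rule submod_image_plus) (simp_all add: scl_add mult.commute)
  have VQ: "c \<in> Q n" if "c \<in> ?V" for c n
    unfolding Q_def using that submod_zero[OF submod_chains, of Y n] by (auto intro!: bexI[of _ 0])
  have hdead: "h a \<in> Q (Suc (length a))" if a: "set a \<subseteq> Y" "\<not> live C a" for a
  proof -
    obtain y where y: "y \<in> C" "y \<noteq> \<one>" "y [^] p = \<one>" "\<forall>t\<in>set a. act y t = t"
      using dead[OF a] by blast
    have yG: "y \<in> carrier G" using y(1) CG by blast
    have ya: "mact y a = a" using y(4) by (simp add: map_idI)
    have pow: "(act y ^^ i) u = act (y [^] i) u" if "u \<in> U" for u and i :: nat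
    proof (induction i)
      case 0
      then show ?case using act_one that U(1) Y(2) by auto
    next
      case (Suc i)
      have "act (y [^] Suc i) u = act (y \<otimes> y [^] i) u" using yG by (metis nat_pow_Suc2)
      then show ?case using Suc act_mult yG that U(1) Y(2) by (auto simp: subset_iff)
    qed
    have "(\<Sum>u\<in>U. single (u # a) 1) \<in> Q (Suc (length a))"
    proof (rule submod_sum_orbits[where \<tau> = "act y"])
      fix u assume u: "u \<in> U"
      show "act y u \<in> U \<and> (act y ^^ p) u = u"
        using u U(1,3) y(1,3) pow act_one Y(2) by auto
      have ua: "set (u # a) \<subseteq> Y" using u a U(1) by auto
      have "single (u # a) 1 - single (mact y (u # a)) 1 \<in> ?V"
        using ua Y y(1) CG by (intro nul_relI relI) auto
      then show "single (u # a) 1 - single (act y u # a) 1 \<in> Q (Suc (length a))"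
        using VQ ya by simp
      show "single (u # a) 1 \<in> Q (Suc (length a))" if "act y u = u"
        using y(1,2,4) that ua by (intro VQ nul_deadI) (auto simp: live_def)
      show "scl (of_nat p) (single (u # a) 1) \<in> Q (Suc (length a))"
        unfolding Q_def mem_Collect_eq using ua submod_zero[OF V]
        by (intro bexI[of _ "single (u # a) 1"] single_chains Zp_1) auto
    qed (use Q finU in auto)
    then show ?thesis unfolding h_def using Q m by (intro submod_scl)
  qed
  show ?thesis
  proof (rule exact_of_contraction_mod_p[OF Y(1) V, of k, OF null_bd[OF _ Y(2)] _ _ _ _ c])
    fix c assume "c \<in> ?V"
    then show "lext k c \<in> ?V" using V
    proof (rule nul_lext)
      fix a b assume ab: "set a \<subseteq> Y" "set b \<subseteq> Y" "rel C a b"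
      have "live C a \<longleftrightarrow> live C b" using live_rel[OF C _ ab(3)] by simp
      moreover have "h a - h b \<in> ?V"
      proof (cases "a = b")
        case False
        then show ?thesis using ab hrel by (auto simp: rel_def)
      qed (simp add: nul_zero)
      ultimately show "k a - k b \<in> ?V" by (simp add: k_def nul_zero)
    qed (simp add: k_def nul_zero)
  next
    fix a assume "set a \<subseteq> Y"
    then show "k a \<in> chains Y (Suc (length a))" 
      using h submod_zero[OF submod_chains, of Y "Suc (length a)"] by (simp add: k_def)
  next
    fix a assume a: "set a \<subseteq> Y"
    have face: "set \<sigma> \<subseteq> set a" "Suc (length \<sigma>) = length a" if "\<sigma> \<in> keys (bd a :: _ \<Rightarrow>\<^sub>0 rat)" for \<sigma>
      using that keys_bd by blast+
    have "single a 1 - lext bd (k a) - lext k (bd a) \<in> Q (length a)"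
    proof (cases "live C a")
      case False
      have "lext k (bd a) = 0"
        unfolding lext_def using False face live_antimono by (intro sum.neutral) (auto simp: k_def)
      moreover have "single a 1 \<in> Q (length a)" using a False by (intro VQ nul_deadI)
      ultimately show ?thesis using False by (simp add: k_def)
    next
      case True
      have "lext h c = scl m (\<Sum>u\<in>U. push ((#) u) c)" for c
      proof -
        have "lext h c = (\<Sum>x\<in>keys c. scl m (\<Sum>u\<in>U. scl (lookup c x) (single (u # x) 1)))"
          by (simp add: lext_def h_def scl_sum mult.commute)
        also have "\<dots> = scl m (\<Sum>u\<in>U. push ((#) u) c)"
          by (simp add: push_def lext_def scl_sum sum.swap[of _ U])
        finally show ?thesis .
      qed
      moreover have "lext bd (h a) = scl m (\<Sum>u\<in>U. single a 1 - push ((#) u) (bd a))"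
        by (simp add: h_def lext_scl lext_sum)
      moreover have "scl m (\<Sum>u\<in>U. single a 1) = single a 1"
        by (rule poly_mapping_eqI) (simp add: lookup_sum lookup_single when_def m1)
      ultimately have "lext bd (h a) = single a 1 - lext h (bd a)"
        by (simp add: sum_subtractf scl_diff)
      then have "single a 1 - lext bd (k a) - lext k (bd a) = lext (\<lambda>\<sigma>. h \<sigma> - k \<sigma>) (bd a)"
        using k_def[of a] True by (simp add: lext_diff_fun)
      also have "\<dots> \<in> Q (length a)"
      proof (rule submod_lext[OF Q integral_bd])
        fix \<sigma> assume \<sigma>: "\<sigma> \<in> keys (bd a :: _ \<Rightarrow>\<^sub>0 rat)"
        show "h \<sigma> - k \<sigma> \<in> Q (length a)"
          using hdead[of \<sigma>] face[OF \<sigma>] a submod_zero[OF Q] by (auto simp: k_def)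
      qed
      finally show ?thesis .
    qed
    then show "\<exists>e\<in>chains Y (length a). single a 1 - lext bd (k a) - lext k (bd a) - scl (of_nat p) e \<in> ?V"
      by (simp add: Q_def)
  next
    fix v n
    assume v: "v \<in> chains Y n" "\<And>i. \<exists>e\<in>chains Y n. v - scl (of_nat p ^ i) e \<in> ?V"
    show "v \<in> ?V"
      using equivp_rel[OF C] _ v by (rule nul_separated) (rule live_rel[OF C subset_refl])
  qed
qed

text \<open>The method of acyclic carriers: \<open>Y ts\<close> bounds the vertices of
  \<open>s ts\<close>. Since \<open>\<Gamma>\<close> acts freely on \<open>L\<close>-lists, a value
  chosen at one representative of each orbit can be transported unambiguously; so \<open>s\<close>
  is strictly equivariant, although the homotopy identity holds only modulo \<open>V\<close>. It is
  applied to \<open>J\<close> with fixed-point carriers in \<open>finite_exact\<close>, and to the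
  whole group with the constant carrier \<open>T\<close> in \<open>cochains_exact\<close>.\<close>

lemma equivariant_contraction:
  assumes \<Gamma>: "subgroup \<Gamma> G" and ST: "S \<subseteq> T" and S_act: "\<And>g t. g \<in> \<Gamma> \<Longrightarrow> t \<in> S \<Longrightarrow> act g t \<in> S"
    and L: "\<And>ts g. set ts \<subseteq> S \<Longrightarrow> g \<in> \<Gamma> \<Longrightarrow> L (mact g ts) \<longleftrightarrow> L ts"
    and L_live: "\<And>ts. set ts \<subseteq> S \<Longrightarrow> L ts \<Longrightarrow> live \<Gamma> ts"
    and L_Nil: "\<not> L []"
    and L_face: "\<And>ts \<sigma>. set ts \<subseteq> S \<Longrightarrow> set \<sigma> \<subseteq> set ts \<Longrightarrow> L \<sigma> \<Longrightarrow> L ts"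
    and V: "submod V" and bdV: "\<And>c. c \<in> V \<Longrightarrow> lext bd c \<in> V"
    and \<Gamma>V: "\<And>g c. g \<in> \<Gamma> \<Longrightarrow> c \<in> V \<Longrightarrow> push (mact g) c \<in> V"
    and deadV: "\<And>ts. set ts \<subseteq> S \<Longrightarrow> \<not> L ts \<Longrightarrow> single ts 1 \<in> V"
    and Y: "\<And>ts. set ts \<subseteq> S \<Longrightarrow> set ts \<subseteq> Y ts \<and> Y ts \<subseteq> S"
    and Y_act: "\<And>ts g t. set ts \<subseteq> S \<Longrightarrow> g \<in> \<Gamma> \<Longrightarrow> t \<in> Y ts \<Longrightarrow> act g t \<in> Y (mact g ts)"
    and Y_face: "\<And>ts \<sigma>. set ts \<subseteq> S \<Longrightarrow> set \<sigma> \<subseteq> set ts \<Longrightarrow> Y \<sigma> \<subseteq> Y ts"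
    and exact: "\<And>ts e. set ts \<subseteq> S \<Longrightarrow> L ts \<Longrightarrow> e \<in> chains (Y ts) (length ts) \<Longrightarrow> lext bd e \<in> V
      \<Longrightarrow> \<exists>w\<in>chains (Y ts) (Suc (length ts)). e - lext bd w \<in> V"
  obtains s where "\<And>ts. set ts \<subseteq> S \<Longrightarrow> s ts \<in> chains (Y ts) (Suc (length ts))"
    "\<And>ts. set ts \<subseteq> S \<Longrightarrow> \<not> L ts \<Longrightarrow> s ts = 0"
    "\<And>ts g. set ts \<subseteq> S \<Longrightarrow> g \<in> \<Gamma> \<Longrightarrow> s (mact g ts) = push (mact g) (s ts)"
    "\<And>ts. set ts \<subseteq> S \<Longrightarrow> single ts 1 - lext bd (s ts) - lext s (bd ts) \<in> V"
proof -
  have \<Gamma>G: "\<Gamma> \<subseteq> carrier G" using \<Gamma> by (rule subgroup.subset)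
  \<comment> \<open>The last clause concerns genuine cycles. Applied to \<open>bd ts\<close>, it
    shows that the error \<open>e ts\<close> of the next stage is a cycle modulo
    \<open>V\<close>.\<close>
  define P where "P n f \<longleftrightarrow> (\<forall>ts. set ts \<subseteq> S \<longrightarrow> length ts = n \<longrightarrow>
      f ts \<in> chains (Y ts) (Suc n) \<and> (\<not> L ts \<longrightarrow> f ts = 0) \<and>
      (\<forall>g\<in>\<Gamma>. f (mact g ts) = push (mact g) (f ts))) \<and>
      (\<forall>c\<in>chains S n. lext bd c = (0 :: _ \<Rightarrow>\<^sub>0 rat) \<longrightarrow> c - lext bd (lext f c) \<in> V)" for n f
  define Q where "Q n f f' \<longleftrightarrow> (\<forall>ts. set ts \<subseteq> S \<longrightarrow> length ts = Suc n \<longrightarrow>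
      single ts 1 - lext bd (f' ts) - lext f (bd ts) \<in> V)" for n :: nat and f f'
  have "\<exists>F. \<forall>n. P n (F n) \<and> Q n (F n) (F (Suc n))"
  proof (rule dependent_nat_choice)
    \<comment> \<open>The empty list fails \<open>L\<close>, so all chains on it lie in
      \<open>V\<close> and zero is a contraction in length 0.\<close>
    have "c - lext bd (lext (\<lambda>_. 0) c) \<in> V" if c: "c \<in> chains S 0" for c
    proof -
      have "lext (\<lambda>a. single a 1) c \<in> V"
        using V chainsD(1)[OF c] by (rule submod_lext) (use deadV[of "[]"] L_Nil c in \<open>auto dest: chainsD\<close>)
      then show ?thesis by (simp add: lext_id lext_def[of "\<lambda>_. 0"])
    qed
    then show "\<exists>f. P 0 f"
      by (intro exI[of _ "\<lambda>_. 0"]) (auto simp: P_def submod_zero[OF submod_chains])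
  next
    fix f n assume "P n f"
    then have f: "\<And>ts. set ts \<subseteq> S \<Longrightarrow> length ts = n \<Longrightarrow> f ts \<in> chains (Y ts) (Suc n)"
        "\<And>ts. set ts \<subseteq> S \<Longrightarrow> length ts = n \<Longrightarrow> \<not> L ts \<Longrightarrow> f ts = 0"
        "\<And>ts g. set ts \<subseteq> S \<Longrightarrow> length ts = n \<Longrightarrow> g \<in> \<Gamma> \<Longrightarrow> f (mact g ts) = push (mact g) (f ts)"
      and f_cyc: "\<And>c. c \<in> chains S n \<Longrightarrow> lext bd c = 0 \<Longrightarrow> c - lext bd (lext f c) \<in> V"
      unfolding P_def by blast+
    define e where "e ts = single ts 1 - lext f (bd ts)" for ts
    have e: "e ts \<in> chains (Y ts) (Suc n)" if ts: "set ts \<subseteq> S" "length ts = Suc n" for ts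
      unfolding e_def
    proof (intro submod_diff[OF submod_chains] single_chains Zp_1 submod_lext[OF submod_chains integral_bd])
      fix \<sigma> assume \<sigma>: "\<sigma> \<in> keys (bd ts :: _ \<Rightarrow>\<^sub>0 rat)"
      show "f \<sigma> \<in> chains (Y ts) (Suc n)"
        using f(1)[of \<sigma>] keys_bd[OF \<sigma>] ts Y_face[OF ts(1), of \<sigma>] chains_mono by fastforce
    qed (use ts Y in auto)
    have bd_e: "lext bd (e ts) \<in> V" if ts: "set ts \<subseteq> S" "length ts = Suc n" for ts
    proof -
      have "bd ts - lext bd (lext f (bd ts)) \<in> V"
        by (rule f_cyc) (simp_all add: bd_bd_list bd_chains ts)
      then show ?thesis by (simp add: e_def lext_diff)
    qed
    have "\<exists>w. set ts \<subseteq> S \<longrightarrow> length ts = Suc n \<longrightarrow> L ts \<longrightarrow>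
      w \<in> chains (Y ts) (Suc (Suc n)) \<and> e ts - lext bd w \<in> V" for ts
      using exact[of ts "e ts"] e[of ts] bd_e[of ts] by (cases "set ts \<subseteq> S \<and> length ts = Suc n \<and> L ts") auto
    then obtain w where w: "\<And>ts. set ts \<subseteq> S \<Longrightarrow> length ts = Suc n \<Longrightarrow> L ts \<Longrightarrow> w ts \<in> chains (Y ts) (Suc (Suc n))"
      "\<And>ts. set ts \<subseteq> S \<Longrightarrow> length ts = Suc n \<Longrightarrow> L ts \<Longrightarrow> e ts - lext bd (w ts) \<in> V"
      by metis
    \<comment> \<open>\<open>rel \<Gamma> ts\<close> is the same predicate for all lists of an
      orbit, so the choice depends on the orbit only.\<close>
    define r where "r ts = (SOME x. rel \<Gamma> ts x)" for ts
    define \<gamma> where "\<gamma> ts = (SOME g. g \<in> \<Gamma> \<and> mact g (r ts) = ts)" for ts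
    have r_rel: "rel \<Gamma> ts (r ts)" for ts
      unfolding r_def by (rule someI[of _ ts]) (simp add: rel_def)
    have r_eq: "r (mact g ts) = r ts" if "set ts \<subseteq> S" "g \<in> \<Gamma>" for g ts
    proof -
      have "rel \<Gamma> ts (mact g ts)" using that \<Gamma>G ST by (intro relI) auto
      then have "rel \<Gamma> ts = rel \<Gamma> (mact g ts)" using equivp_rel[OF \<Gamma>] by (simp add: equivp_def)
      then show ?thesis by (simp add: r_def)
    qed
    have \<gamma>: "\<gamma> ts \<in> \<Gamma>" "mact (\<gamma> ts) (r ts) = ts" and rX: "set (r ts) \<subseteq> S"
      if ts: "set ts \<subseteq> S" for ts
    proof -
      have "rel \<Gamma> (r ts) ts" using r_rel equivp_rel[OF \<Gamma>] by (metis equivp_symp)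
      then have "\<exists>g. g \<in> \<Gamma> \<and> mact g (r ts) = ts"
        using subset_trans[OF ts ST] subgroup.one_closed[OF \<Gamma>] mact_one unfolding rel_def by metis
      from someI_ex[OF this] show "\<gamma> ts \<in> \<Gamma>" "mact (\<gamma> ts) (r ts) = ts" unfolding \<gamma>_def by auto
      obtain g where "r ts = ts \<or> g \<in> \<Gamma> \<and> r ts = mact g ts" using r_rel[of ts] unfolding rel_def by metis
      then show "set (r ts) \<subseteq> S" using ts S_act by (auto simp: subset_iff)
    qed
    have r_L: "L (r ts) \<longleftrightarrow> L ts" "length (r ts) = length ts" if ts: "set ts \<subseteq> S" for ts
      using L[OF rX[OF ts] \<gamma>(1)[OF ts]] \<gamma>(2)[OF ts] by (auto simp flip: length_map[of "act (\<gamma> ts)" "r ts"])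
    have \<gamma>_eq: "\<gamma> (mact g ts) = g \<otimes> \<gamma> ts" if ts: "set ts \<subseteq> S" "L ts" and g: "g \<in> \<Gamma>" for g ts
    proof (rule live_unique[OF \<Gamma>, of "r ts"])
      have gts: "set (mact g ts) \<subseteq> S" using ts g S_act by auto
      show "live \<Gamma> (r ts)" using L_live[OF rX[OF ts(1)]] r_L ts by simp
      show "set (r ts) \<subseteq> T" by (rule subset_trans[OF rX[OF ts(1)] ST])
      show "\<gamma> (mact g ts) \<in> \<Gamma>" by (rule \<gamma>(1)[OF gts])
      show "g \<otimes> \<gamma> ts \<in> \<Gamma>" using g \<gamma>(1)[OF ts(1)] \<Gamma> by (simp add: subgroup.m_closed)
      have "mact (g \<otimes> \<gamma> ts) (r ts) = mact g ts"
        using mact_mult[OF _ _ subset_trans[OF rX[OF ts(1)] ST], of g "\<gamma> ts"] \<gamma>[OF ts(1)] g \<Gamma>G by auto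
      then show "mact (\<gamma> (mact g ts)) (r ts) = mact (g \<otimes> \<gamma> ts) (r ts)"
        using \<gamma>(2)[OF gts] r_eq[OF ts(1) g] by simp
    qed
    define f' where "f' ts = (if L ts then push (mact (\<gamma> ts)) (w (r ts)) else 0)" for ts
    have f'_chain: "f' ts \<in> chains (Y ts) (Suc (Suc n))" if ts: "set ts \<subseteq> S" "length ts = Suc n" for ts
    proof (cases "L ts")
      case True
      have "push (mact (\<gamma> ts)) (w (r ts)) \<in> chains (Y ts) (Suc (Suc n))"
      proof (rule push_chains)
        show "w (r ts) \<in> chains (Y (r ts)) (Suc (Suc n))"
          using w(1) rX r_L ts True by auto
        fix a assume "length a = Suc (Suc n)" "set a \<subseteq> Y (r ts)"
        then show "length (mact (\<gamma> ts) a) = Suc (Suc n) \<and> set (mact (\<gamma> ts) a) \<subseteq> Y ts"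
          using Y_act[OF rX[OF ts(1)] \<gamma>(1)[OF ts(1)]] \<gamma>(2)[OF ts(1)] by auto
      qed
      then show ?thesis using True by (simp add: f'_def)
    qed (simp add: f'_def submod_zero[OF submod_chains])
    have f'_act: "f' (mact g ts) = push (mact g) (f' ts)"
      if ts: "set ts \<subseteq> S" "length ts = Suc n" and g: "g \<in> \<Gamma>" for ts g
    proof (cases "L ts")
      case True
      have "push (mact (g \<otimes> \<gamma> ts)) (w (r ts)) = push (mact g) (push (mact (\<gamma> ts)) (w (r ts)))"
      proof (rule push_mact_mult)
        fix a assume "a \<in> keys (w (r ts))"
        moreover have "w (r ts) \<in> chains (Y (r ts)) (Suc (Suc n))"
          using w(1) rX r_L ts True by auto
        ultimately show "set a \<subseteq> T" using Y[OF rX[OF ts(1)]] ST by (auto dest!: chainsD(3))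
      qed (use g \<gamma>(1)[OF ts(1)] \<Gamma>G in auto)
      then show ?thesis using True L[OF ts(1) g] r_eq[OF ts(1) g] \<gamma>_eq[OF ts(1) True g]
        by (simp add: f'_def)
    qed (use L[OF ts(1) g] in \<open>simp add: f'_def\<close>)
    have "Q n f f'"
      unfolding Q_def
    proof (intro allI impI)
      fix ts assume ts: "set ts \<subseteq> S" "length ts = Suc n"
      show "single ts 1 - lext bd (f' ts) - lext f (bd ts) \<in> V"
      proof (cases "L ts")
        case False
        have "lext f (bd ts) = 0"
          unfolding lext_def
        proof (intro sum.neutral ballI)
          fix \<sigma> assume \<sigma>: "\<sigma> \<in> keys (bd ts :: _ \<Rightarrow>\<^sub>0 rat)"
          have "f \<sigma> = 0" using keys_bd[OF \<sigma>] ts L_face[OF ts(1)] False by (intro f(2)) auto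
          then show "scl (lookup (bd ts) \<sigma>) (f \<sigma>) = 0" by simp
        qed
        then show ?thesis using False deadV[OF ts(1)] by (simp add: f'_def)
      next
        case True
        let ?r = "r ts" and ?g = "\<gamma> ts"
        have r: "set ?r \<subseteq> S" "length ?r = Suc n" "L ?r" using rX r_L ts True by auto
        have 1: "push (mact ?g) (e ?r - lext bd (w ?r)) \<in> V"
          using \<Gamma>V[OF \<gamma>(1)[OF ts(1)] w(2)[OF r]] .
        have 2: "push (mact ?g) (lext f (bd ?r)) = lext f (bd ts)"
        proof -
          have "push (mact ?g) (lext f (bd ?r)) = lext (\<lambda>\<sigma>. f (mact ?g \<sigma>)) (bd ?r)"
            unfolding push_lext
          proof (rule lext_cong)
            fix \<sigma> assume \<sigma>: "\<sigma> \<in> keys (bd ?r :: _ \<Rightarrow>\<^sub>0 rat)"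
            show "push (mact ?g) (f \<sigma>) = f (mact ?g \<sigma>)"
              using keys_bd[OF \<sigma>] r by (intro f(3)[symmetric] \<gamma>(1) ts(1)) auto
          qed
          also have "\<dots> = lext f (push (mact ?g) (bd ?r))" by (simp add: lext_push)
          also have "\<dots> = lext f (bd ts)" by (simp add: push_map_bd \<gamma>(2)[OF ts(1)])
          finally show ?thesis .
        qed
        have 3: "push (mact ?g) (e ?r - lext bd (w ?r))
            = single ts 1 - push (mact ?g) (lext f (bd ?r)) - lext bd (f' ts)"
          using True by (simp add: e_def f'_def push_diff push_map_lext_bd \<gamma>(2)[OF ts(1)])
        show ?thesis using 1 unfolding 2 3 cancel_ab_semigroup_add_class.diff_right_commute[of "single ts 1" "lext f (bd ts)"] .
      qed
    qed
    moreover have "P (Suc n) f'"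
      unfolding P_def
    proof (intro conjI allI impI ballI)
      fix c :: "'t list \<Rightarrow>\<^sub>0 rat" assume c: "c \<in> chains S (Suc n)" "lext bd c = (0 :: _ \<Rightarrow>\<^sub>0 rat)"
      have "lext (\<lambda>ts. single ts 1 - lext bd (f' ts) - lext f (bd ts)) c \<in> V"
        using V chainsD(1)[OF c(1)] by (rule submod_lext) (use \<open>Q n f f'\<close> c(1) in \<open>auto simp: Q_def chains_def\<close>)
      also have "lext (\<lambda>ts. single ts 1 - lext bd (f' ts) - lext f (bd ts)) c
          = c - lext bd (lext f' c) - lext f (lext bd c)"
        by (simp add: lext_diff_fun lext_id lext_lext)
      finally show "c - lext bd (lext f' c) \<in> V" using c(2) by simp
    next
      fix ts assume "set ts \<subseteq> S" "length ts = Suc n"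
      then show "f' ts \<in> chains (Y ts) (Suc (Suc n))" by (rule f'_chain)
    next
      fix ts g assume "set ts \<subseteq> S" "length ts = Suc n" "g \<in> \<Gamma>"
      then show "f' (mact g ts) = push (mact g) (f' ts)" by (rule f'_act)
    qed (simp add: f'_def)
    ultimately show "\<exists>f'. P (Suc n) f' \<and> Q n f f'" by blast
  qed
  then obtain F where F: "\<And>n. P n (F n)" "\<And>n. Q n (F n) (F (Suc n))" by blast
  define s where "s ts = F (length ts) ts" for ts
  have "single ts 1 - lext bd (s ts) - lext s (bd ts) \<in> V" if ts: "set ts \<subseteq> S" for ts
  proof (cases ts)
    case Nil
    have "s [] = 0" using F(1)[of 0] L_Nil by (auto simp: P_def s_def)
    then show ?thesis using deadV[OF ts] L_Nil Nil by simp
  next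
    case (Cons t ts')
    have "lext s (bd ts) = lext (F (length ts')) (bd ts :: _ \<Rightarrow>\<^sub>0 rat)"
      by (rule lext_cong) (use keys_bd Cons in \<open>fastforce simp: s_def\<close>)
    moreover have "s ts = F (Suc (length ts')) ts" using Cons by (simp add: s_def)
    moreover have "single ts 1 - lext bd (F (Suc (length ts')) ts) - lext (F (length ts')) (bd ts) \<in> V"
      using F(2)[of "length ts'"] ts Cons unfolding Q_def by (metis length_Cons)
    ultimately show ?thesis by (simp only:)
  qed
  then show ?thesis
    using F(1) by (intro that[of s]) (auto simp: P_def s_def)
qed

end

section \<open>Finite groups\<close>

context group
begin

lemma ord_consistent:
  assumes "subgroup P G"
  shows "group.ord (G\<lparr>carrier := P\<rparr>) x = ord x"
proof -
  interpret P: group "G\<lparr>carrier := P\<rparr>" using assms by (rule subgroup_imp_group)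
  show ?thesis by (simp add: P.ord_def ord_def nat_pow_consistent[symmetric])
qed

definition psub :: "nat \<Rightarrow> 'a set \<Rightarrow> bool" where
  "psub p P \<longleftrightarrow> subgroup P G \<and> (\<forall>x\<in>P. \<exists>n. ord x = p ^ n)"

lemma psub_iff: "psub p P \<longleftrightarrow> subgroup P G \<and> p_group p (G\<lparr>carrier := P\<rparr>)"
  unfolding psub_def p_group_def using ord_consistent subgroup_imp_group by auto

lemma ord_dvd_card:
  assumes "subgroup C G" "y \<in> C" "finite C"
  shows "ord y dvd card C"
proof -
  interpret C: group "G\<lparr>carrier := C\<rparr>" using assms(1) by (rule subgroup_imp_group)
  show ?thesis
    using C.ord_dvd_group_order[of y] assms ord_consistent[OF assms(1), of y] by (simp add: order_def)
qed

lemma cauchy: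
  assumes C: "subgroup C G" "finite C" and q: "Factorial_Ring.prime q" "q dvd card C"
  obtains y where "y \<in> C" "ord y = q"
proof -
  interpret C: group "G\<lparr>carrier := C\<rparr>" using C(1) by (rule subgroup_imp_group)
  obtain m where m: "order (G\<lparr>carrier := C\<rparr>) = q ^ 1 * m" using q(2) by (auto simp: order_def)
  then obtain Q where Q: "subgroup Q (G\<lparr>carrier := C\<rparr>)" "card Q = q"
    using sylow_thm[OF q(1) C.is_group m] C(2) by auto
  have QG: "subgroup Q G" using Q(1) C(1) by (rule incl_subgroup[rotated])
  have finQ: "finite Q" using Q(2) q(1) by (metis card.infinite not_prime_0)
  have "Q \<noteq> {\<one>}" using Q(2) q(1) by auto
  then obtain y where y: "y \<in> Q" "y \<noteq> \<one>" using subgroup.one_closed[OF QG] by blast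
  have yG: "y \<in> carrier G" using QG y(1) by (rule subgroup.mem_carrier)
  have "ord y dvd q" using ord_dvd_card[OF QG y(1) finQ] Q(2) by simp
  moreover have "ord y \<noteq> 1" using y(2) ord_eq_1[OF yG] by auto
  ultimately have "ord y = q" using q(1) by (metis prime_nat_iff)
  moreover have "y \<in> C" using y(1) subgroup.subset[OF Q(1)] by auto
  ultimately show ?thesis using that by blast
qed

text \<open>By Cauchy's theorem a prime factor of the part of the order prime to \<open>p\<close>
  would be the order of an element.\<close>

lemma card_psub:
  assumes p: "Factorial_Ring.prime p" and P: "psub p P" "finite P"
  obtains k where "card P = p ^ k"
proof -
  have PG: "subgroup P G" using P(1) by (simp add: psub_def)
  have pos: "card P \<noteq> 0" using P(2) subgroup.one_closed[OF PG] by auto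
  obtain m where m: "card P = p ^ multiplicity p (card P) * m" "\<not> p dvd m"
    using multiplicity_decompose'[of "card P" p] pos p by (metis not_prime_unit)
  have "m = 1"
  proof (rule ccontr)
    assume "m \<noteq> 1"
    then obtain q where q: "Factorial_Ring.prime q" "q dvd m" using prime_factor_nat by blast
    then have "q dvd card P" using m(1) by (metis dvd_mult)
    then obtain y where y: "y \<in> P" "ord y = q" using cauchy[OF PG P(2) q(1)] by blast
    then obtain n where n: "q = p ^ n" using P(1) by (auto simp: psub_def)
    then have "n \<noteq> 0" using q(1) by (cases n) auto
    then have "p dvd q" using n by simp
    then have "q = p" using primes_dvd_imp_eq[OF p q(1)] by simp
    then show False using q(2) m(2) by simp
  qed
  then show ?thesis using that m(1) by simp
qed

lemma prime_order_power:
  assumes p: "Factorial_Ring.prime p" and y: "y \<in> carrier G" "y \<noteq> \<one>" "ord y = p ^ n"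
  obtains j :: nat where "y [^] j \<noteq> \<one>" "(y [^] j) [^] p = \<one>"
proof -
  obtain m where n: "n = Suc m" using y using ord_eq_1[OF y(1)] by (cases n) auto
  have "\<not> p ^ Suc m dvd p ^ m" 
    using power_dvd_imp_le[of p "Suc m" m] prime_gt_1_nat[OF p] by auto
  then have "y [^] (p ^ m) \<noteq> \<one>" using y(1,3) n by (simp add: pow_eq_id)
  moreover have "(y [^] (p ^ m)) [^] p = \<one>"
    using y(1,3) n by (simp add: nat_pow_pow pow_eq_id mult.commute)
  ultimately show ?thesis using that by blast
qed

lemma set_action_conj: "set_action G (carrier G) (\<lambda>g h. g \<otimes> h \<otimes> inv g)"
  by unfold_locales (auto simp: m_assoc inv_mult_group)

end

section \<open>Counting orbits and fixed points of finite groups\<close>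

context set_action
begin

lemma group_action_on:
  assumes C: "subgroup C G" and Y: "Y \<subseteq> T" "\<And>g t. g \<in> C \<Longrightarrow> t \<in> Y \<Longrightarrow> act g t \<in> Y"
  shows "group_action (G\<lparr>carrier := C\<rparr>) Y (\<lambda>g. restrict (act g) Y)"
proof -
  interpret C: group "G\<lparr>carrier := C\<rparr>" using C by (rule subgroup_imp_group)
  have CG: "g \<in> carrier G" if "g \<in> C" for g using C that by (rule subgroup.mem_carrier)
  have bij: "restrict (act g) Y \<in> Bij Y" if g: "g \<in> C" for g
    unfolding Bij_def
  proof (intro IntI CollectI)
    have "bij_betw (act g) Y Y"
      by (rule bij_betwI[where g = "act (inv g)"])
        (use g Y act_inv[OF CG[OF g]] act_inv'[OF CG[OF g]] subgroup.m_inv_closed[OF C g] in auto)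
    then show "bij_betw (restrict (act g) Y) Y Y" by (simp cong: bij_betw_cong)
  qed simp
  show ?thesis
  proof (intro group_action.intro group_hom.intro group_hom_axioms.intro)
    show "group (G\<lparr>carrier := C\<rparr>)" ..
    show "group (BijGroup Y)" by (rule group_BijGroup)
    show "(\<lambda>g. restrict (act g) Y) \<in> hom (G\<lparr>carrier := C\<rparr>) (BijGroup Y)"
    proof (rule homI)
      fix g h assume gh: "g \<in> carrier (G\<lparr>carrier := C\<rparr>)" "h \<in> carrier (G\<lparr>carrier := C\<rparr>)"
      have "restrict (act (g \<otimes> h)) Y = compose Y (restrict (act g) Y) (restrict (act h) Y)"
        unfolding compose_def using gh Y CG act_mult by (intro restrict_ext) (auto simp: subset_iff)
      then show "restrict (act (g \<otimes>\<^bsub>G\<lparr>carrier := C\<rparr>\<^esub> h)) Y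
          = restrict (act g) Y \<otimes>\<^bsub>BijGroup Y\<^esub> restrict (act h) Y"
        using gh bij by (simp add: BijGroup_def)
    qed (use bij in \<open>simp add: BijGroup_def\<close>)
  qed
qed

lemma card_orbit:
  assumes C: "subgroup C G" and t: "t \<in> T"
  shows "card ((\<lambda>g. act g t) ` C) * card {g \<in> C. act g t = t} = card C"
proof -
  have CG: "g \<in> carrier G" if "g \<in> C" for g using C that by (rule subgroup.mem_carrier)
  interpret A: group_action "G\<lparr>carrier := C\<rparr>" T "\<lambda>g. restrict (act g) T"
    using C by (rule group_action_on) (use act_closed CG in auto)
  show ?thesis
    using A.orbit_stabilizer_theorem[OF t] t
    by (simp add: orbit_def stabilizer_def order_def Setcompr_eq_image)
qed

text \<open>The points that are not fixed fall into orbits whose lengths are powers of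
  \<open>p\<close> different from 1.\<close>

lemma dvd_card_fixed_points:
  assumes p: "Factorial_Ring.prime p" and P: "subgroup P G" "card P = p ^ k"
    and Y: "finite Y" "Y \<subseteq> T" "\<And>g t. g \<in> P \<Longrightarrow> t \<in> Y \<Longrightarrow> act g t \<in> Y" "p dvd card Y"
  shows "p dvd card {t \<in> Y. \<forall>g\<in>P. act g t = t}"
proof -
  let ?F = "{t \<in> Y. \<forall>g\<in>P. act g t = t}"
  let ?N = "Y - ?F"
  have PG: "g \<in> carrier G" if "g \<in> P" for g using P(1) that by (rule subgroup.mem_carrier)
  have N: "act g t \<in> ?N" if g: "g \<in> P" and t: "t \<in> ?N" for g t
  proof (rule ccontr)
    assume "\<not> ?thesis"
    then have *: "act h (act g t) = act g t" if "h \<in> P" for h using g t Y(3) that by auto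
    have "act g t = t" using *[of "inv g"] g t Y(2) PG act_inv subgroup.m_inv_closed[OF P(1)] by auto
    then show False using * t by auto
  qed
  interpret A: group_action "G\<lparr>carrier := P\<rparr>" ?N "\<lambda>g. restrict (act g) ?N"
    using P(1) _ N by (rule group_action_on) (use Y(2) in auto)
  have "p dvd card B" if "B \<in> orbits (G\<lparr>carrier := P\<rparr>) ?N (\<lambda>g. restrict (act g) ?N)" for B
  proof -
    obtain t where t: "t \<in> ?N" "B = orbit (G\<lparr>carrier := P\<rparr>) (\<lambda>g. restrict (act g) ?N) t"
      using \<open>B \<in> _\<close> by (auto simp: orbits_def)
    then have B: "B = (\<lambda>g. act g t) ` P" by (simp add: orbit_def Setcompr_eq_image)
    obtain g where g: "g \<in> P" "act g t \<noteq> t" using t by auto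
    have tB: "t \<in> B" using B t act_one Y(2) subgroup.one_closed[OF P(1)] by force
    have "t \<in> T" using t(1) Y(2) by blast
    then have "card B dvd p ^ k"
      using card_orbit[OF P(1)] unfolding B P(2)[symmetric] by (metis dvd_triv_left)
    then obtain i where i: "card B = p ^ i" using divides_primepow_nat[OF p] by blast
    have "i \<noteq> 0"
    proof
      assume "i = 0"
      then have "card B = 1" using i by simp
      then obtain b where "B = {b}" by (auto simp: card_1_singleton_iff)
      then show False using tB g B by auto
    qed
    then show ?thesis using i by simp
  qed
  then have "p dvd (\<Sum>B\<in>orbits (G\<lparr>carrier := P\<rparr>) ?N (\<lambda>g. restrict (act g) ?N). card B)"
    by (rule dvd_sum)
  also have "\<dots> = (\<Sum>t\<in>?N. 1)"
    using A.disjoint_sum[of "\<lambda>_. 1::nat"] Y(1) by simp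
  also have "\<dots> = card Y - card ?F" using Y(1) by (simp add: card_Diff_subset)
  finally show ?thesis using Y(4) Y(1) card_mono[of Y ?F] by (auto dest: dvd_diffD1)
qed

end

text \<open>Isotropy groups that are \<open>p\<close>-groups serve twice: a nontrivial one contains
  an element of order \<open>p\<close>, as \<open>finite_group_exact\<close> requires, and those of
  nonempty lists are objects of the orbit category.\<close>

locale p_isotropy = p_action p G T act
  for p :: nat and G :: "('a, 'b) monoid_scheme" (structure) and T :: "'t set" and act :: "'a \<Rightarrow> 't \<Rightarrow> 't" +
  assumes isotropy: "\<lbrakk>t \<in> T; g \<in> carrier G; act g t = t\<rbrakk> \<Longrightarrow> \<exists>n. ord g = p ^ n"
begin

definition stab :: "'a set \<Rightarrow> 't list \<Rightarrow> 'a set" where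
  "stab K a = {g \<in> K. \<forall>t\<in>set a. act g t = t}"

lemma live_iff_stab: "subgroup K G \<Longrightarrow> live K a \<longleftrightarrow> stab K a \<subseteq> {\<one>}"
  by (auto simp: live_def stab_def)

lemma subgroup_stab:
  assumes K: "subgroup K G" and a: "set a \<subseteq> T"
  shows "subgroup (stab K a) G"
proof (rule subgroupI)
  have KG: "g \<in> carrier G" if "g \<in> K" for g using K that by (rule subgroup.mem_carrier)
  show "stab K a \<subseteq> carrier G" using KG by (auto simp: stab_def)
  have "\<one> \<in> stab K a" using subgroup.one_closed[OF K] a act_one by (auto simp: stab_def)
  then show "stab K a \<noteq> {}" by blast
  fix g assume g: "g \<in> stab K a"
  have "act (inv g) t = t" if "t \<in> set a" for t
    using g that a KG act_inv[of g t] by (auto simp: stab_def subset_iff)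
  then show "inv g \<in> stab K a"
    using g subgroup.m_inv_closed[OF K] by (simp add: stab_def)
  fix h assume h: "h \<in> stab K a"
  then show "g \<otimes> h \<in> stab K a"
    using g a KG subgroup.m_closed[OF K] by (auto simp: stab_def act_mult subset_iff)
qed

lemma psub_stab:
  assumes K: "subgroup K G" and a: "set a \<subseteq> T" "a \<noteq> []"
  shows "psub p (stab K a)"
  unfolding psub_def
proof (intro conjI ballI subgroup_stab assms)
  fix g assume g: "g \<in> stab K a"
  then have "g \<in> carrier G" using K by (auto simp: stab_def dest: subgroup.mem_carrier)
  then show "\<exists>n. ord g = p ^ n"
    using isotropy[of "hd a" g] g a by (auto simp: stab_def subset_iff)
qed

text \<open>The case of a single group. A Sylow subgroup fixes a point \<open>u\<close>; the
  stabilizer of \<open>u\<close> is a \<open>p\<close>-group containing it, so its order is the full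
  \<open>p\<close>-part of the order of \<open>C\<close> and the orbit \<open>U\<close> of
  \<open>u\<close> has length prime to \<open>p\<close>.\<close>

lemma sylow_exact:
  assumes C: "subgroup C G" "finite C" "p dvd card C"
    and Y: "finite Y" "Y \<subseteq> T" "\<And>g t. g \<in> C \<Longrightarrow> t \<in> Y \<Longrightarrow> act g t \<in> Y"
    and fixp: "\<And>S. psub p S \<Longrightarrow> S \<subseteq> C \<Longrightarrow> \<exists>t\<in>Y. \<forall>g\<in>S. act g t = t"
    and c: "c \<in> chains Y n" "lext bd c \<in> null Y C C"
  shows "\<exists>w\<in>chains Y (Suc n). c - lext bd w \<in> null Y C C"
proof -
  have CG: "g \<in> carrier G" if "g \<in> C" for g using C(1) that by (rule subgroup.mem_carrier)
  interpret C: group "G\<lparr>carrier := C\<rparr>" using C(1) by (rule subgroup_imp_group)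
  have pos: "card C \<noteq> 0" using C(2) subgroup.one_closed[OF C(1)] by auto
  obtain m where m: "card C = p ^ multiplicity p (card C) * m" "\<not> p dvd m"
    using multiplicity_decompose'[of "card C" p] pos p by (metis not_prime_unit)
  define a where "a = multiplicity p (card C)"
  have "order (G\<lparr>carrier := C\<rparr>) = p ^ a * m" using m(1) by (simp add: order_def a_def)
  then obtain S where S: "subgroup S (G\<lparr>carrier := C\<rparr>)" "card S = p ^ a"
    using sylow_thm[OF p C.is_group] C(2) by auto
  have SG: "subgroup S G" using S(1) C(1) by (rule incl_subgroup[rotated])
  have SC: "S \<subseteq> C" using subgroup.subset[OF S(1)] by simp
  have finS: "finite S" using SC C(2) by (rule finite_subset)
  have "psub p S"
    unfolding psub_def
  proof (intro conjI ballI SG)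
    fix x assume "x \<in> S"
    then have "ord x dvd p ^ a" using ord_dvd_card[OF SG _ finS] S(2) by metis
    then show "\<exists>n. ord x = p ^ n" using divides_primepow_nat[OF p] by blast
  qed
  then obtain u where u: "u \<in> Y" "\<forall>g\<in>S. act g u = u" using fixp SC by blast
  define U where "U = (\<lambda>g. act g u) ` C"
  have uT: "set [u] \<subseteq> T" using u Y(2) by auto
  obtain k where k: "card (stab C [u]) = p ^ k"
  proof (rule card_psub[OF p])
    show "psub p (stab C [u])" using C(1) uT by (rule psub_stab) simp
    show "finite (stab C [u])" using C(2) by (simp add: stab_def)
  qed
  have "S \<subseteq> stab C [u]" using u(2) SC by (auto simp: stab_def)
  then have "p ^ a \<le> p ^ k" using card_mono[of "stab C [u]" S] S(2) k C(2) by (simp add: stab_def)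
  then have ak: "a \<le> k" using prime_gt_1_nat[OF p] power_increasing_iff by blast
  have U_card: "card U * p ^ k = p ^ a * m"
    using card_orbit[OF C(1), of u] u(1) Y(2) k m(1) by (auto simp: U_def stab_def a_def)
  have "\<not> p dvd card U"
  proof
    assume "p dvd card U"
    then have "p * p ^ a dvd card U * p ^ k" using ak by (intro mult_dvd_mono le_imp_power_dvd)
    then have "p * p ^ a dvd m * p ^ a" unfolding U_card by (simp add: mult.commute)
    then show False using m(2) p by (auto simp: prime_gt_0_nat)
  qed
  moreover have "act g t \<in> U" if g: "g \<in> C" and t: "t \<in> U" for g t
  proof -
    obtain h where h: "h \<in> C" "t = act h u" using t by (auto simp: U_def)
    then have "act g t = act (g \<otimes> h) u" using g CG u(1) Y(2) by (auto simp: act_mult)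
    then show ?thesis using subgroup.m_closed[OF C(1) g h(1)] by (simp add: U_def)
  qed
  moreover have "U \<subseteq> Y" using u(1) Y(3) by (auto simp: U_def)
  moreover have "\<exists>y\<in>C. y \<noteq> \<one> \<and> y [^] p = \<one> \<and> (\<forall>t\<in>set b. act y t = t)"
    if b: "set b \<subseteq> Y" "\<not> live C b" for b
  proof (cases "b = []")
    case True
    \<comment> \<open>The stabilizer of the empty list is \<open>C\<close>, which need not be a
      \<open>p\<close>-group; here the element of order \<open>p\<close> comes from the divisibility
      of \<open>card C\<close>.\<close>
    obtain y where y: "y \<in> C" "ord y = p" using cauchy[OF C(1,2) p C(3)] by blast
    have "y \<noteq> \<one>" using y p ord_eq_1[of \<one>] by auto
    moreover have "y [^] p = \<one>" using pow_ord_eq_1[OF CG[OF y(1)]] y(2) by simp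
    ultimately show ?thesis using y(1) True by auto
  next
    case False
    have bT: "set b \<subseteq> T" using b(1) Y(2) by blast
    have st: "subgroup (stab C b) G" using C(1) bT by (rule subgroup_stab)
    obtain g where g: "g \<in> stab C b" "g \<noteq> \<one>" using b(2) by (auto simp: live_def stab_def)
    have gG: "g \<in> carrier G" using st g(1) by (rule subgroup.mem_carrier)
    obtain n where "ord g = p ^ n"
      using psub_stab[OF C(1) bT False] g(1) by (auto simp: psub_def)
    then obtain j :: nat where j: "g [^] j \<noteq> \<one>" "(g [^] j) [^] p = \<one>"
      using prime_order_power[OF p gG g(2)] by blast
    have "g [^] j \<in> stab C b"
      using st g(1) by (induction j) (auto simp: subgroup.one_closed subgroup.m_closed)
    then show ?thesis using j by (auto simp: stab_def)
  qed
  ultimately show ?thesis using C(1) Y c by (intro finite_group_exact[of C Y U])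
qed

text \<open>Commuting elements of orders \<open>p^i\<close> and \<open>p^j\<close> have a product of
  order dividing \<open>p^(i+j)\<close>. The group \<open>P <#> S\<close> is used to find a point
  fixed by \<open>P\<close> and by a subgroup \<open>S\<close> of its centralizer.\<close>

lemma psub_mult_centralizing:
  assumes P: "psub p P" and S: "psub p S" and comm: "\<And>g h. g \<in> P \<Longrightarrow> h \<in> S \<Longrightarrow> g \<otimes> h = h \<otimes> g"
  shows "psub p (P <#> S)"
proof -
  have PG: "subgroup P G" and SG: "subgroup S G" using P S by (auto simp: psub_def)
  have carr: "g \<in> carrier G" "h \<in> carrier G" if "g \<in> P" "h \<in> S" for g h
    using PG SG that by (auto dest: subgroup.mem_carrier)
  have set_multI: "g \<otimes> h \<in> P <#> S" if "g \<in> P" "h \<in> S" for g h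
    using that by (auto simp: set_mult_def)
  have "subgroup (P <#> S) G"
  proof (rule subgroupI)
    show "P <#> S \<subseteq> carrier G" using carr by (auto simp: set_mult_def)
    have "\<one> \<otimes> \<one> \<in> P <#> S"
      by (intro set_multI subgroup.one_closed PG SG)
    then show "P <#> S \<noteq> {}" by blast
    fix x assume "x \<in> P <#> S"
    then obtain g h where gh: "g \<in> P" "h \<in> S" "x = g \<otimes> h" by (auto simp: set_mult_def)
    have inv: "inv g \<in> P" "inv h \<in> S"
      using gh subgroup.m_inv_closed[OF PG] subgroup.m_inv_closed[OF SG] by auto
    have "inv x = inv h \<otimes> inv g" using gh carr by (simp add: inv_mult_group)
    also have "\<dots> = inv g \<otimes> inv h" by (rule comm[OF inv, symmetric])
    finally show "inv x \<in> P <#> S" using set_multI[OF inv] by simp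
    fix y assume "y \<in> P <#> S"
    then obtain g' h' where gh': "g' \<in> P" "h' \<in> S" "y = g' \<otimes> h'" by (auto simp: set_mult_def)
    have c: "g \<in> carrier G" "h \<in> carrier G" "g' \<in> carrier G" "h' \<in> carrier G"
      using carr gh gh' by auto
    have "x \<otimes> y = g \<otimes> (h \<otimes> g') \<otimes> h'" using gh gh' c by (simp add: m_assoc)
    also have "h \<otimes> g' = g' \<otimes> h" by (rule comm[OF gh'(1) gh(2), symmetric])
    also have "g \<otimes> (g' \<otimes> h) \<otimes> h' = (g \<otimes> g') \<otimes> (h \<otimes> h')" using c by (simp add: m_assoc)
    also have "\<dots> \<in> P <#> S"
      using gh gh' by (intro set_multI subgroup.m_closed[OF PG] subgroup.m_closed[OF SG])
    finally show "x \<otimes> y \<in> P <#> S" .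
  qed
  moreover have "\<exists>n. ord x = p ^ n" if x: "x \<in> P <#> S" for x
  proof -
    obtain g h where gh: "g \<in> P" "h \<in> S" "x = g \<otimes> h" using x by (auto simp: set_mult_def)
    obtain i j where ij: "ord g = p ^ i" "ord h = p ^ j" using P S gh unfolding psub_def by blast
    have "x [^] (p ^ (i + j)) = g [^] (p ^ (i + j)) \<otimes> h [^] (p ^ (i + j))"
      unfolding gh(3) by (rule pow_mult_distrib[OF comm[OF gh(1,2)] carr[OF gh(1,2)]])
    moreover have "g [^] (p ^ (i + j)) = \<one>" "h [^] (p ^ (i + j)) = \<one>"
      unfolding pow_eq_id[OF carr(1)[OF gh(1,2)]] pow_eq_id[OF carr(2)[OF gh(1,2)]] ij
      by (simp_all add: le_imp_power_dvd)
    ultimately have "x [^] (p ^ (i + j)) = \<one>" by simp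
    moreover have "x \<in> carrier G" using gh carr by simp
    ultimately have "ord x dvd p ^ (i + j)" by (simp add: pow_eq_id)
    then show ?thesis using divides_primepow_nat[OF p] by blast
  qed
  ultimately show ?thesis by (simp add: psub_def)
qed

text \<open>Let \<open>P \<le> K\<close> be the isotropy group of a list \<open>a\<close> on which \<open>J\<close> acts freely. The lists fixed by
  \<open>P\<close>, modulo those with a nontrivial stabilizer in \<open>J\<close> and modulo \<open>J\<close>, form a complex for the
  centralizer \<open>C\<close> of \<open>P\<close> in \<open>J\<close>; since \<open>P\<close> is a \<open>p\<close>-group, \<open>p\<close> divides the order of \<open>C\<close>.\<close>

lemma finite_fixed_points_exact:
  assumes K: "subgroup K G" "finite K" and J: "subgroup J G" "J \<subseteq> K" "p dvd card J"
    and norm: "\<And>g h. g \<in> K \<Longrightarrow> h \<in> J \<Longrightarrow> g \<otimes> h \<otimes> inv g \<in> J"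
    and Y: "finite Y" "Y \<subseteq> T" "\<And>g t. g \<in> K \<Longrightarrow> t \<in> Y \<Longrightarrow> act g t \<in> Y"
    and fixp: "\<And>S. psub p S \<Longrightarrow> S \<subseteq> K \<Longrightarrow> \<exists>t\<in>Y. \<forall>g\<in>S. act g t = t"
    and P: "psub p P" "P \<subseteq> K"
    and F: "F = {t \<in> Y. \<forall>g\<in>P. act g t = t}"
    and c: "c \<in> chains F n" "lext bd c \<in> null Y J J"
  shows "\<exists>w\<in>chains F (Suc n). c - lext bd w \<in> null Y J J"
proof -
  have KG: "g \<in> carrier G" if "g \<in> K" for g using K(1) that by (rule subgroup.mem_carrier)
  have JG: "g \<in> carrier G" if "g \<in> J" for g using J(1) that by (rule subgroup.mem_carrier)
  have PG: "subgroup P G" "\<And>g. g \<in> P \<Longrightarrow> g \<in> carrier G" using P KG by (auto simp: psub_def)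
  have finJ: "finite J" using J(2) K(2) by (rule finite_subset)
  have FY: "F \<subseteq> Y" and FT: "F \<subseteq> T" using F Y by auto
  obtain k where k: "card P = p ^ k" using card_psub[OF p P(1)] P(2) K(2) finite_subset by blast
  interpret conj: set_action G "carrier G" "\<lambda>g h. g \<otimes> h \<otimes> inv g" by (rule set_action_conj)
  have conj_iff: "g \<otimes> h \<otimes> inv g = h \<longleftrightarrow> g \<otimes> h = h \<otimes> g" if "g \<in> carrier G" "h \<in> carrier G" for g h
  proof
    assume "g \<otimes> h \<otimes> inv g = h"
    then have "h \<otimes> g = g \<otimes> h \<otimes> inv g \<otimes> g" by simp
    then show "g \<otimes> h = h \<otimes> g" using that by (simp add: m_assoc)
  qed (use that in \<open>simp add: m_assoc\<close>)
  define C where "C = {h \<in> J. \<forall>g\<in>P. g \<otimes> h = h \<otimes> g}"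
  have CJ: "C \<subseteq> J" by (auto simp: C_def)
  \<comment> \<open>\<open>Q \<inter> C\<close> is the set of fixed points of \<open>P\<close>
    acting on \<open>Q\<close> by conjugation. It will be used for \<open>J\<close> and for
    stabilizers in \<open>J\<close> of lists fixed by \<open>P\<close>.\<close>
  have dvd_C: "p dvd card (Q \<inter> C)"
    if Q: "Q \<subseteq> J" "p dvd card Q" "\<And>g h. g \<in> P \<Longrightarrow> h \<in> Q \<Longrightarrow> g \<otimes> h \<otimes> inv g \<in> Q" for Q
  proof -
    have "p dvd card {h \<in> Q. \<forall>g\<in>P. g \<otimes> h \<otimes> inv g = h}"
      using p PG(1) k by (rule conj.dvd_card_fixed_points) (use Q finJ JG finite_subset in auto)
    also have "{h \<in> Q. \<forall>g\<in>P. g \<otimes> h \<otimes> inv g = h} = Q \<inter> C"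
      using Q(1) conj_iff PG(2) JG unfolding C_def by blast
    finally show ?thesis .
  qed
  have C: "subgroup C G"
  proof (rule subgroupI)
    show "C \<subseteq> carrier G" using CJ JG by blast
    have "\<one> \<in> C" using subgroup.one_closed[OF J(1)] PG(2) by (simp add: C_def)
    then show "C \<noteq> {}" by blast
    fix h assume h: "h \<in> C"
    have "g \<otimes> inv h = inv h \<otimes> g" if g: "g \<in> P" for g
    proof -
      have "g \<otimes> h = h \<otimes> g" and carr: "g \<in> carrier G" "h \<in> carrier G" using h g PG(2) JG by (auto simp: C_def)
      then have "inv h \<otimes> (g \<otimes> h) \<otimes> inv h = inv h \<otimes> (h \<otimes> g) \<otimes> inv h" by simp
      moreover have "inv h \<otimes> (g \<otimes> h) \<otimes> inv h = inv h \<otimes> g" using carr by (simp add: m_assoc)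
      moreover have "inv h \<otimes> (h \<otimes> g) \<otimes> inv h = g \<otimes> inv h" using carr by (simp add: m_assoc[symmetric])
      ultimately show ?thesis by simp
    qed
    then show "inv h \<in> C" using h subgroup.m_inv_closed[OF J(1)] by (simp add: C_def)
    fix h' assume h': "h' \<in> C"
    have "g \<otimes> (h \<otimes> h') = h \<otimes> h' \<otimes> g" if g: "g \<in> P" for g
    proof -
      have "g \<otimes> h = h \<otimes> g" "g \<otimes> h' = h' \<otimes> g" and carr: "g \<in> carrier G" "h \<in> carrier G" "h' \<in> carrier G"
        using h h' g PG(2) JG by (auto simp: C_def)
      then show ?thesis by (metis m_assoc)
    qed
    then show "h \<otimes> h' \<in> C" using h h' subgroup.m_closed[OF J(1)] by (simp add: C_def)
  qed
  have finC: "finite C" using CJ finJ by (rule finite_subset)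
  have pC: "p dvd card C" using dvd_C[of J] J(3) norm P(2) CJ by (auto simp: Int_absorb1)
  have F_act: "act h t \<in> F" if h: "h \<in> C" and t: "t \<in> F" for h t
  proof -
    have tT: "t \<in> T" using t FT by blast
    have "act g (act h t) = act h t" if g: "g \<in> P" for g
    proof -
      have "g \<otimes> h = h \<otimes> g" and carr: "g \<in> carrier G" "h \<in> carrier G" using h g PG(2) JG by (auto simp: C_def)
      then have "act g (act h t) = act h (act g t)" using tT by (simp flip: act_mult)
      then show ?thesis using t g F by simp
    qed
    moreover have "act h t \<in> Y" using h t J(2) CJ Y(3) F by blast
    ultimately show ?thesis by (simp add: F)
  qed
  \<comment> \<open>A point fixed by the \<open>p\<close>-group \<open>P <#> S\<close> lies in
    \<open>F\<close> and is fixed by \<open>S\<close>.\<close>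
  have F_fix: "\<exists>t\<in>F. \<forall>g\<in>S. act g t = t" if S: "psub p S" "S \<subseteq> C" for S
  proof -
    have comm: "g \<otimes> h = h \<otimes> g" if "g \<in> P" "h \<in> S" for g h using that S(2) by (auto simp: C_def)
    have "psub p (P <#> S)" using P(1) S(1) comm by (rule psub_mult_centralizing)
    moreover have "P <#> S \<subseteq> K"
      using P(2) S(2) CJ J(2) subgroup.m_closed[OF K(1)] by (auto simp: set_mult_def subset_iff)
    ultimately obtain t where t: "t \<in> Y" "\<forall>g\<in>P <#> S. act g t = t" using fixp by blast
    have oneP: "\<one> \<in> P" and oneS: "\<one> \<in> S" using PG(1) S(1) by (auto simp: psub_def subgroup.one_closed)
    have SG: "g \<in> carrier G" if "g \<in> S" for g using that S(2) CJ JG by blast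
    have PS: "g \<otimes> h \<in> P <#> S" if "g \<in> P" "h \<in> S" for g h
      using that by (auto simp: set_mult_def)
    have "g \<in> P <#> S" if "g \<in> P" for g
      using PS[OF that oneS] PG(2)[OF that] by simp
    moreover have "g \<in> P <#> S" if "g \<in> S" for g
      using PS[OF oneP that] SG[OF that] by simp
    ultimately show ?thesis using t by (auto simp: F)
  qed
  \<comment> \<open>If \<open>b\<close> were dead for \<open>J\<close>, its stabilizer in
    \<open>J\<close>, being \<open>J\<close> itself or a nontrivial \<open>p\<close>-group, would
    have order divisible by \<open>p\<close>. As \<open>P\<close> fixes \<open>b\<close>, it
    normalizes that stabilizer, which then meets \<open>C\<close> nontrivially by
    \<open>dvd_C\<close>.\<close>
  have live_C: "live J b" if b: "set b \<subseteq> F" "live C b" for b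
  proof (rule ccontr)
    assume nl: "\<not> live J b"
    have bT: "set b \<subseteq> T" using b(1) FT by blast
    have "p dvd card (stab J b)"
    proof (cases "b = []")
      case True
      then show ?thesis using J(3) by (simp add: stab_def)
    next
      case False
      have fin: "finite (stab J b)" using finJ by (simp add: stab_def)
      obtain i where i: "card (stab J b) = p ^ i"
        using card_psub[OF p psub_stab[OF J(1) bT False] fin] by blast
      have "i \<noteq> 0"
      proof
        assume "i = 0"
        then obtain y where "stab J b = {y}" using i by (auto simp: card_1_singleton_iff)
        then have "stab J b = {\<one>}" using subgroup.one_closed[OF subgroup_stab[OF J(1) bT]] by auto
        then show False using nl live_iff_stab[OF J(1)] by blast
      qed
      then show ?thesis using i by simp
    qed
    moreover have "g \<otimes> h \<otimes> inv g \<in> stab J b" if g: "g \<in> P" and h: "h \<in> stab J b" for g h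
    proof -
      have hJ: "h \<in> J" "\<forall>t\<in>set b. act h t = t" using h by (auto simp: stab_def)
      have "act (g \<otimes> h \<otimes> inv g) t = t" if t: "t \<in> set b" for t
      proof -
        have "act g t = t" "t \<in> T" using b(1) t g F FT by auto
        then show ?thesis using conj_fixes[of g h t] hJ t PG(2)[OF g] JG by auto
      qed
      then show ?thesis using norm g P(2) hJ by (auto simp: stab_def)
    qed
    ultimately have "p dvd card (stab J b \<inter> C)" by (intro dvd_C) (auto simp: stab_def)
    moreover have "stab J b \<inter> C \<subseteq> {\<one>}" using b(2) CJ by (auto simp: live_def stab_def)
    moreover have "\<one> \<in> stab J b \<inter> C"
      using subgroup.one_closed[OF subgroup_stab[OF J(1) bT]] subgroup.one_closed[OF C] by blast
    ultimately have "p dvd card {\<one>}" by (metis insert_absorb subset_singleton_iff empty_iff)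
    then show False using p by auto
  qed
  have "lext bd c \<in> null F C C"
  proof (cases n)
    case 0
    have "lext bd c = (0 :: _ \<Rightarrow>\<^sub>0 rat)"
      unfolding lext_def using c(1) 0 by (intro sum.neutral) (auto dest: chainsD)
    then show ?thesis by (simp add: nul_zero)
  next
    case (Suc m)
    have bc: "lext bd c \<in> chains F m" using c(1) Suc lext_bd_chains by blast
    show ?thesis
    proof (rule nul_transfer[OF c(2) chainsD(1)[OF bc] _ FY equivp_rel[OF J(1)] _ equivp_rel[OF C]])
      show "keys (lext bd c :: _ \<Rightarrow>\<^sub>0 rat) \<subseteq> {a. set a \<subseteq> F}" using bc by (auto simp: chains_def)
      show "live J a \<longleftrightarrow> live J b" if "rel J a b" for a b using live_rel[OF J(1) _ that] by simp
      show "live C a \<longleftrightarrow> live C b" if "rel C a b" for a b using live_rel[OF C _ that] by simp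
      show "live J a" if "set a \<subseteq> F" "live C a" for a using live_C that by blast
      fix a b assume ab: "set a \<subseteq> F" "set b \<subseteq> F" "live C a"
      show "rel J a b \<longleftrightarrow> rel C a b"
      proof
        assume "rel J a b"
        show "rel C a b"
        proof (cases "a = b")
          case False
          then obtain j where j: "j \<in> J" "mact j a = b" using \<open>rel J a b\<close> by (auto simp: rel_def)
          have aT: "set a \<subseteq> T" and bT: "set b \<subseteq> T" using ab FT by auto
          \<comment> \<open>\<open>g\<close> fixes both \<open>a\<close> and \<open>b\<close>, so
            \<open>j\<close> and its conjugate by \<open>g\<close> both carry \<open>a\<close> to
            \<open>b\<close>; freeness of \<open>J\<close> on \<open>a\<close> makes them
            equal.\<close>
          have "g \<otimes> j = j \<otimes> g" if g: "g \<in> P" for g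
          proof -
            have gG: "g \<in> carrier G" and jG: "j \<in> carrier G" using g PG(2) j(1) JG by auto
            have ga: "mact g a = a" and gb: "mact g b = b" using ab g F by (auto intro!: map_idI)
            have "mact (g \<otimes> j \<otimes> inv g) a = mact g (mact j (mact (inv g) (mact g a)))"
              unfolding ga using gG jG aT mact_closed[of "inv g" a] by (simp only: mact_mult m_closed inv_closed)
            also have "\<dots> = mact j a" unfolding mact_inv[OF gG aT] j(2) gb ..
            finally have "g \<otimes> j \<otimes> inv g = j"
              using live_unique[OF J(1) live_C[OF ab(1,3)] aT norm j(1)] g P(2) j(1) by auto
            then show ?thesis using conj_iff[OF gG jG] by simp
          qed
          then have "j \<in> C" using j(1) by (simp add: C_def)
          then show ?thesis using j(2) aT bT by (auto simp: rel_def)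
        qed (simp add: rel_def)
      next
        assume "rel C a b"
        then show "rel J a b" using CJ unfolding rel_def by blast
      qed
    qed
  qed
  then obtain w where w: "w \<in> chains F (Suc n)" "c - lext bd w \<in> null F C C"
    using sylow_exact[OF C finC pC _ FT F_act F_fix c(1)] FY Y(1) finite_subset by blast
  have "c - lext bd w \<in> null Y J J"
    using w(2) FY by (rule nul_mono) (use CJ in \<open>auto simp: live_def rel_def\<close>)
  then show ?thesis using w(1) by blast
qed

text \<open>The contraction \<open>s\<close> is built for the larger quotient by \<open>J\<close>,
  where fewer lists are dead, and then shown to respect the additional \<open>K\<close>-dead lists
  thanks to the carriers \<open>F\<close>. These are defined by stabilizers in \<open>K\<close>, not
  in \<open>J\<close>.\<close>

lemma finite_exact:
  assumes K: "subgroup K G" "finite K" and J: "subgroup J G" "J \<subseteq> K" "p dvd card J"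
    and norm: "\<And>g h. g \<in> K \<Longrightarrow> h \<in> J \<Longrightarrow> g \<otimes> h \<otimes> inv g \<in> J"
    and Y: "finite Y" "Y \<subseteq> T" "\<And>g t. g \<in> K \<Longrightarrow> t \<in> Y \<Longrightarrow> act g t \<in> Y"
    and fixp: "\<And>S. psub p S \<Longrightarrow> S \<subseteq> K \<Longrightarrow> \<exists>t\<in>Y. \<forall>g\<in>S. act g t = t"
    and c: "c \<in> chains Y n" "lext bd c \<in> null Y K J"
  shows "\<exists>w\<in>chains Y (Suc n). c - lext bd w \<in> null Y K J"
proof -
  have KG: "g \<in> carrier G" if "g \<in> K" for g using K(1) that by (rule subgroup.mem_carrier)
  have JG: "J \<subseteq> carrier G" using J(1) by (rule subgroup.subset)
  define F where "F ts = {t \<in> Y. \<forall>g\<in>stab K ts. act g t = t}" for ts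
  have Nil: "\<not> live J []"
  proof -
    obtain y where "y \<in> J" "ord y = p" using cauchy[OF J(1) _ p J(3)] J(2) K(2) finite_subset by blast
    moreover from this have "y \<noteq> \<one>" using p ord_eq_1[of \<one>] by auto
    ultimately show ?thesis by (auto simp: live_def)
  qed
  obtain s where s: "\<And>ts. set ts \<subseteq> Y \<Longrightarrow> s ts \<in> chains (F ts) (Suc (length ts))"
    "\<And>ts. set ts \<subseteq> Y \<Longrightarrow> \<not> live J ts \<Longrightarrow> s ts = 0"
    "\<And>ts g. set ts \<subseteq> Y \<Longrightarrow> g \<in> J \<Longrightarrow> s (mact g ts) = push (mact g) (s ts)"
    "\<And>ts. set ts \<subseteq> Y \<Longrightarrow> single ts 1 - lext bd (s ts) - lext s (bd ts) \<in> null Y J J"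
  proof (rule equivariant_contraction[of J Y "live J" "null Y J J" F])
    show "act g t \<in> Y" if "g \<in> J" "t \<in> Y" for g t using that J(2) Y(3) by blast
    show "live J (mact g ts) \<longleftrightarrow> live J ts" if "set ts \<subseteq> Y" "g \<in> J" for ts g
      using live_mact[OF J(1) that(2)] that(1) Y(2) by blast
    show "live J ts" if "set \<sigma> \<subseteq> set ts" "live J \<sigma>" for ts \<sigma> using live_antimono that by blast
    show "push (mact g) c \<in> null Y J J" if "g \<in> J" "c \<in> null Y J J" for g c
      using that(2) Y(2) _ J(1) that(1) JG conj_in_subgroup[OF J(1) that(1)]
      by (rule null_push) (use J(2) Y(3) that(1) in blast)
    show "set ts \<subseteq> F ts \<and> F ts \<subseteq> Y" if "set ts \<subseteq> Y" for ts
      using that by (auto simp: F_def stab_def)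
    show "act g t \<in> F (mact g ts)" if ts: "set ts \<subseteq> Y" and g: "g \<in> J" and t: "t \<in> F ts" for ts g t
    proof -
      have gK: "g \<in> K" and gG: "g \<in> carrier G" using g J(2) KG by auto
      have tY: "t \<in> Y" "t \<in> T" using t Y(2) by (auto simp: F_def)
      have "act k (act g t) = act g t" if k: "k \<in> stab K (mact g ts)" for k
      proof -
        define h where "h = inv g \<otimes> k \<otimes> g"
        have kK: "k \<in> K" and kG: "k \<in> carrier G" using k KG by (auto simp: stab_def)
        have hK: "h \<in> K" using gK kK K(1) by (simp add: h_def subgroup.m_closed subgroup.m_inv_closed)
        have keq: "g \<otimes> h \<otimes> inv g = k" using gG kG by (simp add: h_def m_assoc) (simp add: m_assoc[symmetric])
        have "act h u = u" if "u \<in> set ts" for u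
          using conj_fixes[of g h u] gG KG[OF hK] that ts Y(2) k unfolding keq by (auto simp: stab_def)
        then have "act h t = t" using t hK by (auto simp: F_def stab_def)
        then show ?thesis using conj_fixes[of g h t] gG KG[OF hK] tY unfolding keq by simp
      qed
      then show ?thesis using Y(3)[OF gK tY(1)] by (simp add: F_def)
    qed
    show "F \<sigma> \<subseteq> F ts" if "set \<sigma> \<subseteq> set ts" for ts \<sigma> using that by (auto simp: F_def stab_def)
    show "\<exists>w\<in>chains (F ts) (Suc (length ts)). e - lext bd w \<in> null Y J J"
      if ts: "set ts \<subseteq> Y" "live J ts" and e: "e \<in> chains (F ts) (length ts)" "lext bd e \<in> null Y J J" for ts e
    proof -
      have "ts \<noteq> []" using ts(2) Nil by auto
      then have "psub p (stab K ts)" using ts Y(2) by (intro psub_stab K(1)) auto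
      from K J norm Y fixp this _ F_def e show ?thesis
        by (rule finite_fixed_points_exact) (auto simp: stab_def)
    qed
  qed (use J(1) Y(2) Nil null_bd submod_nul nul_deadI in auto)
  have VJ: "d \<in> null Y K J" if "d \<in> null Y J J" for d
    using that by (rule nul_mono) (use J(2) in \<open>auto simp: live_def\<close>)
  have "lext (\<lambda>ts. single ts 1 - lext bd (s ts) - lext s (bd ts)) c \<in> null Y J J"
    using submod_nul chainsD(1)[OF c(1)] by (rule submod_lext) (use s(4) c(1) in \<open>auto simp: chains_def\<close>)
  then have 1: "c - lext bd (lext s c) - lext s (lext bd c) \<in> null Y K J"
    by (intro VJ) (simp add: lext_diff_fun lext_id lext_lext)
  have 2: "lext s (lext bd c) \<in> null Y K J"
    using c(2) submod_nul
  proof (rule nul_lext)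
    fix a assume a: "set a \<subseteq> Y" "\<not> live K a"
    show "s a \<in> null Y K J"
    proof (cases "live J a")
      case False
      then show ?thesis using s(2) a(1) by (simp add: nul_zero)
    next
      case True
      \<comment> \<open>This is what the carriers are for: all vertices in \<open>s a\<close> are
        fixed by the stabilizer of \<open>a\<close> in \<open>K\<close>, which is nontrivial, so
        every list in \<open>s a\<close> is dead for \<open>K\<close> too.\<close>
      have "lext (\<lambda>b. single b 1) (s a) \<in> null Y K J"
        using submod_nul chainsD(1)[OF s(1)[OF a(1)]]
      proof (rule submod_lext)
        fix b assume "b \<in> keys (s a)"
        then have b: "set b \<subseteq> F a" using s(1)[OF a(1)] by (auto simp: chains_def)
        then have "\<not> live K b" using a(2) by (auto simp: live_def F_def stab_def subset_iff)
        then show "single b 1 \<in> null Y K J" using b by (intro nul_deadI) (auto simp: F_def)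
      qed
      then show ?thesis by (simp add: lext_id)
    qed
  next
    fix a b assume ab: "set a \<subseteq> Y" "set b \<subseteq> Y" "rel J a b"
    show "s a - s b \<in> null Y K J"
    proof (cases "a = b")
      case False
      then obtain j where j: "j \<in> J" "b = mact j a" using ab by (auto simp: rel_def)
      have "lext (\<lambda>d. single d 1 - single (mact j d) 1) (s a) \<in> null Y K J"
        using submod_nul chainsD(1)[OF s(1)[OF ab(1)]]
      proof (rule submod_lext)
        fix d assume "d \<in> keys (s a)"
        then have d: "set d \<subseteq> Y" using s(1)[OF ab(1)] by (auto simp: chains_def F_def)
        then have "set (mact j d) \<subseteq> Y" using j(1) J(2) Y(3) by (auto simp: subset_iff)
        moreover have "rel J d (mact j d)" using j(1) JG d Y(2) by (intro relI) auto
        ultimately show "single d 1 - single (mact j d) 1 \<in> null Y K J" using d by (intro nul_relI)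
      qed
      then show ?thesis using s(3)[OF ab(1) j(1)] by (simp add: lext_diff_fun lext_id j(2) push_def)
    qed (simp add: nul_zero)
  qed
  have "c - lext bd (lext s c) \<in> null Y K J" using submod_add[OF submod_nul 1 2] by simp
  moreover have "lext s c \<in> chains Y (Suc n)"
  proof (rule lext_chains[OF c(1)])
    fix ts :: "'t list" assume ts: "length ts = n" "set ts \<subseteq> Y"
    have "F ts \<subseteq> Y" by (auto simp: F_def)
    then show "s ts \<in> chains Y (Suc n)" using s(1)[OF ts(2)] ts(1) chains_mono by blast
  qed
  ultimately show ?thesis by blast
qed

end

section \<open>Coefficients in a \<open>\<int>\<^sub>(\<^sub>p\<^sub>)\<close>-module\<close>

locale Zp_module = localization p + module "localized_int p" M
  for p :: nat and M :: "(rat, 'm, 'w) module_scheme"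
begin

text \<open>Pairing of a cochain with a chain. It is used on integral chains, where the coefficients
  are scalars of \<open>M\<close>.\<close>

definition ev :: "('x \<Rightarrow> 'm) \<Rightarrow> ('x \<Rightarrow>\<^sub>0 rat) \<Rightarrow> 'm" where
  "ev f c = (\<Oplus>\<^bsub>M\<^esub>a\<in>keys c. lookup c a \<odot>\<^bsub>M\<^esub> f a)"

lemma smult_zero: "x \<in> carrier M \<Longrightarrow> 0 \<odot>\<^bsub>M\<^esub> x = \<zero>\<^bsub>M\<^esub>"
  using smult_l_null by (simp add: localized_int_def)

lemma smult_add: "r \<in> Zp p \<Longrightarrow> s \<in> Zp p \<Longrightarrow> x \<in> carrier M \<Longrightarrow> (r + s) \<odot>\<^bsub>M\<^esub> x = r \<odot>\<^bsub>M\<^esub> x \<oplus>\<^bsub>M\<^esub> s \<odot>\<^bsub>M\<^esub> x"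
  using smult_l_distr[of r s x] by (simp add: localized_int_def)

lemma smult_mult: "r \<in> Zp p \<Longrightarrow> s \<in> Zp p \<Longrightarrow> x \<in> carrier M \<Longrightarrow> (r * s) \<odot>\<^bsub>M\<^esub> x = r \<odot>\<^bsub>M\<^esub> (s \<odot>\<^bsub>M\<^esub> x)"
  using smult_assoc1[of r s x] by (simp add: localized_int_def)

lemma smult_1: "x \<in> carrier M \<Longrightarrow> 1 \<odot>\<^bsub>M\<^esub> x = x"
  using smult_one[of x] by (simp add: localized_int_def)

context
  fixes f :: "'x \<Rightarrow> 'm"
  assumes f: "\<And>a. f a \<in> carrier M"
begin

lemma ev_term: "integral c \<Longrightarrow> lookup c a \<odot>\<^bsub>M\<^esub> f a \<in> carrier M"
  using f by (simp add: integral_def)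

lemma ev_closed: "integral c \<Longrightarrow> ev f c \<in> carrier M"
  unfolding ev_def using ev_term by (intro M.finsum_closed) auto

lemma ev_superset:
  assumes "integral c" "finite A" "keys c \<subseteq> A"
  shows "ev f c = (\<Oplus>\<^bsub>M\<^esub>a\<in>A. lookup c a \<odot>\<^bsub>M\<^esub> f a)"
  unfolding ev_def using assms f ev_term smult_zero
  by (intro M.add.finprod_mono_neutral_cong_left) (auto simp: in_keys_iff)

lemma ev_zero [simp]: "ev f 0 = \<zero>\<^bsub>M\<^esub>"
  by (simp add: ev_def)

lemma ev_add:
  assumes "integral c" "integral d"
  shows "ev f (c + d) = ev f c \<oplus>\<^bsub>M\<^esub> ev f d"
proof -
  let ?A = "keys c \<union> keys d"
  have "ev f (c + d) = (\<Oplus>\<^bsub>M\<^esub>a\<in>?A. lookup (c + d) a \<odot>\<^bsub>M\<^esub> f a)"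
    using assms by (intro ev_superset integral_add) (use Poly_Mapping.keys_add[of c d] in auto)
  also have "\<dots> = (\<Oplus>\<^bsub>M\<^esub>a\<in>?A. lookup c a \<odot>\<^bsub>M\<^esub> f a \<oplus>\<^bsub>M\<^esub> lookup d a \<odot>\<^bsub>M\<^esub> f a)"
    using assms f ev_term by (intro M.finsum_cong') (auto simp: lookup_add smult_add integral_def)
  also have "\<dots> = (\<Oplus>\<^bsub>M\<^esub>a\<in>?A. lookup c a \<odot>\<^bsub>M\<^esub> f a) \<oplus>\<^bsub>M\<^esub> (\<Oplus>\<^bsub>M\<^esub>a\<in>?A. lookup d a \<odot>\<^bsub>M\<^esub> f a)"
    using assms ev_term by (intro M.finsum_addf) auto
  finally show ?thesis using assms by (simp add: ev_superset[of _ ?A])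
qed

lemma ev_single: "r \<in> Zp p \<Longrightarrow> ev f (single a r) = r \<odot>\<^bsub>M\<^esub> f a"
  using ev_superset[of "single a r" "{a}"] f by (cases "r = 0") (simp_all add: integral_single smult_zero)

lemma ev_scl:
  assumes r: "r \<in> Zp p" and c: "integral c"
  shows "ev f (scl r c) = r \<odot>\<^bsub>M\<^esub> ev f c"
proof -
  have "ev f (scl r c) = (\<Oplus>\<^bsub>M\<^esub>a\<in>keys c. lookup (scl r c) a \<odot>\<^bsub>M\<^esub> f a)"
    using assms keys_scl[of r c] by (intro ev_superset integral_scl) auto
  also have "\<dots> = (\<Oplus>\<^bsub>M\<^esub>a\<in>keys c. r \<odot>\<^bsub>M\<^esub> (lookup c a \<odot>\<^bsub>M\<^esub> f a))"
    using assms f ev_term by (intro M.finsum_cong') (auto simp: smult_mult integral_def)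
  also have "\<dots> = r \<odot>\<^bsub>M\<^esub> ev f c"
    unfolding ev_def using r ev_term[OF c] by (intro finsum_smult_ldistr[symmetric]) auto
  finally show ?thesis .
qed

lemma ev_minus: "integral c \<Longrightarrow> ev f (- c) = \<ominus>\<^bsub>M\<^esub> ev f c"
proof -
  assume c: "integral c"
  have m: "integral (- c)" using c by (simp add: integral_def Zp_minus)
  have "ev f (- c) \<oplus>\<^bsub>M\<^esub> ev f c = \<zero>\<^bsub>M\<^esub>" using ev_add[OF m c] by simp
  then show ?thesis using ev_closed[OF c] ev_closed[OF m] by (metis M.minus_equality)
qed

lemma ev_diff: "integral c \<Longrightarrow> integral d \<Longrightarrow> ev f (c - d) = ev f c \<ominus>\<^bsub>M\<^esub> ev f d"
  using ev_add[of c "- d"] by (simp add: ev_minus a_minus_def integral_def Zp_minus)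

lemma ev_sum: "finite A \<Longrightarrow> (\<And>a. a \<in> A \<Longrightarrow> integral (h a)) \<Longrightarrow> ev f (sum h A) = (\<Oplus>\<^bsub>M\<^esub>a\<in>A. ev f (h a))"
proof (induction A rule: finite_induct)
  case (insert a A)
  have "integral (sum h A)"
    using insert.prems by (auto simp: integral_def lookup_sum intro!: Zp_sum)
  then show ?case using insert ev_closed by (simp add: ev_add Pi_iff)
qed simp

lemma integral_lext: "integral c \<Longrightarrow> (\<And>a. a \<in> keys c \<Longrightarrow> integral (g a)) \<Longrightarrow> integral (lext g c)"
  by (auto simp: integral_def lext_def lookup_sum intro!: Zp_sum Zp_mult)

lemma ev_lext:
  assumes "integral c" "\<And>a. integral (g a)"
  shows "ev f (lext g c) = ev (\<lambda>a. ev f (g a)) c"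
proof -
  have "ev f (lext g c) = (\<Oplus>\<^bsub>M\<^esub>a\<in>keys c. ev f (scl (lookup c a) (g a)))"
    unfolding lext_def using assms by (intro ev_sum integral_scl) (auto simp: integral_def)
  also have "\<dots> = ev (\<lambda>a. ev f (g a)) c"
    unfolding ev_def[of "\<lambda>a. ev f (g a)"] using assms ev_closed
    by (intro M.finsum_cong') (auto simp: ev_scl integral_def)
  finally show ?thesis .
qed

end

lemma ev_cong: "(\<And>a. a \<in> keys c \<Longrightarrow> f a = g a) \<Longrightarrow> (\<And>a. g a \<in> carrier M) \<Longrightarrow> integral c \<Longrightarrow> ev f c = ev g c"
  unfolding ev_def by (rule M.finsum_cong') (auto simp: integral_def)

lemma ev_push:
  assumes "\<And>a. f a \<in> carrier M" "integral c"
  shows "ev f (push g c) = ev (\<lambda>a. f (g a)) c"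
  unfolding push_def using assms by (subst ev_lext) (auto simp: integral_single Zp_1 ev_single smult_1)

end

text \<open>A discrete stand-in for a classifying space: tuples of points fixed by a
  \<open>p\<close>-subgroup span a full simplex, which is contractible as soon as it has a
  vertex.\<close>

locale p_universal = p_isotropy p G T act
  for p :: nat and G :: "('a, 'b) monoid_scheme" (structure) and T :: "'t set" and act :: "'a \<Rightarrow> 't \<Rightarrow> 't" +
  assumes fixed_points: "psub p P \<Longrightarrow> \<exists>t\<in>T. \<forall>g\<in>P. act g t = t"

locale p_coefficients = p_universal p G T act + Zp_module p M + Mod: group_ring_module "localized_int p" G M \<mu>
  for p :: nat and G :: "('a, 'b) monoid_scheme" (structure) and T :: "'t set" and act :: "'a \<Rightarrow> 't \<Rightarrow> 't"
    and M :: "(rat, 'm, 'w) module_scheme" and \<mu> :: "'a \<Rightarrow> 'm \<Rightarrow> 'm" +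
  fixes H :: "'a set"
  assumes H_def: "H = action_kernel G M \<mu>"
    and locally_finite: "locally_finite_group G"
    and order_p: "\<exists>x\<in>H. ord x = p"
begin

lemma \<mu>_zero: "g \<in> carrier G \<Longrightarrow> \<mu> g \<zero>\<^bsub>M\<^esub> = \<zero>\<^bsub>M\<^esub>"
  using Mod.act_add[of g "\<zero>\<^bsub>M\<^esub>" "\<zero>\<^bsub>M\<^esub>"] Mod.act_closed[of g "\<zero>\<^bsub>M\<^esub>"]
  by (simp add: M.add.l_cancel_one')

lemma \<mu>_ev:
  assumes f: "\<And>a. f a \<in> carrier M" and g: "g \<in> carrier G" and c: "integral c"
  shows "\<mu> g (ev f c) = ev (\<lambda>a. \<mu> g (f a)) c"
proof -
  have "\<mu> g (\<Oplus>\<^bsub>M\<^esub>a\<in>A. lookup c a \<odot>\<^bsub>M\<^esub> f a) = (\<Oplus>\<^bsub>M\<^esub>a\<in>A. lookup c a \<odot>\<^bsub>M\<^esub> \<mu> g (f a))" if "finite A" for A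
    using that
  proof (induction A rule: finite_induct)
    case (insert a A)
    have "lookup c a \<in> Zp p" for a using c by (simp add: integral_def)
    then show ?case
      using insert f g Mod.act_closed by (simp add: Mod.act_add Mod.act_smult Pi_iff)
  qed (simp add: \<mu>_zero g)
  then show ?thesis by (simp add: ev_def)
qed

lemma subgroup_H: "subgroup H G"
proof (rule subgroupI)
  show "H \<subseteq> carrier G" by (auto simp: H_def action_kernel_def)
  have "\<one> \<in> H" using Mod.act_one by (simp add: H_def action_kernel_def)
  then show "H \<noteq> {}" by blast
  fix g assume g: "g \<in> H"
  have gG: "g \<in> carrier G" using g by (simp add: H_def action_kernel_def)
  have "\<mu> (inv g) m = m" if m: "m \<in> carrier M" for m
  proof -
    have "\<mu> (inv g) (\<mu> g m) = m"
      using Mod.act_mult[of "inv g" g m] gG m Mod.act_one by simp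
    then show ?thesis using g m by (simp add: H_def action_kernel_def)
  qed
  then show "inv g \<in> H" using gG by (simp add: H_def action_kernel_def)
  fix h assume "h \<in> H"
  then show "g \<otimes> h \<in> H" using g Mod.act_mult by (simp add: H_def action_kernel_def)
qed

lemma normal_H:
  assumes g: "g \<in> carrier G" and h: "h \<in> H"
  shows "g \<otimes> h \<otimes> inv g \<in> H"
proof -
  have hG: "h \<in> carrier G" using h by (simp add: H_def action_kernel_def)
  have "\<mu> (g \<otimes> h \<otimes> inv g) m = m" if m: "m \<in> carrier M" for m
  proof -
    have "\<mu> (g \<otimes> h \<otimes> inv g) m = \<mu> g (\<mu> h (\<mu> (inv g) m))"
      using g hG m Mod.act_closed by (simp add: Mod.act_mult)
    also have "\<mu> h (\<mu> (inv g) m) = \<mu> (inv g) m"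
      using h m g Mod.act_closed by (simp add: H_def action_kernel_def)
    also have "\<mu> g (\<mu> (inv g) m) = m"
      using Mod.act_mult[of g "inv g" m] g m Mod.act_one by simp
    finally show ?thesis .
  qed
  then show ?thesis using g hG by (simp add: H_def action_kernel_def)
qed

text \<open>Nullity is witnessed by finitely many generators. Each dead list contributes one
  nontrivial element fixing it, each identification one element of \<open>H\<close>; any
  \<open>K\<close> and \<open>Y'\<close> containing these witnesses will do.\<close>

lemma null_finite_descent:
  assumes "c \<in> null T (carrier G) H"
  obtains F Y where "finite F" "F \<subseteq> carrier G" "finite Y" "Y \<subseteq> T"
    "\<And>K Y'. F \<subseteq> K \<Longrightarrow> Y \<subseteq> Y' \<Longrightarrow> c \<in> null Y' K (H \<inter> K)"
proof -
  have "\<exists>F Y. finite F \<and> F \<subseteq> carrier G \<and> finite Y \<and> Y \<subseteq> T \<and>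
      (\<forall>K Y'. F \<subseteq> K \<longrightarrow> Y \<subseteq> Y' \<longrightarrow> c \<in> null Y' K (H \<inter> K))"
    using assms
  proof induction
    case nul_zero
    then show ?case by (intro exI[of _ "{}"]) (simp add: nul.nul_zero)
  next
    case (nul_dead c r a)
    then obtain F Y where FY: "finite F" "F \<subseteq> carrier G" "finite Y" "Y \<subseteq> T"
      "\<And>K Y'. F \<subseteq> K \<Longrightarrow> Y \<subseteq> Y' \<Longrightarrow> c \<in> null Y' K (H \<inter> K)" by blast
    obtain g where g: "g \<in> carrier G" "\<forall>t\<in>set a. act g t = t" "g \<noteq> \<one>"
      using nul_dead.hyps by (auto simp: live_def)
    have "c + single a r \<in> null Y' K (H \<inter> K)" if "insert g F \<subseteq> K" "Y \<union> set a \<subseteq> Y'" for K Y'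
      using that FY(5) nul_dead.hyps g by (intro nul.nul_dead) (auto simp: live_def)
    then show ?case
      using FY g nul_dead.hyps by (intro exI[of _ "insert g F"] exI[of _ "Y \<union> set a"]) auto
  next
    case (nul_rel c r a b)
    then obtain F Y where FY: "finite F" "F \<subseteq> carrier G" "finite Y" "Y \<subseteq> T"
      "\<And>K Y'. F \<subseteq> K \<Longrightarrow> Y \<subseteq> Y' \<Longrightarrow> c \<in> null Y' K (H \<inter> K)" by blast
    obtain g where g: "g \<in> H" "a = b \<or> mact g a = b"
      using nul_rel.hyps(5) subgroup.one_closed[OF subgroup_H] unfolding rel_def by blast
    have gG: "g \<in> carrier G" using g(1) subgroup_H by (meson subgroup.mem_carrier)
    have "c + (single a r - single b r) \<in> null Y' K (H \<inter> K)"
      if "insert g F \<subseteq> K" "Y \<union> (set a \<union> set b) \<subseteq> Y'" for K Y'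
    proof (rule nul.nul_rel)
      show "rel (H \<inter> K) a b" using g that nul_rel.hyps by (auto simp: rel_def)
    qed (use that FY(5) nul_rel.hyps in auto)
    then show ?case
      using FY gG nul_rel.hyps by (intro exI[of _ "insert g F"] exI[of _ "Y \<union> (set a \<union> set b)"]) auto
  qed
  then show ?thesis using that by blast
qed

lemma exact:
  assumes c: "c \<in> chains T n" "lext bd c \<in> null T (carrier G) H"
  shows "\<exists>w\<in>chains T (Suc n). c - lext bd w \<in> null T (carrier G) H"
proof -
  obtain F Y where FY: "finite F" "F \<subseteq> carrier G" "finite Y" "Y \<subseteq> T"
    "\<And>K Y'. F \<subseteq> K \<Longrightarrow> Y \<subseteq> Y' \<Longrightarrow> lext bd c \<in> null Y' K (H \<inter> K)"
    using null_finite_descent[OF c(2)] by blast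
  obtain x where x: "x \<in> H" "ord x = p" using order_p by blast
  have xG: "x \<in> carrier G" using x(1) subgroup_H by (meson subgroup.mem_carrier)
  \<comment> \<open>\<open>x\<close> joins the witnesses so that \<open>J\<close> keeps an element
    of order \<open>p\<close>; local finiteness makes \<open>K\<close> finite.\<close>
  define K where "K = generate G (insert x F)"
  have K: "subgroup K G" unfolding K_def using FY(2) xG by (intro generate_is_subgroup) auto
  have finK: "finite K"
    using locally_finite FY(1,2) xG by (auto simp: locally_finite_group_def K_def)
  have FK: "insert x F \<subseteq> K" unfolding K_def by (intro subsetI generate.incl)
  have KG: "g \<in> carrier G" if "g \<in> K" for g using K that by (rule subgroup.mem_carrier)
  define J where "J = H \<inter> K"
  have J: "subgroup J G" unfolding J_def using subgroup_H K by (rule subgroups_Inter_pair)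
  have JK: "J \<subseteq> K" by (simp add: J_def)
  have pJ: "p dvd card J"
    using ord_dvd_card[OF J, of x] x FK finK by (auto simp: J_def)
  have "\<exists>\<tau>. \<forall>S. psub p S \<longrightarrow> \<tau> S \<in> T \<and> (\<forall>g\<in>S. act g (\<tau> S) = \<tau> S)"
    using fixed_points by metis
  then obtain \<tau> where \<tau>: "\<And>S. psub p S \<Longrightarrow> \<tau> S \<in> T" "\<And>S g. psub p S \<Longrightarrow> g \<in> S \<Longrightarrow> act g (\<tau> S) = \<tau> S"
    by metis
  \<comment> \<open>The witnesses, the vertices of \<open>c\<close>, and one fixed point for each of
    the finitely many \<open>p\<close>-subgroups of \<open>K\<close>; \<open>Y2\<close> is the
    closure under \<open>K\<close>.\<close>
  define Y1 where "Y1 = Y \<union> (\<Union>a\<in>keys c. set a) \<union> \<tau> ` {S \<in> Pow K. psub p S}"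
  have Y1: "finite Y1" "Y1 \<subseteq> T"
    using FY(3,4) finK \<tau>(1) c(1) by (auto simp: Y1_def chains_def)
  define Y2 where "Y2 = (\<lambda>(g, t). act g t) ` (K \<times> Y1)"
  have Y12: "Y1 \<subseteq> Y2"
  proof
    fix t assume t: "t \<in> Y1"
    then have "act \<one> t = t" using Y1(2) act_one by blast
    then show "t \<in> Y2" using t subgroup.one_closed[OF K] by (force simp: Y2_def)
  qed
  have Y2: "finite Y2" "Y2 \<subseteq> T" using Y1 finK KG act_closed by (auto simp: Y2_def)
  have Y2_act: "act g t \<in> Y2" if g: "g \<in> K" and "t \<in> Y2" for g t
  proof -
    obtain h u where h: "h \<in> K" "u \<in> Y1" "t = act h u" using \<open>t \<in> Y2\<close> by (auto simp: Y2_def)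
    have "act g t = act (g \<otimes> h) u" using h g KG Y1(2) by (auto simp: act_mult)
    then show ?thesis using h subgroup.m_closed[OF K g h(1)] by (force simp: Y2_def)
  qed
  have norm: "g \<otimes> h \<otimes> inv g \<in> J" if "g \<in> K" "h \<in> J" for g h
    using that normal_H[OF KG] conj_in_subgroup[OF K] by (auto simp: J_def)
  have fixp: "\<exists>t\<in>Y2. \<forall>g\<in>S. act g t = t" if "psub p S" "S \<subseteq> K" for S
    using that \<tau>(2) Y12 by (intro bexI[of _ "\<tau> S"]) (auto simp: Y1_def)
  have "c \<in> chains Y2 n" using c(1) Y12 by (auto simp: chains_def Y1_def)
  moreover have "lext bd c \<in> null Y2 K J"
    unfolding J_def using FK Y12 by (intro FY(5)) (auto simp: Y1_def)
  ultimately obtain w where w: "w \<in> chains Y2 (Suc n)" "c - lext bd w \<in> null Y2 K J"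
    using K finK J JK pJ norm Y2 Y2_act fixp finite_exact[of K J Y2 c n] by blast
  have "c - lext bd w \<in> null T (carrier G) H"
    using w(2) Y2(2) by (rule nul_mono) (use KG in \<open>auto simp: live_def rel_def J_def\<close>)
  moreover have "w \<in> chains T (Suc n)" using w(1) chains_mono[OF Y2(2)] by blast
  ultimately show ?thesis by blast
qed

text \<open>The quotient of the chain complex of \<open>T\<close> by dead lists and by the action of \<open>H\<close> is an acyclic
  complex of free \<open>\<int>\<^sub>(\<^sub>p\<^sub>)[G/H]\<close>-modules, hence contractible, and it computes equivariant cochains
  with values in \<open>M\<close>.\<close>

lemma cochains_exact:
  assumes m: "\<And>a. m a \<in> carrier M" and m_dead: "\<And>a. set a \<subseteq> T \<Longrightarrow> \<not> live (carrier G) a \<Longrightarrow> m a = \<zero>\<^bsub>M\<^esub>"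
    and m_act: "\<And>a g. set a \<subseteq> T \<Longrightarrow> g \<in> carrier G \<Longrightarrow> m (mact g a) = \<mu> g (m a)"
    and cocycle: "\<And>a. set a \<subseteq> T \<Longrightarrow> ev m (bd a) = \<zero>\<^bsub>M\<^esub>"
  obtains x where "\<And>a. x a \<in> carrier M" "\<And>a. set a \<subseteq> T \<Longrightarrow> \<not> live (carrier G) a \<Longrightarrow> x a = \<zero>\<^bsub>M\<^esub>"
    "\<And>a g. set a \<subseteq> T \<Longrightarrow> g \<in> carrier G \<Longrightarrow> x (mact g a) = \<mu> g (x a)"
    "\<And>a. set a \<subseteq> T \<Longrightarrow> m a = ev x (bd a)"
proof -
  let ?V = "null T (carrier G) H"
  have HG: "H \<subseteq> carrier G" using subgroup_H by (rule subgroup.subset)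
  have GG: "subgroup (carrier G) G" by (rule subgroup_self)
  have Nil: "\<not> live (carrier G) []"
  proof -
    obtain y where y: "y \<in> H" "ord y = p" using order_p by blast
    then have "y \<noteq> \<one>" using p by auto
    then show ?thesis using y(1) HG by (auto simp: live_def)
  qed
  obtain s where s: "\<And>ts. set ts \<subseteq> T \<Longrightarrow> s ts \<in> chains T (Suc (length ts))"
    "\<And>ts. set ts \<subseteq> T \<Longrightarrow> \<not> live (carrier G) ts \<Longrightarrow> s ts = 0"
    "\<And>ts g. set ts \<subseteq> T \<Longrightarrow> g \<in> carrier G \<Longrightarrow> s (mact g ts) = push (mact g) (s ts)"
    "\<And>ts. set ts \<subseteq> T \<Longrightarrow> single ts 1 - lext bd (s ts) - lext s (bd ts) \<in> ?V"
  proof (rule equivariant_contraction[of "carrier G" T "live (carrier G)" ?V "\<lambda>_. T"])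
    show "live (carrier G) ts" if "set \<sigma> \<subseteq> set ts" "live (carrier G) \<sigma>" for ts \<sigma>
      using live_antimono that by blast
    show "push (mact g) c \<in> ?V" if "g \<in> carrier G" "c \<in> ?V" for g c
      using that(2) subset_refl _ GG that(1) HG by (rule null_push) (use that(1) act_closed normal_H in auto)
  qed (use GG Nil null_bd submod_nul nul_deadI act_closed live_mact exact in auto)
  \<comment> \<open>\<open>ev_lext\<close> asks for integral values at every list, whereas
    \<open>s\<close> is controlled only on lists in \<open>T\<close>.\<close>
  define s' where "s' a = (if set a \<subseteq> T then s a else 0)" for a
  have s'_int: "integral (s' a)" for a
    using s(1) chainsD(1) by (auto simp: s'_def integral_zero)
  \<comment> \<open>\<open>m\<close> factors through the quotient: it vanishes on dead lists, and it
    is constant on \<open>H\<close>-orbits since it is equivariant and \<open>H\<close> acts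
    trivially on \<open>M\<close>.\<close>
  have ev_null: "ev m c = \<zero>\<^bsub>M\<^esub>" if "c \<in> ?V" for c
  proof -
    have "integral c \<and> ev m c = \<zero>\<^bsub>M\<^esub>"
      using that
    proof induction
      case (nul_dead c r a)
      then show ?case
        using m by (simp add: ev_add integral_single ev_single m_dead integral_add)
    next
      case (nul_rel c r a b)
      have "m a = m b"
      proof (cases "a = b")
        case False
        then obtain h where h: "h \<in> H" "b = mact h a" using nul_rel.hyps by (auto simp: rel_def)
        then have "m b = \<mu> h (m a)" using m_act nul_rel.hyps HG by blast
        then show ?thesis using h(1) m by (simp add: H_def action_kernel_def)
      qed simp
      then have "ev m (single a r - single b r) = \<zero>\<^bsub>M\<^esub>"
        using m nul_rel.hyps by (simp add: ev_diff ev_single integral_single M.r_neg a_minus_def)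
      moreover have "integral (single a r - single b r)"
        using nul_rel.hyps integral_add[OF integral_single integral_single, of r "- r" a b]
        by (simp add: Zp_minus single_uminus)
      ultimately show ?case using nul_rel.IH m by (simp add: ev_add integral_add)
    qed (simp add: integral_zero m)
    then show ?thesis by blast
  qed
  have ev_bd: "ev m (lext bd c) = \<zero>\<^bsub>M\<^esub>" if c: "integral c" "\<And>a. a \<in> keys c \<Longrightarrow> set a \<subseteq> T" for c
  proof -
    have "ev m (lext bd c) = ev (\<lambda>a. ev m (bd a)) c"
      using m c(1) integral_bd by (rule ev_lext)
    also have "\<dots> = ev (\<lambda>_. \<zero>\<^bsub>M\<^esub>) c"
      using cocycle c by (intro ev_cong) auto
    also have "\<dots> = \<zero>\<^bsub>M\<^esub>" using c(1) by (auto simp: ev_def integral_def intro!: M.add.finprod_one_eqI)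
    finally show ?thesis .
  qed
  \<comment> \<open>Evaluating \<open>m\<close> on the homotopy identity gives
    \<open>m = m \<partial> s + m s \<partial>\<close>, and the first summand vanishes because
    \<open>m\<close> is a cocycle.\<close>
  define x where "x a = ev m (s' a)" for a
  have x: "x a \<in> carrier M" for a unfolding x_def using m s'_int by (rule ev_closed)
  show ?thesis
  proof (rule that[of x])
    show "x a \<in> carrier M" for a by (rule x)
    show "x a = \<zero>\<^bsub>M\<^esub>" if "set a \<subseteq> T" "\<not> live (carrier G) a" for a
      using s(2) that m by (simp add: x_def s'_def)
    show "x (mact g a) = \<mu> g (x a)" if a: "set a \<subseteq> T" and g: "g \<in> carrier G" for a g
    proof -
      have "x (mact g a) = ev (\<lambda>b. m (mact g b)) (s a)"
        using mact_closed[OF g a] s(3)[OF a g] m chainsD(1)[OF s(1)[OF a]] by (simp add: x_def s'_def ev_push)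
      also have "\<dots> = ev (\<lambda>b. \<mu> g (m b)) (s a)"
        using m_act[OF _ g] chainsD[OF s(1)[OF a]] Mod.act_closed[OF g m] by (intro ev_cong) auto
      also have "\<dots> = \<mu> g (x a)"
        using \<mu>_ev[OF m g chainsD(1)[OF s(1)[OF a]]] a by (simp add: x_def s'_def)
      finally show ?thesis .
    qed
    show "m a = ev x (bd a)" if a: "set a \<subseteq> T" for a
    proof -
      have eq: "lext s (bd a) = lext s' (bd a :: _ \<Rightarrow>\<^sub>0 rat)"
        by (rule lext_cong) (use a keys_bd in \<open>auto simp: s'_def\<close>)
      have int: "integral (single a 1)" "integral (lext bd (s a))" "integral (lext s' (bd a))"
        using integral_single[OF Zp_1] chainsD(1)[OF lext_bd_chains[OF s(1)[OF a]]]
          integral_lext[OF m integral_bd s'_int] by auto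
      have "ev m (single a 1 - lext bd (s a) - lext s' (bd a)) = \<zero>\<^bsub>M\<^esub>"
        using ev_null[OF s(4)[OF a]] unfolding eq .
      moreover have "integral (single a 1 - lext bd (s a))"
        using int Zp_add Zp_minus by (auto simp: integral_def lookup_minus) (metis add_uminus_conv_diff)
      ultimately have "ev m (single a 1) \<ominus>\<^bsub>M\<^esub> ev m (lext bd (s a)) \<ominus>\<^bsub>M\<^esub> ev m (lext s' (bd a)) = \<zero>\<^bsub>M\<^esub>"
        using int m by (simp add: ev_diff)
      moreover have "ev m (lext bd (s a)) = \<zero>\<^bsub>M\<^esub>"
        using chainsD[OF s(1)[OF a]] by (intro ev_bd)
      moreover have "ev m (lext s' (bd a)) = ev x (bd a)"
        unfolding x_def using m integral_bd s'_int by (rule ev_lext)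
      moreover have "ev m (single a 1) = m a" using m by (simp add: ev_single Zp_1 smult_1)
      ultimately have "m a \<oplus>\<^bsub>M\<^esub> \<ominus>\<^bsub>M\<^esub> ev x (bd a) = \<zero>\<^bsub>M\<^esub>"
        using m M.minus_equality[of "\<zero>\<^bsub>M\<^esub>" "\<zero>\<^bsub>M\<^esub>"] by (simp add: a_minus_def)
      moreover have xbd: "ev x (bd a) \<in> carrier M" using x integral_bd by (rule ev_closed)
      ultimately show ?thesis
        using M.minus_equality[of "m a" "\<ominus>\<^bsub>M\<^esub> ev x (bd a)"] m by simp
    qed
  qed
qed

end

section \<open>A resolution of the constant functor on the orbit category\<close>

lemma nat_transD:
  assumes "nat_trans C F F' \<eta>"
  shows nat_trans_hom: "c \<in> Ob C \<Longrightarrow> \<eta> c \<in> hom (fobj F c) (fobj F' c)"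
    and nat_trans_closed: "c \<in> Ob C \<Longrightarrow> x \<in> carrier (fobj F c) \<Longrightarrow> \<eta> c x \<in> carrier (fobj F' c)"
    and nat_trans_nat: "c \<in> Ob C \<Longrightarrow> d \<in> Ob C \<Longrightarrow> f \<in> Mor C c d \<Longrightarrow> x \<in> carrier (fobj F d)
      \<Longrightarrow> \<eta> c (fmap F c d f x) = fmap F' c d f (\<eta> d x)"
  using assms by (auto simp: nat_trans_def hom_def)

lemma nat_trans_comp:
  assumes "nat_trans C F F' \<eta>" "nat_trans C F' F'' \<theta>"
  shows "nat_trans C F F'' (\<lambda>c x. \<theta> c (\<eta> c x))"
  unfolding nat_trans_def
proof (intro conjI ballI)
  fix c assume c: "c \<in> Ob C"
  show "(\<lambda>x. \<theta> c (\<eta> c x)) \<in> hom (fobj F c) (fobj F'' c)"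
    using hom_compose[OF nat_trans_hom[OF assms(1) c] nat_trans_hom[OF assms(2) c]] by (simp add: comp_def)
  fix d f x assume d: "d \<in> Ob C" "f \<in> Mor C c d" "x \<in> carrier (fobj F d)"
  then show "\<theta> c (\<eta> c (fmap F c d f x)) = fmap F'' c d f (\<theta> d (\<eta> d x))"
    using nat_trans_nat[OF assms(1) c] nat_trans_nat[OF assms(2) c] nat_trans_closed[OF assms(1)] by simp
qed

lemma nat_trans_group_hom:
  assumes "cmodule C F" "cmodule C F'" "nat_trans C F F' \<eta>" "c \<in> Ob C"
  shows "group_hom (fobj F c) (fobj F' c) (\<eta> c)"
  using assms cmodule.fobj_group[OF assms(1,4)] cmodule.fobj_group[OF assms(2,4)]
  by (simp add: group_hom_def group_hom_axioms_def comm_group_def nat_trans_hom)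

lemma nat_trans_diff:
  assumes F: "cmodule C F" and F': "cmodule C F'"
    and \<eta>: "nat_trans C F F' \<eta>" and \<theta>: "nat_trans C F F' \<theta>"
  shows "nat_trans C F F' (\<lambda>c x. \<eta> c x \<otimes>\<^bsub>fobj F' c\<^esub> inv\<^bsub>fobj F' c\<^esub> \<theta> c x)"
  unfolding nat_trans_def
proof (intro conjI ballI)
  fix c assume c: "c \<in> Ob C"
  interpret A: comm_group "fobj F' c" using F' c by (rule cmodule.fobj_group)
  interpret \<eta>c: group_hom "fobj F c" "fobj F' c" "\<eta> c" using F F' \<eta> c by (rule nat_trans_group_hom)
  interpret \<theta>c: group_hom "fobj F c" "fobj F' c" "\<theta> c" using F F' \<theta> c by (rule nat_trans_group_hom)
  show "(\<lambda>x. \<eta> c x \<otimes>\<^bsub>fobj F' c\<^esub> inv\<^bsub>fobj F' c\<^esub> \<theta> c x) \<in> hom (fobj F c) (fobj F' c)"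
    by (rule homI) (simp_all add: A.inv_mult A.m_ac)
  fix d f x assume d: "d \<in> Ob C" "f \<in> Mor C c d" "x \<in> carrier (fobj F d)"
  interpret Ad: comm_group "fobj F' d" using F' d(1) by (rule cmodule.fobj_group)
  interpret f: group_hom "fobj F' d" "fobj F' c" "fmap F' c d f"
    using cmodule.fmap_hom[OF F' c d(1,2)]
    by (simp add: group_hom_def group_hom_axioms_def Ad.is_group A.is_group)
  have "\<eta> d x \<in> carrier (fobj F' d)" "\<theta> d x \<in> carrier (fobj F' d)"
    using nat_trans_closed[OF \<eta> d(1,3)] nat_trans_closed[OF \<theta> d(1,3)] by auto
  then show "\<eta> c (fmap F c d f x) \<otimes>\<^bsub>fobj F' c\<^esub> inv\<^bsub>fobj F' c\<^esub> \<theta> c (fmap F c d f x) =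
      fmap F' c d f (\<eta> d x \<otimes>\<^bsub>fobj F' d\<^esub> inv\<^bsub>fobj F' d\<^esub> \<theta> d x)"
    using nat_trans_nat[OF \<eta> c d] nat_trans_nat[OF \<theta> c d] by simp
qed

lemma keys_lext_subset: "(\<And>a. a \<in> keys c \<Longrightarrow> keys (f a) \<subseteq> B) \<Longrightarrow> keys (lext f c) \<subseteq> B"
  using keys_lext[of f c] by blast

section \<open>Functors of fixed tuples on the orbit category\<close>

context p_universal
begin

abbreviation orb :: "('a set, 'a set) cat" where
  "orb \<equiv> p_orbit_cat p G"

lemma Ob_iff: "P \<in> Ob orb \<longleftrightarrow> psub p P"
  by (simp add: psub_iff p_orbit_cat_def)

lemma category_orb: "category orb"
  by (rule category_p_orbit_cat) (rule is_group)

lemma Ob_subgroup: "P \<in> Ob orb \<Longrightarrow> subgroup P G"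
  by (simp add: Ob_iff psub_def)

lemma MorD:
  assumes PQ: "P \<in> Ob orb" "Q \<in> Ob orb" and S: "S \<in> Mor orb P Q" "g \<in> S"
  shows "g \<in> carrier G" "S = Q #> g" "h \<in> P \<Longrightarrow> g \<otimes> h \<otimes> inv g \<in> Q"
proof -
  have Q: "subgroup Q G" using PQ(2) by (rule Ob_subgroup)
  obtain x where x: "x \<in> carrier G" "(\<lambda>h. x \<otimes> h \<otimes> inv x) ` P \<subseteq> Q" "S = Q #> x"
    using S(1) by (rule orbit_cat_MorE)
  then obtain q where q: "q \<in> Q" "g = q \<otimes> x" using S(2) by (auto simp: r_coset_def)
  have qG: "q \<in> carrier G" using Q q(1) by (rule subgroup.mem_carrier)
  show gG: "g \<in> carrier G" using q x(1) qG by simp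
  show "S = Q #> g" using x Q S(2) by (metis repr_independence)
  show "g \<otimes> h \<otimes> inv g \<in> Q" if h: "h \<in> P"
  proof -
    have hG: "h \<in> carrier G" using Ob_subgroup[OF PQ(1)] h by (rule subgroup.mem_carrier)
    have "g \<otimes> h \<otimes> inv g = q \<otimes> (x \<otimes> h \<otimes> inv x) \<otimes> inv q"
      using q(2) qG hG x(1) by (simp add: inv_mult_group m_assoc)
    moreover have "x \<otimes> h \<otimes> inv x \<in> Q" using x(2) h by blast
    ultimately show ?thesis using conj_in_subgroup[OF Q q(1)] by simp
  qed
qed

lemma MorI: "g \<in> carrier G \<Longrightarrow> (\<And>h. h \<in> P \<Longrightarrow> g \<otimes> h \<otimes> inv g \<in> Q) \<Longrightarrow> Q #> g \<in> Mor orb P Q"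
  unfolding p_orbit_cat_def by auto

lemma Mor_nonempty: "P \<in> Ob orb \<Longrightarrow> Q \<in> Ob orb \<Longrightarrow> S \<in> Mor orb P Q \<Longrightarrow> \<exists>g. g \<in> S"
  by (elim orbit_cat_MorE) (use Ob_subgroup rcos_self in blast)

definition Fix :: "'a set \<Rightarrow> 't set" where
  "Fix P = {t \<in> T. \<forall>g\<in>P. act g t = t}"

definition tuples :: "nat \<Rightarrow> 'a set \<Rightarrow> 't list set" where
  "tuples n P = {a. length a = n \<and> set a \<subseteq> Fix P}"

lemma tuplesD: "a \<in> tuples n P \<Longrightarrow> set a \<subseteq> T" "a \<in> tuples n P \<Longrightarrow> length a = n"
    "a \<in> tuples n P \<Longrightarrow> g \<in> P \<Longrightarrow> mact g a = a"
  by (auto simp: tuples_def Fix_def intro!: map_idI)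

text \<open>On lists fixed by \<open>Q\<close>, all representatives of a coset \<open>S = Qg\<close> have the same effect.\<close>

definition pull :: "'a set \<Rightarrow> 't list \<Rightarrow> 't list" where
  "pull S = mact (inv (SOME g. g \<in> S))"

lemma pull_eq:
  assumes PQ: "P \<in> Ob orb" "Q \<in> Ob orb" and S: "S \<in> Mor orb P Q" "g \<in> S" and a: "a \<in> tuples n Q"
  shows "pull S a = mact (inv g) a"
proof -
  define g' where "g' = (SOME g. g \<in> S)"
  have g': "g' \<in> S" unfolding g'_def using S(2) by (rule someI)
  have gG: "g \<in> carrier G" "S = Q #> g" using MorD[OF PQ S] by auto
  obtain q where q: "q \<in> Q" "g' = q \<otimes> g" using g' gG(2) by (auto simp: r_coset_def)
  have qG: "q \<in> carrier G" using Ob_subgroup[OF PQ(2)] q(1) by (rule subgroup.mem_carrier)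
  have iq: "inv q \<in> Q" using subgroup.m_inv_closed[OF Ob_subgroup[OF PQ(2)] q(1)] .
  have "mact (inv g') a = mact (inv g \<otimes> inv q) a" using q(2) qG gG(1) by (simp add: inv_mult_group)
  also have "\<dots> = mact (inv g) (mact (inv q) a)"
    using qG gG(1) tuplesD(1)[OF a] by (intro mact_mult) auto
  also have "mact (inv q) a = a" using a iq by (rule tuplesD(3))
  finally show ?thesis by (simp add: pull_def g'_def)
qed

lemma mact_tuples:
  assumes PQ: "P \<in> Ob orb" "Q \<in> Ob orb" and S: "S \<in> Mor orb P Q" "g \<in> S" and a: "a \<in> tuples n Q"
  shows "mact (inv g) a \<in> tuples n P"
proof -
  note g = MorD[OF PQ S]
  have "act h (act (inv g) t) = act (inv g) t" if h: "h \<in> P" and t: "t \<in> set a" for h t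
  proof -
    have hG: "h \<in> carrier G" using Ob_subgroup[OF PQ(1)] h by (rule subgroup.mem_carrier)
    have tT: "t \<in> T" using tuplesD(1)[OF a] t by blast
    have "g \<otimes> h \<otimes> inv g \<in> Q" by (rule g(3)[OF h])
    then have "act (g \<otimes> h \<otimes> inv g) t = t" using a t by (auto simp: tuples_def Fix_def)
    then have "act (g \<otimes> h \<otimes> inv g) (act g (act (inv g) t)) = act g (act (inv g) t)"
      using act_inv'[OF g(1) tT] by simp
    then show ?thesis
      using conj_fixes[of g h "act (inv g) t"] g(1) hG tT act_closed[of "inv g" t] by simp
  qed
  then show ?thesis using a g(1) act_closed[of "inv g"] tuplesD(1)[OF a]
    by (auto simp: tuples_def Fix_def subset_iff)
qed

lemma pull_tuples:
  assumes PQ: "P \<in> Ob orb" "Q \<in> Ob orb" and S: "S \<in> Mor orb P Q" and a: "a \<in> tuples n Q"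
  shows "pull S a \<in> tuples n P"
  using Mor_nonempty[OF PQ S] pull_eq[OF PQ S _ a] mact_tuples[OF PQ S _ a] by auto

lemma pull_idt: "P \<in> Ob orb \<Longrightarrow> a \<in> tuples n P \<Longrightarrow> pull (idt orb P) a = a"
  using pull_eq[of P P "idt orb P" \<one> a n] category.idt_closed[OF category_orb] subgroup.one_closed[OF Ob_subgroup]
    mact_one tuplesD(1) by (simp add: p_orbit_cat_def)

lemma pull_cmp:
  assumes Ob: "P \<in> Ob orb" "Q \<in> Ob orb" "N \<in> Ob orb" and S: "S \<in> Mor orb P Q" and U: "U \<in> Mor orb Q N"
    and a: "a \<in> tuples n N"
  shows "pull (cmp orb U S) a = pull S (pull U a)"
proof -
  obtain g where g: "g \<in> S" using Mor_nonempty[OF Ob(1,2) S] by blast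
  obtain h where h: "h \<in> U" using Mor_nonempty[OF Ob(2,3) U] by blast
  have gG: "g \<in> carrier G" and hG: "h \<in> carrier G"
    using MorD(1)[OF Ob(1,2) S g] MorD(1)[OF Ob(2,3) U h] .
  have "h \<otimes> g \<in> cmp orb U S" using g h by (auto simp: p_orbit_cat_def set_mult_def)
  then have "pull (cmp orb U S) a = mact (inv (h \<otimes> g)) a"
    using pull_eq[OF Ob(1,3) category.cmp_closed[OF category_orb Ob S U] _ a] by blast
  also have "\<dots> = mact (inv g) (mact (inv h) a)"
    unfolding inv_mult_group[OF hG gG] using gG hG tuplesD(1)[OF a] by (intro mact_mult) auto
  also have "mact (inv h) a = pull U a" using pull_eq[OF Ob(2,3) U h a] by simp
  also have "mact (inv g) (pull U a) = pull S (pull U a)"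
    using pull_eq[OF Ob(1,2) S g pull_tuples[OF Ob(2,3) U a]] by simp
  finally show ?thesis .
qed

definition E :: "nat \<Rightarrow> ('a set, 'a set, 't list \<Rightarrow>\<^sub>0 int) cmod" where
  "E n = \<lparr>fobj = (\<lambda>P. free_Abelian_group (tuples n P)), fmap = (\<lambda>P Q S. push (pull S))\<rparr>"

lemma E_simps: "fobj (E n) P = free_Abelian_group (tuples n P)" "fmap (E n) P Q S = push (pull S)"
  by (simp_all add: E_def)

lemma push_in_hom:
  assumes "\<And>a. a \<in> A \<Longrightarrow> f a \<in> B"
  shows "push f \<in> hom (free_Abelian_group A) (free_Abelian_group B)"
proof (rule homI)
  fix c :: "_ \<Rightarrow>\<^sub>0 int" assume "c \<in> carrier (free_Abelian_group A)"
  then have "f ` keys c \<subseteq> B" using assms by auto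
  then show "push f c \<in> carrier (free_Abelian_group B)"
    using keys_push[of f c] by simp
qed (simp add: push_add)

lemma cmodule_E: "cmodule orb (E n)"
proof (intro cmodule.intro cmodule_axioms.intro category_orb)
  fix P assume P: "P \<in> Ob orb"
  show "comm_group (fobj (E n) P)" by (simp add: E_simps abelian_free_Abelian_group)
  show "fmap (E n) P P (idt orb P) c = c" if "c \<in> carrier (fobj (E n) P)" for c
    unfolding E_simps by (rule push_ident) (use that P pull_idt in \<open>auto simp: E_simps\<close>)
  fix Q S assume Q: "Q \<in> Ob orb" and S: "S \<in> Mor orb P Q"
  show "fmap (E n) P Q S \<in> hom (fobj (E n) Q) (fobj (E n) P)"
    unfolding E_simps using pull_tuples[OF P Q S] by (rule push_in_hom)
  fix N U c assume N: "N \<in> Ob orb" and U: "U \<in> Mor orb Q N" and c: "c \<in> carrier (fobj (E n) N)"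
  show "fmap (E n) P N (cmp orb U S) c = fmap (E n) P Q S (fmap (E n) Q N U c)"
    unfolding E_simps push_push
    by (rule push_cong) (use c pull_cmp[OF P Q N S U] in \<open>auto simp: E_simps\<close>)
qed

lemma nat_trans_E_eqI:
  assumes F: "cmodule orb F" and \<phi>: "nat_trans orb (E n) F \<phi>" and \<psi>: "nat_trans orb (E n) F \<psi>"
    and P: "P \<in> Ob orb" and eq: "\<And>a. a \<in> tuples n P \<Longrightarrow> \<phi> P (frag_of a) = \<psi> P (frag_of a)"
    and c: "c \<in> carrier (fobj (E n) P)"
  shows "\<phi> P c = \<psi> P c"
proof (rule free_Abelian_group_hom_eq[OF cmodule.fobj_group[OF F P]])
  show "\<phi> P \<in> hom (free_Abelian_group (tuples n P)) (fobj F P)"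
    using nat_trans_hom[OF \<phi> P] by (simp add: E_simps)
  show "\<psi> P \<in> hom (free_Abelian_group (tuples n P)) (fobj F P)"
    using nat_trans_hom[OF \<psi> P] by (simp add: E_simps)
  show "keys c \<subseteq> tuples n P" using c by (simp add: E_simps)
qed (rule eq)

lemma nat_trans_E_exists:
  assumes F: "cmodule orb F"
    and y: "\<And>P a. P \<in> Ob orb \<Longrightarrow> a \<in> tuples n P \<Longrightarrow> y P a \<in> carrier (fobj F P)"
    and nat: "\<And>P Q S a. P \<in> Ob orb \<Longrightarrow> Q \<in> Ob orb \<Longrightarrow> S \<in> Mor orb P Q \<Longrightarrow> a \<in> tuples n Q
      \<Longrightarrow> y P (pull S a) = fmap F P Q S (y Q a)"
  obtains \<phi> where "nat_trans orb (E n) F \<phi>"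
    "\<And>P a. P \<in> Ob orb \<Longrightarrow> a \<in> tuples n P \<Longrightarrow> \<phi> P (frag_of a) = y P a"
proof -
  have "\<exists>h. h \<in> hom (free_Abelian_group (tuples n P)) (fobj F P) \<and> (\<forall>a\<in>tuples n P. h (frag_of a) = y P a)"
    if P: "P \<in> Ob orb" for P
  proof -
    interpret F: comm_group "fobj F P" using F P by (rule cmodule.fobj_group)
    have "y P ` tuples n P \<subseteq> carrier (fobj F P)" using y[OF P] by auto
    from F.free_Abelian_group_universal[OF this] show ?thesis by metis
  qed
  then obtain \<phi> where \<phi>: "\<And>P. P \<in> Ob orb \<Longrightarrow> \<phi> P \<in> hom (free_Abelian_group (tuples n P)) (fobj F P)"
    "\<And>P a. P \<in> Ob orb \<Longrightarrow> a \<in> tuples n P \<Longrightarrow> \<phi> P (frag_of a) = y P a"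
    by metis
  have "nat_trans orb (E n) F \<phi>"
    unfolding nat_trans_def
  proof (intro conjI ballI)
    fix P assume P: "P \<in> Ob orb"
    show "\<phi> P \<in> hom (fobj (E n) P) (fobj F P)" using \<phi>(1)[OF P] by (simp add: E_simps)
    fix Q S c assume Q: "Q \<in> Ob orb" and S: "S \<in> Mor orb P Q" and c: "c \<in> carrier (fobj (E n) Q)"
    have "(\<phi> P \<circ> push (pull S)) c = (fmap F P Q S \<circ> \<phi> Q) c"
    proof (rule free_Abelian_group_hom_eq[OF cmodule.fobj_group[OF F P]])
      show "\<phi> P \<circ> push (pull S) \<in> hom (free_Abelian_group (tuples n Q)) (fobj F P)"
        by (rule Group.hom_compose[OF push_in_hom \<phi>(1)[OF P]]) (rule pull_tuples[OF P Q S])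
      show "fmap F P Q S \<circ> \<phi> Q \<in> hom (free_Abelian_group (tuples n Q)) (fobj F P)"
        using \<phi>(1)[OF Q] cmodule.fmap_hom[OF F P Q S] by (rule Group.hom_compose)
      show "(\<phi> P \<circ> push (pull S)) (frag_of a) = (fmap F P Q S \<circ> \<phi> Q) (frag_of a)" if "a \<in> tuples n Q" for a
        using that \<phi>(2) P Q nat[OF P Q S that] pull_tuples[OF P Q S that] by simp
      show "keys c \<subseteq> tuples n Q" using c by (simp add: E_simps)
    qed
    then show "\<phi> P (fmap (E n) P Q S c) = fmap F P Q S (\<phi> Q c)" by (simp add: E_simps)
  qed
  then show ?thesis using \<phi>(2) that by blast
qed

lemma bd_tuples: "a \<in> tuples (Suc n) P \<Longrightarrow> keys (bd a :: _ \<Rightarrow>\<^sub>0 int) \<subseteq> tuples n P"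
  using keys_bd by (fastforce simp: tuples_def)

lemma bd_closed: "c \<in> carrier (fobj (E (Suc n)) P) \<Longrightarrow> lext bd c \<in> carrier (fobj (E n) P)"
  unfolding E_simps carrier_free_Abelian_group_iff using bd_tuples by (intro keys_lext_subset) blast

lemma nat_trans_bd: "nat_trans orb (E (Suc n)) (E n) (\<lambda>P. lext bd)"
  unfolding nat_trans_def
proof (intro conjI ballI homI)
  fix P Q S c assume "P \<in> Ob orb" "Q \<in> Ob orb" "S \<in> Mor orb P Q"
  show "lext bd (fmap (E (Suc n)) P Q S c) = fmap (E n) P Q S (lext bd c)"
    by (simp add: E_simps pull_def push_map_lext_bd)
qed (use bd_closed in \<open>auto simp: E_simps lext_add\<close>)

lemma cone_closed: "u \<in> Fix P \<Longrightarrow> c \<in> carrier (fobj (E n) P) \<Longrightarrow> push ((#) u) c \<in> carrier (fobj (E (Suc n)) P)"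
  using keys_push[of "(#) u" c] by (fastforce simp: E_simps tuples_def)

definition pt :: "'a set \<Rightarrow> 't" where
  "pt P = (SOME t. t \<in> Fix P)"

lemma pt:
  assumes "P \<in> Ob orb"
  shows "pt P \<in> Fix P"
proof -
  have "\<exists>t. t \<in> Fix P" using fixed_points[of P] assms unfolding Ob_iff Fix_def by blast
  then show ?thesis unfolding pt_def by (rule someI_ex)
qed

text \<open>The isotropy group of a nonempty list is an object, so that \<open>E n\<close> is a sum of representable
  functors, one for every orbit, if \<open>n > 0\<close>.\<close>

lemma E_projective:
  assumes A: "cmodule orb A" and B: "cmodule orb B" and \<theta>: "nat_trans orb A B \<theta>"
    and \<phi>: "nat_trans orb (E (Suc n)) B \<phi>"
    and surj: "\<And>P c. P \<in> Ob orb \<Longrightarrow> c \<in> carrier (fobj (E (Suc n)) P) \<Longrightarrow> \<phi> P c \<in> \<theta> P ` carrier (fobj A P)"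
  obtains \<psi> where "nat_trans orb (E (Suc n)) A \<psi>"
    "\<And>P c. P \<in> Ob orb \<Longrightarrow> c \<in> carrier (fobj (E (Suc n)) P) \<Longrightarrow> \<theta> P (\<psi> P c) = \<phi> P c"
proof -
  define I where "I a = stab (carrier G) a" for a
  have GG: "subgroup (carrier G) G" by (rule subgroup_self)
  have I_Ob: "I a \<in> Ob orb" if "set a \<subseteq> T" "length a = Suc n" for a
    unfolding Ob_iff I_def using that by (intro psub_stab GG) auto
  have I_tuple: "a \<in> tuples (Suc n) (I a)" if "set a \<subseteq> T" "length a = Suc n" for a
    using that by (auto simp: tuples_def Fix_def I_def stab_def)
  have "\<phi> (I a) (frag_of a) \<in> \<theta> (I a) ` carrier (fobj A (I a))" if "set a \<subseteq> T" "length a = Suc n" for a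
    using surj[OF I_Ob[OF that], of "frag_of a"] I_tuple[OF that] by (simp add: E_simps)
  then have "\<exists>y. set a \<subseteq> T \<longrightarrow> length a = Suc n \<longrightarrow>
      y \<in> carrier (fobj A (I a)) \<and> \<theta> (I a) y = \<phi> (I a) (frag_of a)" for a
    by (metis imageE)
  then obtain y where y: "\<And>a. set a \<subseteq> T \<Longrightarrow> length a = Suc n \<Longrightarrow> y a \<in> carrier (fobj A (I a))"
    "\<And>a. set a \<subseteq> T \<Longrightarrow> length a = Suc n \<Longrightarrow> \<theta> (I a) (y a) = \<phi> (I a) (frag_of a)"
    by metis
  define r where "r a = (SOME b. rel (carrier G) a b)" for a
  \<comment> \<open>All group elements carrying \<open>a\<close> to its representative. They form a
    coset of \<open>I (r a)\<close>, hence a morphism to \<open>I (r a)\<close> from every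
    \<open>P\<close> that fixes \<open>a\<close>, and it pulls \<open>r a\<close> back to
    \<open>a\<close>.\<close>
  define S where "S a = {g \<in> carrier G. mact g a = r a}" for a
  have r_rel: "rel (carrier G) a (r a)" for a
    unfolding r_def by (rule someI[of _ a]) (simp add: rel_def)
  have r_eq: "r (mact g a) = r a" if "set a \<subseteq> T" "g \<in> carrier G" for g a
  proof -
    have "rel (carrier G) a (mact g a)" using that by (intro relI) auto
    then have "rel (carrier G) a = rel (carrier G) (mact g a)"
      using equivp_rel[OF GG] by (simp add: equivp_def)
    then show ?thesis by (simp add: r_def)
  qed
  have S_ex: "\<exists>g. g \<in> S a" if "set a \<subseteq> T" for a
  proof (cases "a = r a")
    case True
    then have "mact \<one> a = r a" using mact_one[OF that] by simp
    then show ?thesis unfolding S_def by blast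
  next
    case False
    then show ?thesis using r_rel[of a] unfolding rel_def S_def by blast
  qed
  have r_T: "set (r a) \<subseteq> T" "length (r a) = Suc n" if a: "set a \<subseteq> T" "length a = Suc n" for a
  proof -
    obtain g where "g \<in> S a" using S_ex[OF a(1)] by blast
    then have "g \<in> carrier G" "r a = mact g a" by (auto simp: S_def)
    then show "set (r a) \<subseteq> T" "length (r a) = Suc n" using mact_closed a by auto
  qed
  have S_coset: "S a = I (r a) #> g" if a: "set a \<subseteq> T" and g: "g \<in> S a" for a g
  proof (intro equalityI subsetI)
    have gG: "g \<in> carrier G" and ga: "mact g a = r a" using g by (auto simp: S_def)
    fix h assume h: "h \<in> S a"
    then have hG: "h \<in> carrier G" and ha: "mact h a = r a" by (auto simp: S_def)
    have "mact (h \<otimes> inv g) (r a) = mact h (mact (inv g) (mact g a))"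
      using mact_mult[of h "inv g" "r a"] gG hG mact_closed[OF gG a] ga by simp
    then have "mact (h \<otimes> inv g) (r a) = r a" unfolding mact_inv[OF gG a] ha .
    then have "\<forall>t\<in>set (r a). act (h \<otimes> inv g) t = t" by (metis list.map_ident map_eq_conv)
    then have "h \<otimes> inv g \<in> I (r a)" using gG hG by (simp add: I_def stab_def)
    then show "h \<in> I (r a) #> g" using gG hG unfolding r_coset_def
      by (auto intro!: bexI[of _ "h \<otimes> inv g"] simp: m_assoc)
  next
    have gG: "g \<in> carrier G" and ga: "mact g a = r a" using g by (auto simp: S_def)
    fix h assume "h \<in> I (r a) #> g"
    then obtain k where k: "k \<in> I (r a)" "h = k \<otimes> g" by (auto simp: r_coset_def)
    then have "k \<in> carrier G" "mact k (r a) = r a" by (auto simp: I_def stab_def intro!: map_idI)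
    then show "h \<in> S a" using k(2) gG mact_mult[of k g a] a ga by (simp add: S_def)
  qed
  have S_Mor: "S a \<in> Mor orb P (I (r a))" if P: "P \<in> Ob orb" and a: "a \<in> tuples (Suc n) P" for a P
  proof -
    have aT: "set a \<subseteq> T" using a by (rule tuplesD)
    obtain g where g: "g \<in> S a" using S_ex[OF aT] by blast
    have gG: "g \<in> carrier G" and ga: "mact g a = r a" using g by (auto simp: S_def)
    have "I (r a) #> g \<in> Mor orb P (I (r a))"
    proof (rule MorI[OF gG])
      fix h assume h: "h \<in> P"
      have hG: "h \<in> carrier G" using Ob_subgroup[OF P] h by (rule subgroup.mem_carrier)
      have "act (g \<otimes> h \<otimes> inv g) (act g t) = act g t" if "t \<in> set a" for t
        using conj_fixes[OF gG hG] that aT a h by (auto simp: tuples_def Fix_def)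
      then show "g \<otimes> h \<otimes> inv g \<in> I (r a)" using gG hG by (auto simp: I_def stab_def simp flip: ga)
    qed
    then show ?thesis using S_coset[OF aT g] by simp
  qed
  have S_pull: "pull (S a) (r a) = a" if P: "P \<in> Ob orb" and a: "a \<in> tuples (Suc n) P" for a P
  proof -
    have aT: "set a \<subseteq> T" "length a = Suc n" using tuplesD[OF a] by auto
    obtain g where g: "g \<in> S a" using S_ex[OF aT(1)] by blast
    have gG: "g \<in> carrier G" and ga: "mact g a = r a" using g by (auto simp: S_def)
    have "pull (S a) (r a) = mact (inv g) (r a)"
      using r_T[OF aT] by (intro pull_eq[OF P I_Ob S_Mor[OF P a] g I_tuple]) auto
    then show ?thesis using mact_inv[OF gG aT(1)] ga by simp
  qed
  have S_cmp: "S (pull U a) = cmp orb (S a) U" if P: "P \<in> Ob orb" "Q \<in> Ob orb" and U: "U \<in> Mor orb P Q"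
    and a: "a \<in> tuples (Suc n) Q" for P Q U a
  proof -
    have aT: "set a \<subseteq> T" "length a = Suc n" using tuplesD[OF a] by auto
    obtain g where g: "g \<in> S a" using S_ex[OF aT(1)] by blast
    have gG: "g \<in> carrier G" and ga: "mact g a = r a" using g by (auto simp: S_def)
    obtain h where h: "h \<in> U" using Mor_nonempty[OF P U] by blast
    have hG: "h \<in> carrier G" using MorD[OF P U h] by simp
    have pa: "pull U a = mact (inv h) a" using P U h a by (rule pull_eq)
    have paT: "set (pull U a) \<subseteq> T" unfolding pa using hG aT by (intro mact_closed) auto
    have rp: "r (pull U a) = r a" unfolding pa using r_eq aT hG by simp
    have "mact (g \<otimes> h) (pull U a) = mact g (mact h (mact (inv h) a))"
      unfolding pa using gG hG aT mact_closed[of "inv h" a] by (intro mact_mult) auto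
    also have "mact h (mact (inv h) a) = a" using mact_inv[of "inv h" a] hG aT by simp
    finally have "g \<otimes> h \<in> S (pull U a)" using gG hG ga rp by (simp add: S_def)
    then have 1: "S (pull U a) = I (r a) #> (g \<otimes> h)" using S_coset[OF paT] rp by simp
    have Ir: "I (r a) \<in> Ob orb" using r_T[OF aT] by (intro I_Ob)
    have "cmp orb (S a) U \<in> Mor orb P (I (r a))"
      by (rule category.cmp_closed[OF category_orb P Ir U S_Mor[OF P(2) a]])
    moreover have "g \<otimes> h \<in> cmp orb (S a) U" using g h by (auto simp: p_orbit_cat_def set_mult_def)
    ultimately have "cmp orb (S a) U = I (r a) #> (g \<otimes> h)" by (rule MorD(2)[OF P(1) Ir])
    then show ?thesis using 1 by simp
  qed
  \<comment> \<open>The lift chosen at \<open>r a\<close> is carried to \<open>P\<close> along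
    \<open>S a\<close>; \<open>S_cmp\<close> is the naturality of this choice.\<close>
  obtain \<psi> where \<psi>: "nat_trans orb (E (Suc n)) A \<psi>"
    "\<And>P a. P \<in> Ob orb \<Longrightarrow> a \<in> tuples (Suc n) P \<Longrightarrow> \<psi> P (frag_of a) = fmap A P (I (r a)) (S a) (y (r a))"
  proof (rule nat_trans_E_exists[OF A])
    fix P a assume P: "P \<in> Ob orb" and a: "a \<in> tuples (Suc n) P"
    have r: "set (r a) \<subseteq> T" "length (r a) = Suc n" using r_T tuplesD[OF a] by auto
    show "fmap A P (I (r a)) (S a) (y (r a)) \<in> carrier (fobj A P)"
      using cmodule.fmap_hom[OF A P I_Ob[OF r] S_Mor[OF P a]] y(1)[OF r] by (auto simp: hom_def)
  next
    fix P Q U a assume P: "P \<in> Ob orb" "Q \<in> Ob orb" and U: "U \<in> Mor orb P Q" and a: "a \<in> tuples (Suc n) Q"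
    have aT: "set a \<subseteq> T" "length a = Suc n" using tuplesD[OF a] by auto
    have r: "set (r a) \<subseteq> T" "length (r a) = Suc n" using r_T aT by auto
    obtain h where h: "h \<in> U" using Mor_nonempty[OF P U] by blast
    have rp: "r (pull U a) = r a"
      using pull_eq[OF P U h a] r_eq[OF aT(1)] MorD(1)[OF P U h] by simp
    show "fmap A P (I (r (pull U a))) (S (pull U a)) (y (r (pull U a)))
        = fmap A P Q U (fmap A Q (I (r a)) (S a) (y (r a)))"
      unfolding rp S_cmp[OF P U a]
      using cmodule.fmap_cmp[OF A P I_Ob[OF r] U S_Mor[OF P(2) a] y(1)[OF r]] .
  qed (use that in blast)
  show ?thesis
  proof (rule that[OF \<psi>(1)])
    fix P c assume P: "P \<in> Ob orb" and c: "c \<in> carrier (fobj (E (Suc n)) P)"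
    show "\<theta> P (\<psi> P c) = \<phi> P c"
    proof (rule nat_trans_E_eqI[OF B nat_trans_comp[OF \<psi>(1) \<theta>] \<phi> P _ c])
      fix a assume a: "a \<in> tuples (Suc n) P"
      have r: "set (r a) \<subseteq> T" "length (r a) = Suc n" using r_T tuplesD[OF a] by auto
      note Ir = I_Ob[OF r] and SM = S_Mor[OF P a]
      have "\<theta> P (\<psi> P (frag_of a)) = fmap B P (I (r a)) (S a) (\<theta> (I (r a)) (y (r a)))"
        using \<psi>(2)[OF P a] nat_trans_nat[OF \<theta> P Ir SM y(1)[OF r]] by simp
      also have "\<dots> = \<phi> P (fmap (E (Suc n)) P (I (r a)) (S a) (frag_of (r a)))"
        using nat_trans_nat[OF \<phi> P Ir SM, of "frag_of (r a)"] I_tuple[OF r] y(2)[OF r] by (simp add: E_simps)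
      also have "\<dots> = \<phi> P (frag_of a)" using S_pull[OF P a] by (simp add: E_simps)
      finally show "\<theta> P (\<psi> P (frag_of a)) = \<phi> P (frag_of a)" .
    qed
  qed
qed

section \<open>Cocycles and exactness of the rows\<close>

definition cocycle :: "nat \<Rightarrow> ('a set, 'a set, 'y) cmod \<Rightarrow> ('a set \<Rightarrow> ('t list \<Rightarrow>\<^sub>0 int) \<Rightarrow> 'y) \<Rightarrow> bool" where
  "cocycle n F \<phi> \<longleftrightarrow> nat_trans orb (E n) F \<phi> \<and>
     (\<forall>P\<in>Ob orb. \<forall>c\<in>carrier (fobj (E (Suc n)) P). \<phi> P (lext bd c) = \<one>\<^bsub>fobj F P\<^esub>)"

lemma cocycleD:
  assumes "cocycle n F \<phi>"
  shows "nat_trans orb (E n) F \<phi>"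
    and "P \<in> Ob orb \<Longrightarrow> c \<in> carrier (fobj (E (Suc n)) P) \<Longrightarrow> \<phi> P (lext bd c) = \<one>\<^bsub>fobj F P\<^esub>"
  using assms by (auto simp: cocycle_def)

lemma E_group_hom: "cmodule orb F \<Longrightarrow> nat_trans orb (E n) F \<phi> \<Longrightarrow> P \<in> Ob orb
    \<Longrightarrow> group_hom (fobj (E n) P) (fobj F P) (\<phi> P)"
  using cmodule_E by (rule nat_trans_group_hom)

lemma E_hom_add:
  assumes "cmodule orb F" "nat_trans orb (E n) F \<phi>" "P \<in> Ob orb"
    "c \<in> carrier (fobj (E n) P)" "d \<in> carrier (fobj (E n) P)"
  shows "\<phi> P (c + d) = \<phi> P c \<otimes>\<^bsub>fobj F P\<^esub> \<phi> P d"
  using group_hom.hom_mult[OF E_group_hom[OF assms(1-3)] assms(4,5)] by (simp add: E_simps)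

text \<open>A cocycle kills the boundary of the cone on \<open>c\<close>. By \<open>bd_cone\<close>
  the remaining argument is the cone on the boundary of \<open>c\<close>, so a cocycle depends on
  this boundary only.\<close>

lemma cocycle_cone:
  assumes F: "cmodule orb F" and \<phi>: "cocycle n F \<phi>" and P: "P \<in> Ob orb" and u: "u \<in> Fix P"
    and c: "c \<in> carrier (fobj (E n) P)"
  shows "\<phi> P c = \<phi> P (c - lext bd (push ((#) u) c))"
proof -
  interpret \<phi>P: group_hom "fobj (E n) P" "fobj F P" "\<phi> P"
    using F cocycleD(1)[OF \<phi>] P by (rule E_group_hom)
  have b: "lext bd (push ((#) u) c) \<in> carrier (fobj (E n) P)" by (intro bd_closed cone_closed u c)
  have d: "c - lext bd (push ((#) u) c) \<in> carrier (fobj (E n) P)"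
    using c b keys_diff[of c "lext bd (push ((#) u) c)"] by (auto simp: E_simps)
  have "\<phi> P c = \<phi> P ((c - lext bd (push ((#) u) c)) + lext bd (push ((#) u) c))" by simp
  also have "\<dots> = \<phi> P (c - lext bd (push ((#) u) c)) \<otimes>\<^bsub>fobj F P\<^esub> \<phi> P (lext bd (push ((#) u) c))"
    using F cocycleD(1)[OF \<phi>] P d b by (rule E_hom_add)
  also have "\<phi> P (lext bd (push ((#) u) c)) = \<one>\<^bsub>fobj F P\<^esub>"
    using \<phi> P cone_closed[OF u c] by (rule cocycleD(2))
  finally show ?thesis using \<phi>P.hom_closed[OF d] by simp
qed

text \<open>Coning with a point of \<open>Fix P\<close> contracts each \<open>E n\<close> at
  \<open>P\<close>, but no choice of points is natural in \<open>P\<close>. On cycles, however, the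
  value of a cocycle at the cone is independent of the point, hence natural; injectivity extends it
  from the cycles \<open>A\<close> to all of \<open>E n\<close>.\<close>

lemma injective_row_exact:
  assumes I: "injective_cmodule orb F" and \<phi>: "cocycle (Suc n) F \<phi>"
  obtains \<psi> where "nat_trans orb (E n) F \<psi>"
    "\<And>P c. P \<in> Ob orb \<Longrightarrow> c \<in> carrier (fobj (E (Suc n)) P) \<Longrightarrow> \<psi> P (lext bd c) = \<phi> P c"
proof -
  have F: "cmodule orb F" using I by (simp add: injective_cmodule_def)
  note \<phi>' = cocycleD(1)[OF \<phi>]
  define Z where "Z P = {c \<in> carrier (fobj (E n) P). lext bd c = (0 :: _ \<Rightarrow>\<^sub>0 int)}" for P
  define A where "A = \<lparr>fobj = (\<lambda>P. (fobj (E n) P)\<lparr>carrier := Z P\<rparr>), fmap = fmap (E n)\<rparr>"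
  define \<chi> where "\<chi> P c = \<phi> P (push ((#) (pt P)) c)" for P c
  have cone: "push ((#) u) c \<in> carrier (fobj (E (Suc n)) P)" if "c \<in> Z P" "u \<in> Fix P" for c P u
    using that cone_closed by (simp add: Z_def)
  \<comment> \<open>The difference of two cones on a cycle is itself a cycle, and a cocycle vanishes
    on cycles by \<open>cocycle_cone\<close>.\<close>
  have \<chi>_eq: "\<chi> P c = \<phi> P (push ((#) u) c)" if P: "P \<in> Ob orb" and c: "c \<in> Z P" and u: "u \<in> Fix P" for P c u
  proof -
    let ?d = "push ((#) (pt P)) c - push ((#) u) c"
    note c1 = cone[OF c pt[OF P]] and c2 = cone[OF c u]
    have d: "?d \<in> carrier (fobj (E (Suc n)) P)"
      using c1 c2 keys_diff[of "push ((#) (pt P)) c" "push ((#) u) c"] by (auto simp: E_simps)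
    have bd_d: "lext bd ?d = 0" using c by (simp add: lext_diff bd_cone Z_def)
    interpret \<phi>P: group_hom "fobj (E (Suc n)) P" "fobj F P" "\<phi> P" using F \<phi>' P by (rule E_group_hom)
    have "\<phi> P ?d = \<phi> P 0"
      using cocycle_cone[OF F \<phi> P u d] by (simp add: bd_cone bd_d)
    then have "\<phi> P ?d = \<one>\<^bsub>fobj F P\<^esub>" using \<phi>P.hom_one by (simp add: E_simps)
    moreover have "\<phi> P (?d + push ((#) u) c) = \<phi> P ?d \<otimes>\<^bsub>fobj F P\<^esub> \<phi> P (push ((#) u) c)"
      using F \<phi>' P d c2 by (rule E_hom_add)
    ultimately show ?thesis using \<phi>P.hom_closed[OF c2] by (simp add: \<chi>_def)
  qed
  have Z_map: "push (pull S) c \<in> Z P"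
    if "P \<in> Ob orb" "Q \<in> Ob orb" "S \<in> Mor orb P Q" "c \<in> Z Q" for P Q S c
  proof -
    have "fmap (E n) P Q S c \<in> carrier (fobj (E n) P)"
      using cmodule.fmap_hom[OF cmodule_E that(1-3), of n] that(4) by (auto simp: hom_def Z_def)
    moreover have "lext bd (push (pull S) c) = 0"
      using that(4) by (simp add: Z_def pull_def flip: push_map_lext_bd)
    ultimately show ?thesis by (simp add: Z_def E_simps)
  qed
  have A: "cmodule orb A"
  proof (intro cmodule.intro cmodule_axioms.intro category_orb)
    fix P assume P: "P \<in> Ob orb"
    show "comm_group (fobj A P)"
    proof (rule comm_groupI)
      fix c assume "c \<in> carrier (fobj A P)"
      then show "\<exists>d\<in>carrier (fobj A P). d \<otimes>\<^bsub>fobj A P\<^esub> c = \<one>\<^bsub>fobj A P\<^esub>"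
        by (intro bexI[of _ "- c"]) (auto simp: A_def Z_def E_simps lext_minus)
    next
      fix c d assume "c \<in> carrier (fobj A P)" "d \<in> carrier (fobj A P)"
      then show "c \<otimes>\<^bsub>fobj A P\<^esub> d \<in> carrier (fobj A P)"
        using Poly_Mapping.keys_add[of c d] by (auto simp: A_def Z_def E_simps lext_add)
    qed (auto simp: A_def Z_def E_simps algebra_simps)
    show "fmap A P P (idt orb P) c = c" if "c \<in> carrier (fobj A P)" for c
      using cmodule.fmap_idt[OF cmodule_E P] that by (simp add: A_def Z_def)
    fix Q S assume Q: "Q \<in> Ob orb" and S: "S \<in> Mor orb P Q"
    show "fmap A P Q S \<in> hom (fobj A Q) (fobj A P)"
      using Z_map[OF P Q S] by (auto simp: A_def hom_def E_simps push_add)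
    fix N U c assume N: "N \<in> Ob orb" and U: "U \<in> Mor orb Q N" and c: "c \<in> carrier (fobj A N)"
    show "fmap A P N (cmp orb U S) c = fmap A P Q S (fmap A Q N U c)"
      using cmodule.fmap_cmp[OF cmodule_E P Q N S U] c by (simp add: A_def Z_def)
  qed
  have \<chi>: "nat_trans orb A F \<chi>"
    unfolding nat_trans_def
  proof (intro conjI ballI homI)
    fix P c assume P: "P \<in> Ob orb" and "c \<in> carrier (fobj A P)"
    then have c: "c \<in> Z P" by (simp add: A_def)
    show "\<chi> P c \<in> carrier (fobj F P)"
      using nat_trans_closed[OF \<phi>' P cone[OF c pt[OF P]]] by (simp add: \<chi>_def)
    fix d assume "d \<in> carrier (fobj A P)"
    then have d: "d \<in> Z P" by (simp add: A_def)
    show "\<chi> P (c \<otimes>\<^bsub>fobj A P\<^esub> d) = \<chi> P c \<otimes>\<^bsub>fobj F P\<^esub> \<chi> P d"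
      using E_hom_add[OF F \<phi>' P cone[OF c pt[OF P]] cone[OF d pt[OF P]]]
      by (simp add: \<chi>_def A_def E_simps push_add)
  next
    fix P Q S c assume P: "P \<in> Ob orb" and Q: "Q \<in> Ob orb" and S: "S \<in> Mor orb P Q"
      and "c \<in> carrier (fobj A Q)"
    then have c: "c \<in> Z Q" by (simp add: A_def)
    \<comment> \<open>The translate of \<open>pt Q\<close> is a point fixed by \<open>P\<close>, in
      general different from \<open>pt P\<close>; \<open>\<chi>_eq\<close> allows it as cone
      point.\<close>
    define u where "u = act (inv (SOME g. g \<in> S)) (pt Q)"
    have "[pt Q] \<in> tuples 1 Q" using pt[OF Q] by (simp add: tuples_def)
    then have "pull S [pt Q] \<in> tuples 1 P" by (rule pull_tuples[OF P Q S])
    then have u: "u \<in> Fix P" by (simp add: tuples_def pull_def u_def)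
    have "\<chi> P (push (pull S) c) = \<phi> P (push ((#) u) (push (pull S) c))"
      using P Z_map[OF P Q S c] u by (rule \<chi>_eq)
    also have "push ((#) u) (push (pull S) c) = fmap (E (Suc n)) P Q S (push ((#) (pt Q)) c)"
      by (simp add: E_simps push_push pull_def u_def)
    also have "\<phi> P \<dots> = fmap F P Q S (\<chi> Q c)"
      using nat_trans_nat[OF \<phi>' P Q S cone[OF c pt[OF Q]]] by (simp add: \<chi>_def)
    finally show "\<chi> P (fmap A P Q S c) = fmap F P Q S (\<chi> Q c)" by (simp add: A_def E_simps)
  qed
  have "nat_trans orb A (E n) (\<lambda>P c. c)"
    by (auto simp: nat_trans_def A_def Z_def hom_def)
  from injective_cmodule_extends[OF A cmodule_E I this _ \<chi>]
  obtain \<psi> where \<psi>: "nat_trans orb (E n) F \<psi>" "\<And>P c. P \<in> Ob orb \<Longrightarrow> c \<in> carrier (fobj A P) \<Longrightarrow> \<psi> P c = \<chi> P c"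
    by (auto simp: inj_on_def)
  show ?thesis
  proof (rule that[OF \<psi>(1)])
    fix P c assume P: "P \<in> Ob orb" and c: "c \<in> carrier (fobj (E (Suc n)) P)"
    have "lext bd c \<in> Z P" using bd_closed[OF c] by (simp add: Z_def)
    then have "\<psi> P (lext bd c) = \<phi> P (push ((#) (pt P)) (lext bd c))"
      using \<psi>(2)[OF P] by (simp add: A_def \<chi>_def)
    also have "\<dots> = \<phi> P c"
      using cocycle_cone[OF F \<phi> P pt[OF P] c] by (simp add: bd_cone)
    finally show "\<psi> P (lext bd c) = \<phi> P c" .
  qed
qed

lemma nat_trans_comp_bd: "nat_trans orb (E n) F \<phi> \<Longrightarrow> nat_trans orb (E (Suc n)) F (\<lambda>P c. \<phi> P (lext bd c))"
  by (rule nat_trans_comp[OF nat_trans_bd])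

lemma cocycle_comp_bd:
  assumes F: "cmodule orb F" and \<phi>: "nat_trans orb (E n) F \<phi>"
  shows "cocycle (Suc n) F (\<lambda>P c. \<phi> P (lext bd c))"
proof -
  have "\<phi> P 0 = \<one>\<^bsub>fobj F P\<^esub>" if "P \<in> Ob orb" for P
    using group_hom.hom_one[OF E_group_hom[OF F \<phi> that]] by (simp add: E_simps)
  then show ?thesis using nat_trans_comp_bd[OF \<phi>] by (simp add: cocycle_def)
qed

text \<open>The double complex of the groups of natural transformations from \<open>E n\<close> to \<open>I j\<close>: its rows are
  exact since \<open>I j\<close> is injective, and its columns for \<open>n > 0\<close> are exact since \<open>E n\<close> is projective.
  Cocycles with values in \<open>F\<close> thus determine its cohomology.\<close>

context
  fixes F :: "('a set, 'a set, 'x) cmod" and I :: "nat \<Rightarrow> ('a set, 'a set, 'y) cmod" and \<delta> \<epsilon>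
  assumes res: "injective_resolution orb F I \<delta> \<epsilon>"
    and cocycle_F: "\<And>n f. cocycle (Suc n) F f \<Longrightarrow> \<exists>x. nat_trans orb (E n) F x \<and>
      (\<forall>P\<in>Ob orb. \<forall>c\<in>carrier (fobj (E (Suc n)) P). f P c = x P (lext bd c))"
begin

interpretation R: injective_resolution orb F I \<delta> \<epsilon> by (rule res)

lemma I_cmodule: "cmodule orb (I j)"
  using R.injective[of j] by (simp add: injective_cmodule_def)

lemma \<delta>_group_hom: "P \<in> Ob orb \<Longrightarrow> group_hom (fobj (I j) P) (fobj (I (Suc j)) P) (\<delta> j P)"
  by (rule nat_trans_group_hom[OF I_cmodule I_cmodule R.diff_nat])

lemma \<delta>_\<delta>:
  assumes "P \<in> Ob orb" "x \<in> carrier (fobj (I j) P)"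
  shows "\<delta> (Suc j) P (\<delta> j P x) = \<one>\<^bsub>fobj (I (Suc (Suc j))) P\<^esub>"
  using R.exact_Suc[OF assms(1), of j] assms(2) by (auto simp: kernel_def)

text \<open>Projectivity lifts \<open>z\<close> through \<epsilon>; since \<epsilon> is injective
  the lift is again a cocycle, now with values in \<open>F\<close>, where positive cohomology
  vanishes by \<open>cocycle_F\<close>.\<close>

lemma resolution_row_0:
  assumes z: "cocycle (Suc n) (I 0) z"
    and \<delta>z: "\<And>P c. P \<in> Ob orb \<Longrightarrow> c \<in> carrier (fobj (E (Suc n)) P) \<Longrightarrow> \<delta> 0 P (z P c) = \<one>\<^bsub>fobj (I 1) P\<^esub>"
  obtains x where "nat_trans orb (E n) F x"
    "\<And>P c. P \<in> Ob orb \<Longrightarrow> c \<in> carrier (fobj (E (Suc n)) P) \<Longrightarrow> z P c = \<epsilon> P (x P (lext bd c))"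
proof -
  note z' = cocycleD(1)[OF z]
  have "z P c \<in> \<epsilon> P ` carrier (fobj F P)" if "P \<in> Ob orb" "c \<in> carrier (fobj (E (Suc n)) P)" for P c
    using R.exact_0[OF that(1)] \<delta>z[OF that] nat_trans_closed[OF z' that] by (simp add: kernel_def)
  then obtain f where f: "nat_trans orb (E (Suc n)) F f"
    "\<And>P c. P \<in> Ob orb \<Longrightarrow> c \<in> carrier (fobj (E (Suc n)) P) \<Longrightarrow> \<epsilon> P (f P c) = z P c"
    using E_projective[OF R.cmodule_axioms I_cmodule R.aug_nat z'] by blast
  have "cocycle (Suc n) F f"
    unfolding cocycle_def
  proof (intro conjI ballI f(1))
    fix P c assume P: "P \<in> Ob orb" and c: "c \<in> carrier (fobj (E (Suc (Suc n))) P)"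
    interpret \<epsilon>: group_hom "fobj F P" "fobj (I 0) P" "\<epsilon> P"
      using R.cmodule_axioms I_cmodule R.aug_nat P by (rule nat_trans_group_hom)
    have "\<epsilon> P (f P (lext bd c)) = \<epsilon> P \<one>\<^bsub>fobj F P\<^esub>"
      using f(2)[OF P bd_closed[OF c]] cocycleD(2)[OF z P c] by simp
    then show "f P (lext bd c) = \<one>\<^bsub>fobj F P\<^esub>"
      by (rule inj_onD[OF R.aug_inj[OF P] _ nat_trans_closed[OF f(1) P bd_closed[OF c]] \<epsilon>.G.one_closed])
  qed
  then obtain x where "nat_trans orb (E n) F x"
    "\<forall>P\<in>Ob orb. \<forall>c\<in>carrier (fobj (E (Suc n)) P). f P c = x P (lext bd c)"
    using cocycle_F by blast
  then show ?thesis using f(2) that by (metis (no_types, lifting))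
qed

text \<open>Vanishing of positive cohomology with coefficients in the kernel of
  \<open>\<delta> j\<close>, expressed inside \<open>I j\<close> without forming the kernel as a
  module: both the cocycle and its primitive are killed by \<open>\<delta> j\<close>.\<close>

definition row_exact :: "nat \<Rightarrow> bool" where
  "row_exact j \<longleftrightarrow> (\<forall>n z. cocycle (Suc n) (I j) z \<longrightarrow>
      (\<forall>P\<in>Ob orb. \<forall>c\<in>carrier (fobj (E (Suc n)) P). \<delta> j P (z P c) = \<one>\<^bsub>fobj (I (Suc j)) P\<^esub>) \<longrightarrow>
      (\<exists>f. nat_trans orb (E n) (I j) f \<and> (\<forall>P\<in>Ob orb. \<forall>c\<in>carrier (fobj (E n) P). \<delta> j P (f P c) = \<one>\<^bsub>fobj (I (Suc j)) P\<^esub>) \<and>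
        (\<forall>P\<in>Ob orb. \<forall>c\<in>carrier (fobj (E (Suc n)) P). z P c = f P (lext bd c))))"

text \<open>Dimension shifting, written additively. Lift \<open>z = \<delta> y\<close> by
  projectivity; \<open>y \<partial>\<close> takes values in the kernel of \<open>\<delta> j\<close>,
  so by \<open>IH\<close> it equals \<open>f \<partial>\<close> with \<open>\<delta> f = 0\<close>.
  Then \<open>y - f\<close> is a cocycle in the injective \<open>I j\<close>, hence of the form
  \<open>u \<partial>\<close>, and \<open>z = \<delta> (y - f)\<close>.\<close>

lemma resolution_row_Suc:
  assumes IH: "row_exact j"
    and z: "cocycle (Suc n) (I (Suc j)) z"
    and \<delta>z: "\<And>P c. P \<in> Ob orb \<Longrightarrow> c \<in> carrier (fobj (E (Suc n)) P) \<Longrightarrow> \<delta> (Suc j) P (z P c) = \<one>\<^bsub>fobj (I (Suc (Suc j))) P\<^esub>"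
  obtains u where "nat_trans orb (E n) (I j) u"
    "\<And>P c. P \<in> Ob orb \<Longrightarrow> c \<in> carrier (fobj (E (Suc n)) P) \<Longrightarrow> z P c = \<delta> j P (u P (lext bd c))"
proof -
  note z' = cocycleD(1)[OF z]
  have "z P c \<in> \<delta> j P ` carrier (fobj (I j) P)" if "P \<in> Ob orb" "c \<in> carrier (fobj (E (Suc n)) P)" for P c
    using R.exact_Suc[OF that(1)] \<delta>z[OF that] nat_trans_closed[OF z' that] by (simp add: kernel_def)
  then obtain y where y: "nat_trans orb (E (Suc n)) (I j) y"
    "\<And>P c. P \<in> Ob orb \<Longrightarrow> c \<in> carrier (fobj (E (Suc n)) P) \<Longrightarrow> \<delta> j P (y P c) = z P c"
    using E_projective[OF I_cmodule I_cmodule R.diff_nat z'] by blast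
  have "cocycle (Suc (Suc n)) (I j) (\<lambda>P c. y P (lext bd c))"
    using I_cmodule y(1) by (rule cocycle_comp_bd)
  moreover have "\<delta> j P (y P (lext bd c)) = \<one>\<^bsub>fobj (I (Suc j)) P\<^esub>"
    if "P \<in> Ob orb" "c \<in> carrier (fobj (E (Suc (Suc n))) P)" for P c
    using y(2)[OF that(1) bd_closed[OF that(2)]] cocycleD(2)[OF z that] by simp
  ultimately obtain f where f: "nat_trans orb (E (Suc n)) (I j) f"
    "\<And>P c. P \<in> Ob orb \<Longrightarrow> c \<in> carrier (fobj (E (Suc n)) P) \<Longrightarrow> \<delta> j P (f P c) = \<one>\<^bsub>fobj (I (Suc j)) P\<^esub>"
    "\<And>P c. P \<in> Ob orb \<Longrightarrow> c \<in> carrier (fobj (E (Suc (Suc n))) P) \<Longrightarrow> y P (lext bd c) = f P (lext bd c)"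
    using IH[unfolded row_exact_def, rule_format, of "Suc n" "\<lambda>P c. y P (lext bd c)"] by blast
  define w where "w P c = y P c \<otimes>\<^bsub>fobj (I j) P\<^esub> inv\<^bsub>fobj (I j) P\<^esub> f P c" for P c
  have w: "cocycle (Suc n) (I j) w"
    unfolding cocycle_def
  proof (intro conjI ballI)
    show "nat_trans orb (E (Suc n)) (I j) w"
      unfolding w_def using cmodule_E I_cmodule y(1) f(1) by (rule nat_trans_diff)
    fix P c assume P: "P \<in> Ob orb" and c: "c \<in> carrier (fobj (E (Suc (Suc n))) P)"
    interpret A: comm_group "fobj (I j) P" using I_cmodule P by (rule cmodule.fobj_group)
    show "w P (lext bd c) = \<one>\<^bsub>fobj (I j) P\<^esub>"
      using f(3)[OF P c] nat_trans_closed[OF f(1) P bd_closed[OF c]] by (simp add: w_def)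
  qed
  obtain u where u: "nat_trans orb (E n) (I j) u"
    "\<And>P c. P \<in> Ob orb \<Longrightarrow> c \<in> carrier (fobj (E (Suc n)) P) \<Longrightarrow> u P (lext bd c) = w P c"
    using injective_row_exact[OF R.injective w] by blast
  show ?thesis
  proof (rule that[OF u(1)])
    fix P c assume P: "P \<in> Ob orb" and c: "c \<in> carrier (fobj (E (Suc n)) P)"
    interpret d: group_hom "fobj (I j) P" "fobj (I (Suc j)) P" "\<delta> j P" using P by (rule \<delta>_group_hom)
    have "y P c \<in> carrier (fobj (I j) P)" "f P c \<in> carrier (fobj (I j) P)"
      using nat_trans_closed[OF y(1) P c] nat_trans_closed[OF f(1) P c] .
    then have "\<delta> j P (w P c) = z P c"
      using y(2)[OF P c] f(2)[OF P c] nat_trans_closed[OF z' P c] by (simp add: w_def)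
    then show "z P c = \<delta> j P (u P (lext bd c))" using u(2)[OF P c] by simp
  qed
qed

lemma resolution_row: "row_exact j"
proof (induction j)
  case 0
  show ?case
    unfolding row_exact_def
  proof (intro allI impI)
    fix n z
    assume z: "cocycle (Suc n) (I 0) z"
      and "\<forall>P\<in>Ob orb. \<forall>c\<in>carrier (fobj (E (Suc n)) P). \<delta> 0 P (z P c) = \<one>\<^bsub>fobj (I (Suc 0)) P\<^esub>"
    then obtain x where x: "nat_trans orb (E n) F x"
      "\<And>P c. P \<in> Ob orb \<Longrightarrow> c \<in> carrier (fobj (E (Suc n)) P) \<Longrightarrow> z P c = \<epsilon> P (x P (lext bd c))"
      using resolution_row_0[OF z] by auto
    have "\<delta> 0 P (\<epsilon> P (x P c)) = \<one>\<^bsub>fobj (I (Suc 0)) P\<^esub>"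
      if "P \<in> Ob orb" "c \<in> carrier (fobj (E n) P)" for P c
      using R.exact_0[OF that(1)] nat_trans_closed[OF x(1) that] by (auto simp: kernel_def)
    then show "\<exists>f. nat_trans orb (E n) (I 0) f \<and> (\<forall>P\<in>Ob orb. \<forall>c\<in>carrier (fobj (E n) P). \<delta> 0 P (f P c) = \<one>\<^bsub>fobj (I (Suc 0)) P\<^esub>) \<and>
        (\<forall>P\<in>Ob orb. \<forall>c\<in>carrier (fobj (E (Suc n)) P). z P c = f P (lext bd c))"
      using nat_trans_comp[OF x(1) R.aug_nat] x(2) by (intro exI[of _ "\<lambda>P c. \<epsilon> P (x P c)"]) auto
  qed
next
  case (Suc j)
  show ?case
    unfolding row_exact_def
  proof (intro allI impI)
    fix n z
    assume z: "cocycle (Suc n) (I (Suc j)) z"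
      "\<forall>P\<in>Ob orb. \<forall>c\<in>carrier (fobj (E (Suc n)) P). \<delta> (Suc j) P (z P c) = \<one>\<^bsub>fobj (I (Suc (Suc j))) P\<^esub>"
    obtain u where u: "nat_trans orb (E n) (I j) u"
      "\<And>P c. P \<in> Ob orb \<Longrightarrow> c \<in> carrier (fobj (E (Suc n)) P) \<Longrightarrow> z P c = \<delta> j P (u P (lext bd c))"
      using resolution_row_Suc[OF Suc z(1)] z(2) by blast
    then show "\<exists>f. nat_trans orb (E n) (I (Suc j)) f \<and> (\<forall>P\<in>Ob orb. \<forall>c\<in>carrier (fobj (E n) P). \<delta> (Suc j) P (f P c) = \<one>\<^bsub>fobj (I (Suc (Suc j))) P\<^esub>) \<and>
        (\<forall>P\<in>Ob orb. \<forall>c\<in>carrier (fobj (E (Suc n)) P). z P c = f P (lext bd c))"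
      using nat_trans_comp[OF u(1) R.diff_nat] \<delta>_\<delta> nat_trans_closed[OF u(1)]
      by (intro exI[of _ "\<lambda>P c. \<delta> j P (u P c)"]) auto
  qed
qed

text \<open>Elements of the inverse limit are transformations from \<open>E 0\<close>, the constant functor \<open>\<int>\<close>.\<close>

lemma tuples_0: "tuples 0 P = {[]}"
  by (auto simp: tuples_def)

lemma lim_nat_trans:
  assumes A: "cmodule orb A" and x: "x \<in> carrier (inv_lim orb A)"
  obtains \<phi> where "nat_trans orb (E 0) A \<phi>" "\<And>P. P \<in> Ob orb \<Longrightarrow> \<phi> P (frag_of []) = x P"
proof (rule nat_trans_E_exists[OF A, of 0 "\<lambda>P a. x P"])
  show "x P \<in> carrier (fobj A P)" if "P \<in> Ob orb" for P
    using x that by (auto simp: inv_lim_def)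
  show "x P = fmap A P Q S (x Q)" if "P \<in> Ob orb" "Q \<in> Ob orb" "S \<in> Mor orb P Q" for P Q S
    using x that by (auto simp: inv_lim_def)
qed (use that in \<open>auto simp: tuples_0\<close>)

lemma nat_trans_lim:
  assumes \<phi>: "nat_trans orb (E 0) A \<phi>"
  shows "(\<lambda>P\<in>Ob orb. \<phi> P (frag_of [])) \<in> carrier (inv_lim orb A)"
proof -
  have c: "frag_of [] \<in> carrier (fobj (E 0) P)" for P by (simp add: E_simps tuples_0)
  have "fmap A P Q S (\<phi> Q (frag_of [])) = \<phi> P (frag_of [])"
    if "P \<in> Ob orb" "Q \<in> Ob orb" "S \<in> Mor orb P Q" for P Q S
    using nat_trans_nat[OF \<phi> that c] by (simp add: E_simps pull_def)
  then show ?thesis using nat_trans_closed[OF \<phi> _ c] by (auto simp: inv_lim_def)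
qed

text \<open>The boundary of a one-point list is the empty list, and \<open>pt P\<close> supplies
  such a list at every object; so the augmentation is onto and can be cancelled.\<close>

lemma cocycle_0_eq:
  assumes A: "cmodule orb A" and \<phi>: "nat_trans orb (E 0) A \<phi>" and \<psi>: "nat_trans orb (E 0) A \<psi>"
    and eq: "\<And>P c. P \<in> Ob orb \<Longrightarrow> c \<in> carrier (fobj (E 1) P) \<Longrightarrow> \<phi> P (lext bd c) = \<psi> P (lext bd c)"
    and P: "P \<in> Ob orb"
  shows "\<phi> P (frag_of []) = \<psi> P (frag_of [])"
proof -
  have "[pt P] \<in> tuples 1 P" using pt[OF P] by (simp add: tuples_def)
  then have "frag_of [pt P] \<in> carrier (fobj (E 1) P)" by (simp add: E_simps)
  from eq[OF P this] show ?thesis by simp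
qed

text \<open>Precomposed with the augmentation \<open>E 1 \<rightarrow> E 0\<close>, the
  transformation given by \<open>x\<close> becomes a cocycle of positive degree, to which
  \<open>resolution_row_Suc\<close> applies; the augmentation is then cancelled again.\<close>

lemma lim_exact:
  assumes x: "x \<in> carrier (inv_lim orb (I (Suc j)))"
    and \<delta>x: "\<And>P. P \<in> Ob orb \<Longrightarrow> \<delta> (Suc j) P (x P) = \<one>\<^bsub>fobj (I (Suc (Suc j))) P\<^esub>"
  shows "\<exists>u\<in>carrier (inv_lim orb (I j)). \<forall>P\<in>Ob orb. x P = \<delta> j P (u P)"
proof -
  obtain \<phi> where \<phi>: "nat_trans orb (E 0) (I (Suc j)) \<phi>" "\<And>P. P \<in> Ob orb \<Longrightarrow> \<phi> P (frag_of []) = x P"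
    using lim_nat_trans[OF I_cmodule x] by blast
  have \<delta>\<phi>: "\<delta> (Suc j) P (\<phi> P c) = \<one>\<^bsub>fobj (I (Suc (Suc j))) P\<^esub>"
    if P: "P \<in> Ob orb" and c: "c \<in> carrier (fobj (E 0) P)" for P c
  proof -
    have hom: "(\<lambda>_. \<one>\<^bsub>fobj (I (Suc (Suc j))) P\<^esub>) \<in> hom (free_Abelian_group (tuples 0 P)) (fobj (I (Suc (Suc j))) P)"
      using cmodule.fobj_group[OF I_cmodule P, of "Suc (Suc j)"]
      by (auto simp: hom_def comm_group_def intro: group.is_monoid monoid.one_closed dest: group.is_monoid)
    show ?thesis
    proof (rule free_Abelian_group_hom_eq[OF cmodule.fobj_group[OF I_cmodule P] _ hom])
      show "(\<lambda>c. \<delta> (Suc j) P (\<phi> P c)) \<in> hom (free_Abelian_group (tuples 0 P)) (fobj (I (Suc (Suc j))) P)"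
        using nat_trans_hom[OF nat_trans_comp[OF \<phi>(1) R.diff_nat] P] by (simp add: E_simps)
    qed (use c \<delta>x[OF P] \<phi>(2)[OF P] in \<open>auto simp: E_simps tuples_0\<close>)
  qed
  have "cocycle (Suc 0) (I (Suc j)) (\<lambda>P c. \<phi> P (lext bd c))"
    using I_cmodule \<phi>(1) by (rule cocycle_comp_bd)
  then obtain u where u: "nat_trans orb (E 0) (I j) u"
    "\<And>P c. P \<in> Ob orb \<Longrightarrow> c \<in> carrier (fobj (E (Suc 0)) P) \<Longrightarrow> \<phi> P (lext bd c) = \<delta> j P (u P (lext bd c))"
    using resolution_row_Suc[OF resolution_row[of j], of 0 "\<lambda>P c. \<phi> P (lext bd c)"] \<delta>\<phi>[OF _ bd_closed] by blast
  have "x P = \<delta> j P (u P (frag_of []))" if P: "P \<in> Ob orb" for P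
    using cocycle_0_eq[OF I_cmodule \<phi>(1) nat_trans_comp[OF u(1) R.diff_nat] _ P] u(2) \<phi>(2)[OF P] by simp
  then show ?thesis using nat_trans_lim[OF u(1)] by (intro bexI[of _ "\<lambda>P\<in>Ob orb. u P (frag_of [])"]) auto
qed

text \<open>Left exactness of the inverse limit: the preimages under the injective \<epsilon> are
  unique and thus form a compatible family in \<open>F\<close>.\<close>

lemma lim_0_trivial:
  assumes F0: "\<And>x P. x \<in> carrier (inv_lim orb F) \<Longrightarrow> P \<in> Ob orb \<Longrightarrow> x P = \<one>\<^bsub>fobj F P\<^esub>"
    and x: "x \<in> carrier (inv_lim orb (I 0))"
    and \<delta>x: "\<And>P. P \<in> Ob orb \<Longrightarrow> \<delta> 0 P (x P) = \<one>\<^bsub>fobj (I 1) P\<^esub>" and P: "P \<in> Ob orb"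
  shows "x P = \<one>\<^bsub>fobj (I 0) P\<^esub>"
proof -
  have "\<exists>y. y \<in> carrier (fobj F Q) \<and> \<epsilon> Q y = x Q" if Q: "Q \<in> Ob orb" for Q
  proof -
    have "x Q \<in> carrier (fobj (I 0) Q)" using x Q by (auto simp: inv_lim_def)
    then have "x Q \<in> \<epsilon> Q ` carrier (fobj F Q)"
      using R.exact_0[OF Q] \<delta>x[OF Q] by (simp add: kernel_def)
    then obtain y where "x Q = \<epsilon> Q y" "y \<in> carrier (fobj F Q)" by (rule imageE)
    then show ?thesis by (intro exI[of _ y]) simp
  qed
  then obtain y where y: "\<And>Q. Q \<in> Ob orb \<Longrightarrow> y Q \<in> carrier (fobj F Q)" "\<And>Q. Q \<in> Ob orb \<Longrightarrow> \<epsilon> Q (y Q) = x Q"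
    by metis
  have "fmap F Q N S (y N) = y Q" if *: "Q \<in> Ob orb" "N \<in> Ob orb" "S \<in> Mor orb Q N" for Q N S
  proof (rule inj_onD[OF R.aug_inj[OF *(1)]])
    have "\<epsilon> Q (fmap F Q N S (y N)) = fmap (I 0) Q N S (x N)"
      using nat_trans_nat[OF R.aug_nat * y(1)[OF *(2)]] y(2)[OF *(2)] by simp
    also have "\<dots> = x Q" using x * by (auto simp: inv_lim_def)
    finally show "\<epsilon> Q (fmap F Q N S (y N)) = \<epsilon> Q (y Q)" using y(2)[OF *(1)] by simp
    show "fmap F Q N S (y N) \<in> carrier (fobj F Q)"
      using R.fmap_hom[OF *] y(1)[OF *(2)] by (auto simp: hom_def)
  qed (rule y(1)[OF *(1)])
  then have "restrict y (Ob orb) \<in> carrier (inv_lim orb F)" using y(1) by (auto simp: inv_lim_def)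
  from F0[OF this P] have "y P = \<one>\<^bsub>fobj F P\<^esub>" using P by simp
  then show ?thesis
    using y(2)[OF P] group_hom.hom_one[OF nat_trans_group_hom[OF R.cmodule_axioms I_cmodule R.aug_nat P]] by simp
qed

lemma higher_lim_trivial:
  assumes F0: "\<And>x P. x \<in> carrier (inv_lim orb F) \<Longrightarrow> P \<in> Ob orb \<Longrightarrow> x P = \<one>\<^bsub>fobj F P\<^esub>"
  shows "trivial_group (higher_lim orb I \<delta> i)"
proof -
  define W where "W = product_group (Ob orb) (fobj (I i))"
  define K where "K = kernel (inv_lim orb (I i)) (inv_lim orb (I (Suc i))) (inv_lim_map orb (\<delta> i))"
  define N where "N = (case i of 0 \<Rightarrow> {\<one>\<^bsub>inv_lim orb (I 0)\<^esub>}
          | Suc j \<Rightarrow> inv_lim_map orb (\<delta> j) ` carrier (inv_lim orb (I j)))"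
  have grp: "comm_group (fobj (I j) P)" if "P \<in> Ob orb" for j P
    using I_cmodule that by (rule cmodule.fobj_group)
  have grp': "group (fobj (I j) P)" if "P \<in> Ob orb" for j P
    using grp[OF that] by (simp add: comm_group_def)
  have lim: "x \<in> carrier (inv_lim orb (I j)) \<longleftrightarrow> x \<in> (\<Pi>\<^sub>E P\<in>Ob orb. carrier (fobj (I j) P)) \<and>
      (\<forall>P\<in>Ob orb. \<forall>Q\<in>Ob orb. \<forall>S\<in>Mor orb P Q. fmap (I j) P Q S (x Q) = x P)" for x j
    by (simp add: inv_lim_def)
  have K: "x \<in> K \<longleftrightarrow> x \<in> carrier (inv_lim orb (I i)) \<and> (\<forall>P\<in>Ob orb. \<delta> i P (x P) = \<one>\<^bsub>fobj (I (Suc i)) P\<^esub>)" for x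
    by (auto simp: K_def kernel_def inv_lim_map_def inv_lim_def restrict_def fun_eq_iff)
  have hom: "group_hom (fobj (I i) Q) (fobj (I i) P) (fmap (I i) P Q S)"
    if "P \<in> Ob orb" "Q \<in> Ob orb" "S \<in> Mor orb P Q" for P Q S
    using cmodule.fmap_hom[OF I_cmodule that] grp' that by (simp add: group_hom_def group_hom_axioms_def)
  have one_K: "(\<lambda>P\<in>Ob orb. \<one>\<^bsub>fobj (I i) P\<^esub>) \<in> K"
  proof -
    have "\<one>\<^bsub>fobj (I i) P\<^esub> \<in> carrier (fobj (I i) P)" if "P \<in> Ob orb" for P
      using group.is_monoid[OF grp'[OF that]] by (rule monoid.one_closed)
    then show ?thesis
      unfolding K lim using group_hom.hom_one[OF hom] group_hom.hom_one[OF \<delta>_group_hom] by auto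
  qed
  \<comment> \<open>In degree 0 the denominator is the trivial subgroup, which calls for
    \<open>F0\<close>; positive degrees are \<open>lim_exact\<close>. The quotient becomes
    \<open>K\<close> modulo \<open>K\<close>.\<close>
  have KN: "K = N"
  proof (cases i)
    case 0
    have K_one: "x = (\<lambda>P\<in>Ob orb. \<one>\<^bsub>fobj (I 0) P\<^esub>)" if "x \<in> K" for x
    proof -
      have "x P = \<one>\<^bsub>fobj (I 0) P\<^esub>" if P: "P \<in> Ob orb" for P
        using F0 _ _ P by (rule lim_0_trivial) (use \<open>x \<in> K\<close> in \<open>auto simp: K 0\<close>)
      moreover have "x \<in> extensional (Ob orb)" using \<open>x \<in> K\<close> unfolding K lim by (auto simp: PiE_def)
      ultimately show ?thesis by (intro extensionalityI[of _ "Ob orb"]) auto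
    qed
    have one_eq: "\<one>\<^bsub>inv_lim orb (I 0)\<^esub> = (\<lambda>P\<in>Ob orb. \<one>\<^bsub>fobj (I 0) P\<^esub>)"
      by (simp add: inv_lim_def)
    have "(\<lambda>P\<in>Ob orb. \<one>\<^bsub>fobj (I 0) P\<^esub>) \<in> K" using one_K unfolding 0 .
    then have "K = {\<one>\<^bsub>inv_lim orb (I 0)\<^esub>}" unfolding one_eq using K_one by blast
    then show ?thesis by (simp add: N_def 0)
  next
    case (Suc j)
    show ?thesis
    proof (intro equalityI subsetI)
      fix x assume "x \<in> K"
      then have x: "x \<in> carrier (inv_lim orb (I (Suc j)))"
        "\<And>P. P \<in> Ob orb \<Longrightarrow> \<delta> (Suc j) P (x P) = \<one>\<^bsub>fobj (I (Suc (Suc j))) P\<^esub>"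
        unfolding K Suc by auto
      obtain u where u: "u \<in> carrier (inv_lim orb (I j))" "\<forall>P\<in>Ob orb. x P = \<delta> j P (u P)"
        using lim_exact[OF x] by blast
      have "x = inv_lim_map orb (\<delta> j) u"
        unfolding inv_lim_map_def
        by (rule extensionalityI[of _ "Ob orb"]) (use x(1) u(2) in \<open>auto simp: lim PiE_def\<close>)
      then show "x \<in> N" using u(1) Suc by (simp add: N_def)
    next
      fix x assume "x \<in> N"
      then obtain u where u: "u \<in> carrier (inv_lim orb (I j))" "x = inv_lim_map orb (\<delta> j) u"
        using Suc by (auto simp: N_def)
      have uc: "u P \<in> carrier (fobj (I j) P)" if "P \<in> Ob orb" for P using u(1) that by (auto simp: lim)
      have "fmap (I (Suc j)) P Q S (\<delta> j Q (u Q)) = \<delta> j P (u P)"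
        if "P \<in> Ob orb" "Q \<in> Ob orb" "S \<in> Mor orb P Q" for P Q S
        using nat_trans_nat[OF R.diff_nat that uc[OF that(2)]] u(1) that by (simp add: lim)
      moreover have "\<delta> (Suc j) P (\<delta> j P (u P)) = \<one>\<^bsub>fobj (I (Suc (Suc j))) P\<^esub>"
        "\<delta> j P (u P) \<in> carrier (fobj (I (Suc j)) P)" if P: "P \<in> Ob orb" for P
        using \<delta>_\<delta>[OF P uc[OF P]] nat_trans_closed[OF R.diff_nat P uc[OF P]] .
      ultimately show "x \<in> K"
        unfolding K lim Suc u(2) inv_lim_map_def by auto
    qed
  qed
  have W: "group W" unfolding W_def using grp' by (rule product_group)
  have "subgroup K W"
  proof (rule group.subgroupI[OF W])
    show "K \<subseteq> carrier W" unfolding W_def using K lim by auto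
    show "K \<noteq> {}" using one_K by blast
    fix x assume x: "x \<in> K"
    have xc: "x P \<in> carrier (fobj (I i) P)" if "P \<in> Ob orb" for P using x that by (auto simp: K lim)
    have "inv\<^bsub>W\<^esub> x = (\<lambda>P\<in>Ob orb. inv\<^bsub>fobj (I i) P\<^esub> x P)"
      unfolding W_def using x grp' by (intro inv_product_group) (auto simp: K lim)
    also have "\<dots> \<in> K"
    proof -
      have "\<delta> i P (inv\<^bsub>fobj (I i) P\<^esub> x P) = \<one>\<^bsub>fobj (I (Suc i)) P\<^esub>"
        "inv\<^bsub>fobj (I i) P\<^esub> x P \<in> carrier (fobj (I i) P)" if P: "P \<in> Ob orb" for P
      proof -
        interpret d: group_hom "fobj (I i) P" "fobj (I (Suc i)) P" "\<delta> i P" using P by (rule \<delta>_group_hom)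
        show "\<delta> i P (inv\<^bsub>fobj (I i) P\<^esub> x P) = \<one>\<^bsub>fobj (I (Suc i)) P\<^esub>"
          "inv\<^bsub>fobj (I i) P\<^esub> x P \<in> carrier (fobj (I i) P)"
          using x P xc[OF P] by (auto simp: K)
      qed
      moreover have "fmap (I i) P Q S (inv\<^bsub>fobj (I i) Q\<^esub> x Q) = inv\<^bsub>fobj (I i) P\<^esub> x P"
        if *: "P \<in> Ob orb" "Q \<in> Ob orb" "S \<in> Mor orb P Q" for P Q S
      proof -
        have "fmap (I i) P Q S (x Q) = x P" using x * by (simp add: K lim)
        then show ?thesis using group_hom.hom_inv[OF hom[OF *] xc[OF *(2)]] by simp
      qed
      ultimately show ?thesis unfolding K lim by auto
    qed
    finally show "inv\<^bsub>W\<^esub> x \<in> K" .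
    fix y assume y: "y \<in> K"
    have yc: "y P \<in> carrier (fobj (I i) P)" if "P \<in> Ob orb" for P using y that by (auto simp: K lim)
    have "x \<otimes>\<^bsub>W\<^esub> y = (\<lambda>P\<in>Ob orb. x P \<otimes>\<^bsub>fobj (I i) P\<^esub> y P)" by (simp add: W_def)
    also have "\<dots> \<in> K"
    proof -
      have "\<delta> i P (x P \<otimes>\<^bsub>fobj (I i) P\<^esub> y P) = \<one>\<^bsub>fobj (I (Suc i)) P\<^esub>"
        "x P \<otimes>\<^bsub>fobj (I i) P\<^esub> y P \<in> carrier (fobj (I i) P)" if P: "P \<in> Ob orb" for P
      proof -
        interpret d: group_hom "fobj (I i) P" "fobj (I (Suc i)) P" "\<delta> i P" using P by (rule \<delta>_group_hom)
        show "\<delta> i P (x P \<otimes>\<^bsub>fobj (I i) P\<^esub> y P) = \<one>\<^bsub>fobj (I (Suc i)) P\<^esub>"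
          "x P \<otimes>\<^bsub>fobj (I i) P\<^esub> y P \<in> carrier (fobj (I i) P)"
          using x y P xc[OF P] yc[OF P] by (auto simp: K)
      qed
      moreover have "fmap (I i) P Q S (x Q \<otimes>\<^bsub>fobj (I i) Q\<^esub> y Q) = x P \<otimes>\<^bsub>fobj (I i) P\<^esub> y P"
        if *: "P \<in> Ob orb" "Q \<in> Ob orb" "S \<in> Mor orb P Q" for P Q S
      proof -
        have "fmap (I i) P Q S (x Q) = x P" "fmap (I i) P Q S (y Q) = y P" using x y * by (simp_all add: K lim)
        then show ?thesis using group_hom.hom_mult[OF hom[OF *] xc[OF *(2)] yc[OF *(2)]] by simp
      qed
      ultimately show ?thesis unfolding K lim by auto
    qed
    finally show "x \<otimes>\<^bsub>W\<^esub> y \<in> K" .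
  qed
  then interpret L: group "W\<lparr>carrier := K\<rparr>" using W by (rule subgroup.subgroup_is_group)
  have eq: "higher_lim orb I \<delta> i = (W\<lparr>carrier := K\<rparr>) Mod K"
    unfolding higher_lim_def K_def[symmetric] N_def[symmetric] KN[symmetric]
    by (simp add: inv_lim_def W_def)
  have "normal K (W\<lparr>carrier := K\<rparr>)"
    unfolding L.normal_inv_iff
  proof (intro conjI ballI)
    show "subgroup K (W\<lparr>carrier := K\<rparr>)" using L.subgroup_self by simp
    fix x h assume "x \<in> carrier (W\<lparr>carrier := K\<rparr>)" "h \<in> K"
    then have "x \<otimes>\<^bsub>W\<lparr>carrier := K\<rparr>\<^esub> h \<otimes>\<^bsub>W\<lparr>carrier := K\<rparr>\<^esub> inv\<^bsub>W\<lparr>carrier := K\<rparr>\<^esub> x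
        \<in> carrier (W\<lparr>carrier := K\<rparr>)"
      by (intro L.m_closed L.inv_closed) simp_all
    then show "x \<otimes>\<^bsub>W\<lparr>carrier := K\<rparr>\<^esub> h \<otimes>\<^bsub>W\<lparr>carrier := K\<rparr>\<^esub> inv\<^bsub>W\<lparr>carrier := K\<rparr>\<^esub> x \<in> K"
      by simp
  qed
  then interpret Q: group "(W\<lparr>carrier := K\<rparr>) Mod K" by (rule normal.factorgroup_is_group)
  have "carrier ((W\<lparr>carrier := K\<rparr>) Mod K) = {K}"
  proof -
    have "K #>\<^bsub>W\<lparr>carrier := K\<rparr>\<^esub> x = K" if "x \<in> K" for x
      using L.coset_join2[of x K] L.subgroup_self that by simp
    moreover have "\<one>\<^bsub>W\<lparr>carrier := K\<rparr>\<^esub> \<in> K" using L.one_closed by simp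
    ultimately show ?thesis unfolding FactGroup_def RCOSETS_def by (auto intro!: bexI[of _ "\<one>\<^bsub>W\<lparr>carrier := K\<rparr>\<^esub>"])
  qed
  then show ?thesis unfolding eq Q.trivial_group by blast
qed

end

end

section \<open>Cocycles with values in \<open>F\<^sub>M\<close>\<close>

text \<open>Transformations from \<open>E n\<close> live on chains with coefficients in
  \<open>int\<close>, \<open>ev\<close> on chains with coefficients in \<open>rat\<close>; this is
  the change of coefficients between them.\<close>

definition ratify :: "('x \<Rightarrow>\<^sub>0 int) \<Rightarrow> ('x \<Rightarrow>\<^sub>0 rat)" where
  "ratify = Poly_Mapping.map of_int"

lemma lookup_ratify [simp]: "lookup (ratify c) a = of_int (lookup c a)"
  by (simp add: ratify_def map.rep_eq when_def)

lemma keys_ratify: "keys (ratify c) = keys c"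
  by (auto simp: in_keys_iff)

lemma ratify_simps [simp]:
  "ratify 0 = 0" "ratify (c + d) = ratify c + ratify d" "ratify (c - d) = ratify c - ratify d"
  "ratify (scl k c) = scl (of_int k) (ratify c)" "ratify (single a k) = single a (of_int k)"
  by (rule poly_mapping_eqI; simp add: lookup_add lookup_minus lookup_single when_def)+

lemma ratify_sum: "ratify (sum f A) = (\<Sum>a\<in>A. ratify (f a))"
  by (induction A rule: infinite_finite_induct) simp_all

lemma ratify_push: "ratify (push f c) = push f (ratify c)"
  by (simp add: push_def lext_def ratify_sum keys_ratify)

lemma ratify_bd: "ratify (bd a) = bd a"
  by (induction a) (simp_all add: ratify_push)

context p_coefficients
begin

lemma integral_ratify: "integral (ratify c)"
  using Zp_of_int by (simp add: integral_def)

abbreviation F\<^sub>M :: "('a set, 'a set, 'm) cmod" where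
  "F\<^sub>M \<equiv> atomic_functor G M \<mu>"

lemma F\<^sub>M_one: "\<one>\<^bsub>fobj F\<^sub>M P\<^esub> = \<zero>\<^bsub>M\<^esub>"
  by (simp add: atomic_functor_def)

lemma F\<^sub>M_off_one: "P \<noteq> {\<one>} \<Longrightarrow> x \<in> carrier (fobj F\<^sub>M P) \<longleftrightarrow> x = \<zero>\<^bsub>M\<^esub>"
  by (simp add: atomic_functor_def)

lemma F\<^sub>M_at_one: "carrier (fobj F\<^sub>M {\<one>}) = carrier M"
  by (simp add: atomic_functor_def)

lemma one_Ob: "{\<one>} \<in> Ob orb"
  unfolding Ob_iff psub_def using triv_subgroup by (auto intro!: exI[of _ 0])

lemma tuples_one: "a \<in> tuples n {\<one>} \<longleftrightarrow> length a = n \<and> set a \<subseteq> T"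
  using act_one by (auto simp: tuples_def Fix_def)

lemma ev_eq_zero: "(\<And>a. a \<in> keys c \<Longrightarrow> f a = \<zero>\<^bsub>M\<^esub>) \<Longrightarrow> integral c \<Longrightarrow> ev f c = \<zero>\<^bsub>M\<^esub>"
  by (auto simp: ev_def integral_def intro!: M.add.finprod_one_eqI)

lemma nat_trans_F\<^sub>M_ev:
  assumes \<phi>: "nat_trans orb (E n) F\<^sub>M \<phi>" and f: "\<And>a. f a \<in> carrier M"
    and eq: "\<And>a. a \<in> tuples n {\<one>} \<Longrightarrow> f a = \<phi> {\<one>} (frag_of a)"
    and c: "c \<in> carrier (fobj (E n) {\<one>})"
  shows "\<phi> {\<one>} c = ev f (ratify c)"
proof (rule free_Abelian_group_hom_eq[OF cmodule.fobj_group[OF Mod.cmodule_atomic_functor one_Ob]])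
  show "\<phi> {\<one>} \<in> hom (free_Abelian_group (tuples n {\<one>})) (fobj F\<^sub>M {\<one>})"
    using nat_trans_hom[OF \<phi> one_Ob] by (simp add: E_simps)
  show "(\<lambda>c. ev f (ratify c)) \<in> hom (free_Abelian_group (tuples n {\<one>})) (fobj F\<^sub>M {\<one>})"
    using f ev_closed[OF f integral_ratify] ev_add[OF f integral_ratify integral_ratify]
    by (auto simp: hom_def atomic_functor_def)
  show "keys c \<subseteq> tuples n {\<one>}" using c by (simp add: E_simps)
  show "\<phi> {\<one>} (frag_of a) = ev f (ratify (frag_of a))" if "a \<in> tuples n {\<one>}" for a
    using eq[OF that] f smult_1[OF f[of a]] by (simp add: ev_single Zp_1)
qed

lemma the_elem_coset: "g \<in> carrier G \<Longrightarrow> the_elem ({\<one>} #> g) = g"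
  by (simp add: r_coset_def)

text \<open>At the trivial subgroup a cocycle is an equivariant function on tuples. Naturality along
  \<open>{\<one>} \<rightarrow> P\<close> makes it factor through the zero group at nontrivial
  \<open>P\<close>, so it vanishes on dead tuples and \<open>cochains_exact\<close> applies.
  Conversely, vanishing on dead tuples is what makes the primitive natural.\<close>

lemma cocycle_F\<^sub>M:
  assumes f: "cocycle (Suc n) F\<^sub>M f"
  shows "\<exists>x. nat_trans orb (E n) F\<^sub>M x \<and>
      (\<forall>P\<in>Ob orb. \<forall>c\<in>carrier (fobj (E (Suc n)) P). f P c = x P (lext bd c))"
proof -
  note F = Mod.cmodule_atomic_functor[of p]
  note f' = cocycleD(1)[OF f]
  have gen: "frag_of a \<in> carrier (fobj (E k) P)" if "a \<in> tuples k P" for a k P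
    using that by (simp add: E_simps)
  \<comment> \<open>\<open>cochains_exact\<close> treats all degrees at once, so the function is
    extended by zero to lists of other lengths.\<close>
  define m where "m a = (if length a = Suc n \<and> set a \<subseteq> T then f {\<one>} (frag_of a) else \<zero>\<^bsub>M\<^esub>)" for a
  have m_eq: "m a = f {\<one>} (frag_of a)" if "a \<in> tuples (Suc n) {\<one>}" for a
    using that by (simp add: m_def tuples_one)
  have m: "m a \<in> carrier M" for a
    using nat_trans_closed[OF f' one_Ob gen] F\<^sub>M_at_one by (auto simp: m_def tuples_one)
  have m_dead: "m a = \<zero>\<^bsub>M\<^esub>" if a: "set a \<subseteq> T" "\<not> live (carrier G) a" for a
  proof (cases "length a = Suc n")
    case True
    define P where "P = stab (carrier G) a"
    have P: "P \<in> Ob orb" unfolding P_def Ob_iff using a(1) True by (intro psub_stab subgroup_self) auto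
    have P1: "P \<noteq> {\<one>}" using a(2) live_iff_stab[OF subgroup_self, of a] by (auto simp: P_def)
    have aP: "a \<in> tuples (Suc n) P" using a(1) True by (auto simp: P_def tuples_def Fix_def stab_def)
    have S: "P #> \<one> \<in> Mor orb {\<one>} P"
      using subgroup.one_closed[OF Ob_subgroup[OF P]] by (intro MorI) auto
    have "\<one> \<in> P #> \<one>" by (rule rcos_self[OF subgroup.one_closed[OF subgroup_self] Ob_subgroup[OF P]])
    then have "pull (P #> \<one>) a = a"
      using pull_eq[OF one_Ob P S _ aP] mact_one[OF a(1)] by simp
    then have "m a = f {\<one>} (fmap (E (Suc n)) {\<one>} P (P #> \<one>) (frag_of a))"
      using a(1) True by (simp add: m_def E_simps)
    also have "\<dots> = fmap F\<^sub>M {\<one>} P (P #> \<one>) (f P (frag_of a))"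
      by (rule nat_trans_nat[OF f' one_Ob P S gen[OF aP]])
    also have "\<dots> = \<zero>\<^bsub>M\<^esub>" using P1 by (simp add: atomic_functor_def)
    finally show ?thesis .
  qed (simp add: m_def)
  have m_act: "m (mact g a) = \<mu> g (m a)" if a: "set a \<subseteq> T" and g: "g \<in> carrier G" for a g
  proof (cases "length a = Suc n")
    case True
    have a1: "a \<in> tuples (Suc n) {\<one>}" using a True by (simp add: tuples_one)
    \<comment> \<open>Both \<open>pull\<close> and the functor act through the inverse of a
      representative; the coset of \<open>inv g\<close> therefore gives the action of
      \<open>g\<close>.\<close>
    let ?S = "{\<one>} #> inv g"
    have S: "?S \<in> Mor orb {\<one>} {\<one>}" using g by (intro MorI) auto
    have "inv g \<in> ?S" using g by (simp add: r_coset_def)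
    then have "mact g a = pull ?S a" using pull_eq[OF one_Ob one_Ob S _ a1] g by simp
    then have "m (mact g a) = f {\<one>} (fmap (E (Suc n)) {\<one>} {\<one>} ?S (frag_of a))"
      using m_eq[OF pull_tuples[OF one_Ob one_Ob S a1]] by (simp add: E_simps)
    also have "\<dots> = fmap F\<^sub>M {\<one>} {\<one>} ?S (f {\<one>} (frag_of a))"
      by (rule nat_trans_nat[OF f' one_Ob one_Ob S gen[OF a1]])
    also have "\<dots> = \<mu> g (m a)"
      using g m_eq[OF a1] by (simp add: atomic_functor_def the_elem_coset)
    finally show ?thesis .
  qed (simp add: m_def \<mu>_zero[OF g])
  have m_bd: "ev m (bd a) = \<zero>\<^bsub>M\<^esub>" if a: "set a \<subseteq> T" for a
  proof (cases "length a = Suc (Suc n)")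
    case True
    have a1: "a \<in> tuples (Suc (Suc n)) {\<one>}" using a True by (simp add: tuples_one)
    have "ev m (bd a) = f {\<one>} (lext bd (frag_of a))"
      using nat_trans_F\<^sub>M_ev[OF f' m m_eq bd_closed[OF gen[OF a1]]] by (simp add: ratify_bd)
    also have "\<dots> = \<zero>\<^bsub>M\<^esub>" using cocycleD(2)[OF f one_Ob gen[OF a1]] by (simp add: F\<^sub>M_one)
    finally show ?thesis .
  next
    case False
    show ?thesis
    proof (intro ev_eq_zero integral_bd)
      fix \<sigma> assume \<sigma>: "\<sigma> \<in> keys (bd a :: _ \<Rightarrow>\<^sub>0 rat)"
      have "length \<sigma> \<noteq> Suc n" using keys_bd[OF \<sigma>] False by auto
      then show "m \<sigma> = \<zero>\<^bsub>M\<^esub>" by (simp add: m_def)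
    qed
  qed
  obtain x where x: "\<And>a. x a \<in> carrier M" "\<And>a. set a \<subseteq> T \<Longrightarrow> \<not> live (carrier G) a \<Longrightarrow> x a = \<zero>\<^bsub>M\<^esub>"
    "\<And>a g. set a \<subseteq> T \<Longrightarrow> g \<in> carrier G \<Longrightarrow> x (mact g a) = \<mu> g (x a)"
    "\<And>a. set a \<subseteq> T \<Longrightarrow> m a = ev x (bd a)"
    using cochains_exact[OF m m_dead m_act m_bd] by blast
  \<comment> \<open>Naturality from a nontrivial \<open>Q\<close> to the trivial subgroup asks
    \<open>x\<close> to vanish on pulled back tuples; these are fixed by a conjugate of
    \<open>Q\<close>, hence dead.\<close>
  define y where "y P a = (if P = {\<one>} then x a else \<zero>\<^bsub>M\<^esub>)" for P a
  obtain \<xi> where \<xi>: "nat_trans orb (E n) F\<^sub>M \<xi>"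
    "\<And>P a. P \<in> Ob orb \<Longrightarrow> a \<in> tuples n P \<Longrightarrow> \<xi> P (frag_of a) = y P a"
  proof (rule nat_trans_E_exists[OF F])
    show "y P a \<in> carrier (fobj F\<^sub>M P)" for P a
      using x(1) by (simp add: y_def atomic_functor_def)
    fix P Q S a assume P: "P \<in> Ob orb" and Q: "Q \<in> Ob orb" and S: "S \<in> Mor orb P Q" and a: "a \<in> tuples n Q"
    obtain g where g: "g \<in> S" using Mor_nonempty[OF P Q S] by blast
    note gS = MorD[OF P Q S g]
    have aT: "set a \<subseteq> T" using a by (rule tuplesD)
    have pa: "pull S a = mact (inv g) a" using P Q S g a by (rule pull_eq)
    show "y P (pull S a) = fmap F\<^sub>M P Q S (y Q a)"
    proof (cases "Q = {\<one>}")
      case True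
      have "h = \<one>" if h: "h \<in> P" for h
      proof -
        have hG: "h \<in> carrier G" using Ob_subgroup[OF P] h by (rule subgroup.mem_carrier)
        have "g \<otimes> h \<otimes> inv g = \<one>" using gS(3)[OF h] True by simp
        then show ?thesis by (rule conj_eq_one[OF gS(1) hG])
      qed
      then have "P = {\<one>}" using subgroup.one_closed[OF Ob_subgroup[OF P]] by blast
      moreover have "the_elem S = g" using gS(2) True the_elem_coset[OF gS(1)] by simp
      ultimately show ?thesis
        using True gS(1) x(3)[OF aT, of "inv g"] by (simp add: y_def pa atomic_functor_def)
    next
      case False
      have "y P (pull S a) = \<zero>\<^bsub>M\<^esub>"
      proof (cases "P = {\<one>}")
        case True
        obtain q where q: "q \<in> Q" "q \<noteq> \<one>" using False subgroup.one_closed[OF Ob_subgroup[OF Q]] by blast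
        have qG: "q \<in> carrier G" using Ob_subgroup[OF Q] q(1) by (rule subgroup.mem_carrier)
        define k where "k = inv g \<otimes> q \<otimes> g"
        have kG: "k \<in> carrier G" using qG gS(1) by (simp add: k_def)
        have "k \<noteq> \<one>"
          using conj_eq_one[of "inv g" q] qG gS(1) q(2) by (auto simp: k_def)
        moreover have "act k t = t" if "t \<in> set (pull S a)" for t
        proof -
          obtain s where s: "s \<in> set a" "t = act (inv g) s" using \<open>t \<in> _\<close> by (auto simp: pa)
          have "act q s = s" using a s(1) q(1) by (auto simp: tuples_def Fix_def)
          then show ?thesis
            using conj_fixes[of "inv g" q s] gS(1) qG s aT by (auto simp: k_def)
        qed
        ultimately have "\<not> live (carrier G) (pull S a)" using kG by (auto simp: live_def)
        moreover have "set (pull S a) \<subseteq> T" unfolding pa using gS(1) aT by (intro mact_closed) auto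
        ultimately show ?thesis using x(2) by (simp add: y_def)
      qed (simp add: y_def)
      then show ?thesis using False by (simp add: atomic_functor_def)
    qed
  qed (use that in blast)
  have "f P c = \<xi> P (lext bd c)" if P: "P \<in> Ob orb" and c: "c \<in> carrier (fobj (E (Suc n)) P)" for P c
  proof (cases "P = {\<one>}")
    case False
    then show ?thesis
      using nat_trans_closed[OF f' P c] nat_trans_closed[OF \<xi>(1) P bd_closed[OF c]] F\<^sub>M_off_one by simp
  next
    case True
    show ?thesis
    proof (rule nat_trans_E_eqI[OF F f' nat_trans_comp_bd[OF \<xi>(1)] P _ c])
      fix a assume "a \<in> tuples (Suc n) P"
      then have a: "a \<in> tuples (Suc n) {\<one>}" using True by simp
      have "\<xi> {\<one>} (lext bd (frag_of a)) = ev x (ratify (lext bd (frag_of a)))"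
        using \<xi>(2)[OF one_Ob] by (intro nat_trans_F\<^sub>M_ev[OF \<xi>(1) x(1) _ bd_closed[OF gen[OF a]]]) (simp add: y_def)
      then show "f P (frag_of a) = \<xi> P (lext bd (frag_of a))"
        using x(4)[of a] m_eq[OF a] a True by (simp add: ratify_bd tuples_one)
    qed
  qed
  then show ?thesis using \<xi>(1) by blast
qed

text \<open>An element of order \<open>p\<close> generates an object \<open>Q\<close> on which the
  functor vanishes, and the value at the trivial subgroup is the image of the value at
  \<open>Q\<close>.\<close>

lemma inv_lim_F\<^sub>M:
  assumes x: "x \<in> carrier (inv_lim orb F\<^sub>M)" and P: "P \<in> Ob orb"
  shows "x P = \<one>\<^bsub>fobj F\<^sub>M P\<^esub>"
proof (cases "P = {\<one>}")
  case False
  then show ?thesis using x P F\<^sub>M_off_one F\<^sub>M_one by (auto simp: inv_lim_def)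
next
  case True
  obtain h where h: "h \<in> H" "ord h = p" using order_p by blast
  have hG: "h \<in> carrier G" using h(1) subgroup_H by (meson subgroup.mem_carrier)
  define Q where "Q = generate G {h}"
  have Q: "subgroup Q G" unfolding Q_def using hG by (intro generate_is_subgroup) auto
  have finQ: "finite Q" using locally_finite hG by (simp add: locally_finite_group_def Q_def)
  have hQ: "h \<in> Q" by (simp add: Q_def generate.incl)
  have "ord y = p ^ 0 \<or> ord y = p ^ 1" if y: "y \<in> Q" for y
  proof -
    have "card Q = p" using generate_pow_card[OF hG] h(2) by (simp add: Q_def)
    then have "ord y dvd p" using ord_dvd_card[OF Q y finQ] by simp
    then show ?thesis using p by (auto simp: prime_nat_iff)
  qed
  then have QOb: "Q \<in> Ob orb" using Q unfolding Ob_iff psub_def by blast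
  have "Q \<noteq> {\<one>}" using hQ h(2) p by auto
  have S: "Q #> \<one> \<in> Mor orb {\<one>} Q" using subgroup.one_closed[OF Q] by (intro MorI) auto
  have "x {\<one>} = fmap F\<^sub>M {\<one>} Q (Q #> \<one>) (x Q)"
    using x one_Ob QOb S by (auto simp: inv_lim_def)
  then show ?thesis using \<open>Q \<noteq> {\<one>}\<close> True by (simp add: atomic_functor_def)
qed

theorem higher_lim_F\<^sub>M_trivial:
  assumes "injective_resolution orb F\<^sub>M I \<delta> \<epsilon>"
  shows "trivial_group (higher_lim orb I \<delta> i)"
  using assms cocycle_F\<^sub>M inv_lim_F\<^sub>M by (rule higher_lim_trivial)

end

section \<open>The set of cosets of \<open>p\<close>-subgroups\<close>

context group
begin

definition p_cosets :: "nat \<Rightarrow> 'a set set" where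
  "p_cosets p = {g <# P | g P. g \<in> carrier G \<and> psub p P}"

lemma conj_nat_pow: "g \<in> carrier G \<Longrightarrow> h \<in> carrier G \<Longrightarrow> (g \<otimes> h \<otimes> inv g) [^] (n::nat) = g \<otimes> h [^] n \<otimes> inv g"
proof (induction n)
  case (Suc n)
  have "(g \<otimes> h \<otimes> inv g) [^] Suc n = g \<otimes> h [^] n \<otimes> inv g \<otimes> (g \<otimes> h \<otimes> inv g)" using Suc by simp
  also have "\<dots> = g \<otimes> h [^] n \<otimes> (inv g \<otimes> g) \<otimes> h \<otimes> inv g" using Suc.prems by (simp only: m_assoc m_closed inv_closed nat_pow_closed)
  also have "\<dots> = g \<otimes> h [^] Suc n \<otimes> inv g" using Suc.prems by (simp add: m_assoc)
  finally show ?case .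
qed simp

text \<open>The elements fixing the coset \<open>h <# P\<close> are conjugates by \<open>h\<close>
  of elements of \<open>P\<close>, so their orders are powers of \<open>p\<close>; and a
  \<open>p\<close>-subgroup \<open>P\<close> fixes the point \<open>P\<close>.\<close>

lemma p_universal_p_cosets:
  assumes "Factorial_Ring.prime p"
  shows "p_universal p G (p_cosets p) (\<lambda>g t. g <# t)"
proof unfold_locales
  fix t assume "t \<in> p_cosets p"
  then obtain h P where t: "t = h <# P" "h \<in> carrier G" "psub p P" by (auto simp: p_cosets_def)
  have P: "subgroup P G" "P \<subseteq> carrier G" using t(3) by (auto simp: psub_def subgroup.subset)
  have tG: "t \<subseteq> carrier G" using t P by (simp add: l_coset_subset_G)
  show "\<one> <# t = t" using tG by (rule lcos_mult_one)
  fix g assume g: "g \<in> carrier G"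
  have "g <# t = (g \<otimes> h) <# P" using t g P by (simp add: lcos_m_assoc)
  then show "g <# t \<in> p_cosets p" using t g by (auto simp: p_cosets_def)
  show "(g \<otimes> k) <# t = g <# (k <# t)" if "k \<in> carrier G" for k
    using tG g that by (simp add: lcos_m_assoc)
  assume fix_t: "g <# t = t"
  have "h \<in> t"
    unfolding t(1) l_coset_def using subgroup.one_closed[OF P(1)] t(2) by (auto intro!: bexI[of _ \<one>])
  then have "g \<otimes> h \<in> g <# t" by (auto simp: l_coset_def)
  then obtain q where q: "q \<in> P" "g \<otimes> h = h \<otimes> q" using fix_t t(1) by (auto simp: l_coset_def)
  have qG: "q \<in> carrier G" using q(1) P by blast
  have "g = h \<otimes> q \<otimes> inv h" using q(2) g t(2) by (simp flip: q(2)) (simp add: m_assoc)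
  moreover obtain n where n: "ord q = p ^ n" using q(1) t(3) by (auto simp: psub_def)
  ultimately have "g [^] (p ^ n) = \<one>"
    using conj_nat_pow[OF t(2) qG] pow_ord_eq_1[OF qG] t(2) by simp
  then have "ord g dvd p ^ n" using g by (simp add: pow_eq_id)
  then show "\<exists>n. ord g = p ^ n" using divides_primepow_nat[OF assms] by blast
next
  fix P assume P: "psub p P"
  then have sub: "subgroup P G" by (simp add: psub_def)
  have "P = \<one> <# P" using lcos_mult_one[OF subgroup.subset[OF sub]] by simp
  then have "P \<in> p_cosets p" using P unfolding p_cosets_def by blast
  moreover have "g <# P = P" if "g \<in> P" for g
    using coset_join3[OF subgroup.mem_carrier[OF sub that] sub that] .
  ultimately show "\<exists>t\<in>p_cosets p. \<forall>g\<in>P. g <# t = t" by blast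
qed (use assms in auto)

end

theorem theorem4:
  fixes p :: nat
    and G :: "('g, 'z) monoid_scheme"
    and M :: "(rat, 'm, 'w) module_scheme"
    and act :: "'g \<Rightarrow> 'm \<Rightarrow> 'm"
    and I :: "nat \<Rightarrow> ('g set, 'g set, 'y) cmod"
    and \<delta> :: "nat \<Rightarrow> 'g set \<Rightarrow> 'y \<Rightarrow> 'y"
    and \<epsilon> :: "'g set \<Rightarrow> 'm \<Rightarrow> 'y"
    and i :: nat
  assumes "Factorial_Ring.prime p"
    and "locally_finite_group G"
    and "group_ring_module (localized_int p) G M act"
    and "\<exists>g\<in>action_kernel G M act. group.ord G g = p"
    and "injective_resolution (p_orbit_cat p G) (atomic_functor G M act) I \<delta> \<epsilon>"
  shows "trivial_group (higher_lim (p_orbit_cat p G) I \<delta> i)"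
proof -
  interpret Mod: group_ring_module "localized_int p" G M act by fact
  have "p_universal p G (group.p_cosets G p) (\<lambda>g t. g <#\<^bsub>G\<^esub> t)"
    using Mod.G.is_group assms(1) by (rule group.p_universal_p_cosets)
  then interpret C: p_coefficients p G "group.p_cosets G p" "\<lambda>g t. g <#\<^bsub>G\<^esub> t" M act "action_kernel G M act"
    using assms Mod.module_axioms Mod.group_ring_module_axioms
    by (simp add: p_coefficients_def p_coefficients_axioms_def Zp_module_def localization_def)
  show ?thesis using assms(5) by (rule C.higher_lim_F\<^sub>M_trivial)
qed

end
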